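(* Let $\beta,\gamma\in[0,1]$ and $F_0\ge0$. Let $K$ be a bounded coagulation kernel, let $F\colon(0,\infty)^2\to[0,\infty)$ be continuous and symmetric with $F(x,y)\le F_0(x^\gamma+y^\gamma)$ for $x,y>0$, let $\mu_{\mathrm{in}}\in\mathcal{M}_b^+(0,1]$ and let $g$ be a boundary datum with $M_{\max\{\beta,\gamma\}}<\infty$. Then there is a unique $\mu\in C\big([0,\infty);\mathcal{M}_b^+(0,1]\big)$ such that $$\langle\mu_t,\varphi\rangle=\langle\mu_{\mathrm{in}},\varphi\rangle+\int_0^t\Big(\tfrac12\langle\mu_s\otimes\mu_s,K\mathcal{A}[\varphi]\rangle-\langle\mu_s,\mathcal{G}_s\varphi+\mathcal{B}[\varphi]\rangle+\langle\mathcal{L},\mathcal{C}_s\varphi\rangle\Big)ds$$ for all $t\ge0$ and all bounded Borel functions $\varphi\colon(0,1]\to\mathbb{R}$.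
   Context: A bounded coagulation kernel is a nonnegative symmetric Borel function $K\colon(0,\infty)^2\to\mathbb{R}$ such that $\sup_{x,y\in(0,1]}K(x,y)<\infty$ and there is $K_\beta>0$ with $\sup_{x\in(0,1]}K(x,y)\le K_\beta\,y^\beta$ for all $y\in(1,\infty)$. $\mathcal{M}_b^+(0,1]$ is the set of finite nonnegative Borel measures on $(0,1]$, with the topology of the total variation norm. $\langle\mu,\varphi\rangle=\int\varphi\,d\mu$; $\mathcal{L}$ is Lebesgue measure on $(0,1]$. A boundary datum is a nonnegative continuous map $g\colon[0,\infty)\to L^1(1,\infty)$, $t\mapsto g(t,\cdot)$. For $\lambda\in\mathbb{R}$, $M_\lambda=\sup_{t\ge0}\int_1^\infty x^\lambda g(t,x)\,dx$. For $\varphi\colon(0,1]\to\mathbb{R}$ let $\overline{\varphi}(x)=\varphi(x)$ for $x\in(0,1]$ and $\overline\varphi(x)=\varphi(1)$ for $x>1$. For $x,y\in(0,1]$, $$\mathcal{A}[\varphi](x,y)=\overline\varphi(x+y)-\varphi(x)-\varphi(y),\qquad \mathcal{B}[\varphi](x)=\tfrac12\int_0^xF(x-y,y)\big(\varphi(x)-\varphi(x-y)-\varphi(y)\big)\,dy,$$ $$\mathcal{G}_t(x)=\int_1^\infty K(x,y)g(t,y)\,dy,\qquad \mathcal{C}_t(x)=\int_1^\infty F(y-x,x)g(t,y)\,dy.$$ *)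

theory Defs
  imports "HOL-Analysis.Analysis"
begin

section \<open>Coagulation kernels\<close>

text \<open>Functions on $(0,\infty)^2$, $(0,1]$ or $(1,\infty)$ are total functions on \<^typ>\<open>real\<close> that are
  constrained and evaluated only on the stated domain. The bound by $K_\beta y^\beta$ is written
  pointwise, because the real-valued supremum of an unbounded set carries no information.\<close>

definition bounded_coagulation_kernel :: "real \<Rightarrow> (real \<Rightarrow> real \<Rightarrow> real) \<Rightarrow> bool" where
  "bounded_coagulation_kernel \<beta> K \<longleftrightarrow>
     (\<forall>x>0. \<forall>y>0. 0 \<le> K x y \<and> K x y = K y x) \<and>
     (\<lambda>(x, y). K x y) \<in> borel_measurable (restrict_space borel ({0<..} \<times> {0<..})) \<and>
     bdd_above ((\<lambda>(x, y). K x y) ` ({0<..1} \<times> {0<..1})) \<and>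
     (\<exists>K\<^sub>\<beta>>0. \<forall>y>1. \<forall>x\<in>{0<..1}. K x y \<le> K\<^sub>\<beta> * y powr \<beta>)"

section \<open>Finite measures on the half-open unit interval\<close>

definition finite_measures :: "real measure set" where
  "finite_measures = {M. sets M = sets (restrict_space borel {0<..1}) \<and> finite_measure M}"

text \<open>The total variation norm $\|M-N\|$ of the difference of two finite measures on the same
  \<open>\<sigma>\<close>-algebra, as the supremum over finite measurable partitions of the space.\<close>

definition tv_dist :: "'a measure \<Rightarrow> 'a measure \<Rightarrow> ennreal" where
  "tv_dist M N =
     (SUP P\<in>{P. finite P \<and> P \<subseteq> sets M \<and> partition_on (space M) P}.
        \<Sum>A\<in>P. ennreal \<bar>measure M A - measure N A\<bar>)"

definition tv_continuous :: "(real \<Rightarrow> 'a measure) \<Rightarrow> bool" where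
  "tv_continuous \<mu> \<longleftrightarrow>
     (\<forall>t\<ge>0. ((\<lambda>s. tv_dist (\<mu> s) (\<mu> t)) \<longlongrightarrow> 0) (at t within {0..}))"

section \<open>Boundary data\<close>

text \<open>Elements of $L^1(1,\infty)$ are given by Borel representatives, so nonnegativity is
  required almost everywhere only.\<close>

definition boundary_datum :: "(real \<Rightarrow> real \<Rightarrow> real) \<Rightarrow> bool" where
  "boundary_datum g \<longleftrightarrow>
     (\<forall>t\<ge>0. set_integrable lborel {1<..} (g t)) \<and>
     (\<forall>t\<ge>0. AE x in lborel. 1 < x \<longrightarrow> 0 \<le> g t x) \<and>
     (\<forall>t\<ge>0. ((\<lambda>s. LINT x:{1<..}|lborel. \<bar>g s x - g t x\<bar>) \<longlongrightarrow> 0) (at t within {0..}))"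

definition boundary_moment :: "(real \<Rightarrow> real \<Rightarrow> real) \<Rightarrow> real \<Rightarrow> ennreal" where
  "boundary_moment g r = (SUP t\<in>{0..}. \<integral>\<^sup>+x\<in>{1<..}. ennreal (x powr r * g t x) \<partial>lborel)"

section \<open>The weak formulation\<close>

definition const_ext :: "(real \<Rightarrow> real) \<Rightarrow> real \<Rightarrow> real" where
  "const_ext \<phi> x = (if x \<le> 1 then \<phi> x else \<phi> 1)"

definition coag_A :: "(real \<Rightarrow> real) \<Rightarrow> real \<Rightarrow> real \<Rightarrow> real" where
  "coag_A \<phi> x y = const_ext \<phi> (x + y) - \<phi> x - \<phi> y"

definition frag_B :: "(real \<Rightarrow> real \<Rightarrow> real) \<Rightarrow> (real \<Rightarrow> real) \<Rightarrow> real \<Rightarrow> real" where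
  "frag_B F \<phi> x = 1/2 * (LINT y:{0<..<x}|lborel. F (x - y) y * (\<phi> x - \<phi> (x - y) - \<phi> y))"

definition boundary_G ::
    "(real \<Rightarrow> real \<Rightarrow> real) \<Rightarrow> (real \<Rightarrow> real \<Rightarrow> real) \<Rightarrow> real \<Rightarrow> real \<Rightarrow> real" where
  "boundary_G K g t x = (LINT y:{1<..}|lborel. K x y * g t y)"

definition boundary_C ::
    "(real \<Rightarrow> real \<Rightarrow> real) \<Rightarrow> (real \<Rightarrow> real \<Rightarrow> real) \<Rightarrow> real \<Rightarrow> real \<Rightarrow> real" where
  "boundary_C F g t x = (LINT y:{1<..}|lborel. F (y - x) x * g t y)"

definition weak_rhs ::
    "(real \<Rightarrow> real \<Rightarrow> real) \<Rightarrow> (real \<Rightarrow> real \<Rightarrow> real) \<Rightarrow> (real \<Rightarrow> real \<Rightarrow> real) \<Rightarrow>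
     (real \<Rightarrow> real measure) \<Rightarrow> (real \<Rightarrow> real) \<Rightarrow> real \<Rightarrow> real" where
  "weak_rhs K F g \<mu> \<phi> s =
     1/2 * (LINT p|(\<mu> s \<Otimes>\<^sub>M \<mu> s). K (fst p) (snd p) * coag_A \<phi> (fst p) (snd p))
     - (LINT x|\<mu> s. boundary_G K g s x * \<phi> x + frag_B F \<phi> x)
     + (LINT x:{0<..1}|lborel. boundary_C F g s x * \<phi> x)"

text \<open>Values of \<open>\<mu>\<close> at negative times are irrelevant.\<close>

definition weak_solution ::
    "(real \<Rightarrow> real \<Rightarrow> real) \<Rightarrow> (real \<Rightarrow> real \<Rightarrow> real) \<Rightarrow> (real \<Rightarrow> real \<Rightarrow> real) \<Rightarrow>
     real measure \<Rightarrow> (real \<Rightarrow> real measure) \<Rightarrow> bool" where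
  "weak_solution K F g \<mu>\<^sub>i\<^sub>n \<mu> \<longleftrightarrow>
     (\<forall>t\<ge>0. \<mu> t \<in> finite_measures) \<and> tv_continuous \<mu> \<and>
     (\<forall>t\<ge>0. \<forall>\<phi>. \<phi> \<in> borel_measurable (restrict_space borel {0<..1}) \<and> bounded (\<phi> ` {0<..1}) \<longrightarrow>
        (LINT x|\<mu> t. \<phi> x) = (LINT x|\<mu>\<^sub>i\<^sub>n. \<phi> x) + (LINT s:{0..t}|lborel. weak_rhs K F g \<mu> \<phi> s))"

end

theory Submission
  imports Defs
begin

text \<open>Testing with \<open>\<phi>\<close> turns the weak equation into an ordinary differential equation
  \<open>\<mu>' = W\<^sub>t(\<mu>)\<close> for finite measures, where \<open>W\<^sub>t\<close> is Lipschitz in total variation on sets of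
  bounded mass, with a constant that does not depend on \<open>t\<close>.
  Uniqueness follows by iterating this Lipschitz bound. For existence
  the difficulty is positivity. If \<open>\<mu>\<close> has mass at most \<open>R\<close>, then all loss terms are bounded by
  \<open>(p + q R) \<mu>\<close>, and the total mass grows at rate at most \<open>p (mass + 1)\<close>. So with
  \<open>\<rho>(t) = (\<parallel>\<mu>\<^sub>0\<parallel> + 1) e\<^bsup>2pt\<^esup>\<close>, \<open>\<theta> = p + q \<rho>\<close> and \<open>\<Theta>' = \<theta>\<close> the mild equation
  \<open>\<mu>\<^sub>t = e\<^bsup>-\<Theta>(t)\<^esup> (\<mu>\<^sub>0 + \<integral>\<^sub>0\<^sup>t e\<^bsup>\<Theta>(s)\<^esup> (\<theta>(s) \<mu>\<^sub>s + W\<^sub>s(\<mu>\<^sub>s)) ds)\<close> maps nonnegative measures of mass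
  at most \<open>\<rho>\<close> to such measures. Picard iteration then converges globally in time, and Fubini turns the mild
  equation back into the original one.\<close>

section \<open>Finite measures as functionals\<close>

text \<open>The quadratic coagulation term is what could prevent a global solution, but it has two
  favourable features. Tested with 1 it is nonpositive, because A[1] = -1; hence the total mass
  obeys an affine differential inequality although W itself is quadratic. And its loss part is the
  measure times a rate that is bounded by a constant times the total mass, so an a priori mass bound
  makes this loss linear. The first feature gives \<rho>, the second \<theta>. Picard iteration of
  the original equation could leave the cone of nonnegative measures; after \<theta> \<mu> has been
  added and compensated by the integrating factor, the integrand is nonnegative. As \<rho> bounds
  all iterates in advance, the Lipschitz constants are uniform on [0,T], the n-th difference decays
  like c^n / n!, and no short time intervals have to be glued. The moment of order max(\<beta>,
  \<gamma>) is what bounds G_t and C_t on (0,1]: for x <= 1 < y the weights K(x,y) and F(y-x,x) are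
  at most constants times y^\<beta> and y^\<gamma>.\<close>

definition finite_on :: "'a measure \<Rightarrow> 'a measure set" where
  "finite_on S = {M. sets M = sets S \<and> finite_measure M}"

definition bdd_fun :: "'a measure \<Rightarrow> ('a \<Rightarrow> real) set" where
  "bdd_fun S = {\<phi> \<in> borel_measurable S. bounded (\<phi> ` space S)}"

definition unit_fun :: "'a measure \<Rightarrow> ('a \<Rightarrow> real) set" where
  "unit_fun S = {\<phi> \<in> borel_measurable S. \<forall>x\<in>space S. \<bar>\<phi> x\<bar> \<le> 1}"

text \<open>Dual form of the statement that the total variation norm of M - N is at most e. For
  finite measures on S and e >= 0 it is equivalent to a bound on \<open>tv_dist\<close>, and it fits
  measures that are known only through their integrals.\<close>

definition tv_le :: "'a measure \<Rightarrow> 'a measure \<Rightarrow> 'a measure \<Rightarrow> real \<Rightarrow> bool" where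
  "tv_le S M N e \<longleftrightarrow> (\<forall>\<phi>\<in>unit_fun S. \<bar>(LINT x|M. \<phi> x) - (LINT x|N. \<phi> x)\<bar> \<le> e)"

abbreviation mass :: "'a measure \<Rightarrow> real" where
  "mass M \<equiv> measure M (space M)"

lemma finite_onD:
  assumes "M \<in> finite_on S"
  shows "sets M = sets S" "space M = space S" "finite_measure M"
    "borel_measurable M = borel_measurable S"
proof -
  show *: "sets M = sets S" "finite_measure M" using assms by (auto simp: finite_on_def)
  show "space M = space S" using *(1) by (rule sets_eq_imp_space_eq)
  show "borel_measurable M = borel_measurable S" using *(1) by (rule measurable_cong_sets) simp
qed

lemma bdd_funI:
  assumes "\<phi> \<in> borel_measurable S" "\<And>x. x \<in> space S \<Longrightarrow> \<bar>\<phi> x\<bar> \<le> c"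
  shows "\<phi> \<in> bdd_fun S"
  using assms by (auto simp: bdd_fun_def bounded_iff intro!: exI[of _ c])

lemma bdd_funE:
  assumes "\<phi> \<in> bdd_fun S"
  obtains c where "c > 0" "\<phi> \<in> borel_measurable S" "\<And>x. x \<in> space S \<Longrightarrow> \<bar>\<phi> x\<bar> \<le> c"
proof -
  obtain c where "c > 0" "\<forall>y\<in>\<phi> ` space S. norm y \<le> c"
    using assms by (auto simp: bdd_fun_def bounded_pos)
  then show thesis
    using assms by (intro that[of c]) (auto simp: bdd_fun_def)
qed

lemma unit_funI:
  assumes "\<phi> \<in> borel_measurable S" "\<And>x. x \<in> space S \<Longrightarrow> \<bar>\<phi> x\<bar> \<le> 1"
  shows "\<phi> \<in> unit_fun S"
  using assms by (auto simp: unit_fun_def)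

lemma unit_funD:
  assumes "\<phi> \<in> unit_fun S"
  shows "\<phi> \<in> borel_measurable S" "x \<in> space S \<Longrightarrow> \<bar>\<phi> x\<bar> \<le> 1"
  using assms by (auto simp: unit_fun_def)

lemma unit_fun_bdd: "\<phi> \<in> unit_fun S \<Longrightarrow> \<phi> \<in> bdd_fun S"
  by (auto simp: unit_fun_def intro: bdd_funI)

lemma const_unit: "\<bar>c\<bar> \<le> 1 \<Longrightarrow> (\<lambda>_. c) \<in> unit_fun S"
  by (auto simp: unit_fun_def)

lemma indicator_unit: "A \<in> sets S \<Longrightarrow> indicator A \<in> unit_fun S"
  by (auto simp: unit_fun_def indicator_def)

lemma bdd_fun_scaled:
  assumes "\<phi> \<in> bdd_fun S"
  obtains c \<psi> where "c > 0" "\<psi> \<in> unit_fun S" "\<phi> = (\<lambda>x. c * \<psi> x)"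
proof -
  obtain c where c: "c > 0" "\<phi> \<in> borel_measurable S" "\<And>x. x \<in> space S \<Longrightarrow> \<bar>\<phi> x\<bar> \<le> c"
    using assms by (rule bdd_funE) blast
  show thesis
    by (rule that[of c "\<lambda>x. \<phi> x / c"]) (use c in \<open>auto intro!: unit_funI simp: divide_simps\<close>)
qed

lemma bdd_fun_add: "\<phi> \<in> bdd_fun S \<Longrightarrow> \<psi> \<in> bdd_fun S \<Longrightarrow> (\<lambda>x. \<phi> x + \<psi> x) \<in> bdd_fun S"
  by (auto simp: bdd_fun_def intro: bounded_plus_comp)

lemma bdd_fun_scale: "\<phi> \<in> bdd_fun S \<Longrightarrow> (\<lambda>x. c * \<phi> x) \<in> bdd_fun S"
proof -
  assume "\<phi> \<in> bdd_fun S"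
  then obtain k where "k > 0" "\<phi> \<in> borel_measurable S" "\<And>x. x \<in> space S \<Longrightarrow> \<bar>\<phi> x\<bar> \<le> k"
    by (rule bdd_funE) blast
  then show ?thesis
    by (intro bdd_funI[of _ _ "\<bar>c\<bar> * k"]) (auto simp: abs_mult mult_left_mono)
qed

lemma integrable_bounded:
  fixes \<phi> :: "'a \<Rightarrow> real"
  assumes "finite_measure M" "\<phi> \<in> borel_measurable M" "\<And>x. x \<in> space M \<Longrightarrow> \<bar>\<phi> x\<bar> \<le> c"
  shows "integrable M \<phi>"
  using assms by (intro finite_measure.integrable_const_bound[of _ _ c]) auto

lemma integral_bounded:
  fixes \<phi> :: "'a \<Rightarrow> real"
  assumes "finite_measure M" "\<phi> \<in> borel_measurable M" "\<And>x. x \<in> space M \<Longrightarrow> \<bar>\<phi> x\<bar> \<le> c"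
  shows "\<bar>LINT x|M. \<phi> x\<bar> \<le> c * mass M"
proof -
  interpret finite_measure M by fact
  have "\<bar>LINT x|M. \<phi> x\<bar> \<le> (LINT x|M. \<bar>\<phi> x\<bar>)"
    by (rule integral_abs_bound)
  also have "\<dots> \<le> (LINT x|M. c)"
    by (intro integral_mono integrable_abs integrable_bounded[OF assms] integrable_const assms(3))
  finally show ?thesis by (simp add: mult.commute)
qed

lemma integral_tendsto_bounded:
  fixes \<phi> :: "nat \<Rightarrow> 'a \<Rightarrow> real"
  assumes "finite_measure M" "\<And>n. \<phi> n \<in> borel_measurable M" "\<phi>' \<in> borel_measurable M"
    and "\<And>n x. x \<in> space M \<Longrightarrow> \<bar>\<phi> n x\<bar> \<le> c"
    and "\<And>x. x \<in> space M \<Longrightarrow> (\<lambda>n. \<phi> n x) \<longlonglongrightarrow> \<phi>' x"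
  shows "(\<lambda>n. LINT x|M. \<phi> n x) \<longlonglongrightarrow> (LINT x|M. \<phi>' x)"
proof -
  interpret finite_measure M by fact
  show ?thesis
    by (rule integral_dominated_convergence[where w = "\<lambda>_. c"]) (use assms in auto)
qed

lemma finite_on_integrable: "M \<in> finite_on S \<Longrightarrow> \<phi> \<in> bdd_fun S \<Longrightarrow> integrable M \<phi>"
  by (metis bdd_funE finite_onD integrable_bounded)

lemma finite_on_integral_le:
  assumes "M \<in> finite_on S" "\<phi> \<in> unit_fun S"
  shows "\<bar>LINT x|M. \<phi> x\<bar> \<le> mass M"
proof -
  note M = finite_onD[OF assms(1)]
  have "\<bar>LINT x|M. \<phi> x\<bar> \<le> 1 * mass M"
    using M unit_funD[OF assms(2)] by (intro integral_bounded) simp_all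
  then show ?thesis by simp
qed

lemma unit_fun_limit:
  assumes "\<And>n. \<phi> n \<in> unit_fun S" "\<And>x. x \<in> space S \<Longrightarrow> (\<lambda>n. \<phi> n x) \<longlonglongrightarrow> \<phi>' x"
  shows "\<phi>' \<in> unit_fun S"
proof (rule unit_funI)
  show "\<phi>' \<in> borel_measurable S"
    by (rule borel_measurable_LIMSEQ_real[OF assms(2) unit_funD(1)[OF assms(1)]])
  show "\<bar>\<phi>' x\<bar> \<le> 1" if "x \<in> space S" for x
    by (rule tendsto_upperbound[OF tendsto_rabs[OF assms(2)[OF that]]])
      (simp_all add: unit_funD(2)[OF assms(1) that])
qed

text \<open>Limits and time integrals of measures are formed as functionals and turned back into
  measures here, so that no normed space of signed measures is needed.\<close>

lemma functional_representation:
  fixes J :: "('a \<Rightarrow> real) \<Rightarrow> real"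
  assumes add: "\<And>\<phi> \<psi>. \<phi> \<in> bdd_fun S \<Longrightarrow> \<psi> \<in> bdd_fun S \<Longrightarrow> J (\<lambda>x. \<phi> x + \<psi> x) = J \<phi> + J \<psi>"
    and scale: "\<And>c \<phi>. \<phi> \<in> bdd_fun S \<Longrightarrow> J (\<lambda>x. c * \<phi> x) = c * J \<phi>"
    and pos: "\<And>\<phi>. \<phi> \<in> unit_fun S \<Longrightarrow> (\<And>x. x \<in> space S \<Longrightarrow> 0 \<le> \<phi> x) \<Longrightarrow> 0 \<le> J \<phi>"
    and lim: "\<And>\<phi> \<phi>'. (\<And>n. \<phi> n \<in> unit_fun S) \<Longrightarrow>
      (\<And>x. x \<in> space S \<Longrightarrow> (\<lambda>n. \<phi> n x) \<longlonglongrightarrow> \<phi>' x) \<Longrightarrow> (\<lambda>n. J (\<phi> n)) \<longlonglongrightarrow> J \<phi>'"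
  shows "\<exists>M\<in>finite_on S. \<forall>\<phi>\<in>bdd_fun S. (LINT x|M. \<phi> x) = J \<phi>"
proof -
  have J0: "J (\<lambda>_. 0) = 0"
    using scale[of "\<lambda>_. 0" 0] unit_fun_bdd[OF const_unit[of 0 S]] by simp
  have J_sum: "J (\<lambda>x. \<Sum>i<(n::nat). \<phi> i x) = (\<Sum>i<n. J (\<phi> i)) \<and> (\<lambda>x. \<Sum>i<n. \<phi> i x) \<in> bdd_fun S"
    if "\<And>i. \<phi> i \<in> bdd_fun S" for \<phi> n
    by (induction n) (use that in \<open>auto simp: J0 add intro: bdd_fun_add unit_fun_bdd[OF const_unit]\<close>)
  define M where "M = measure_of (space S) (sets S) (\<lambda>A. ennreal (J (indicator A)))"
  have sets_M: "sets M = sets S" "space M = space S"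
    by (simp_all add: M_def)
  have emeasure_M: "emeasure M A = ennreal (J (indicator A))" if "A \<in> sets S" for A
    unfolding M_def
  proof (rule emeasure_measure_of_sigma)
    show "sigma_algebra (space S) (sets S)" "A \<in> sets S" by (rule sets.sigma_algebra_axioms) fact
    have "J (indicator {}) = 0" by (simp add: J0 indicator_def[abs_def])
    then show "positive (sets S) (\<lambda>A. ennreal (J (indicator A)))"
      by (simp add: positive_def)
    show "countably_additive (sets S) (\<lambda>A. ennreal (J (indicator A)))"
    proof (rule countably_additiveI)
      fix A :: "nat \<Rightarrow> 'a set" assume A: "range A \<subseteq> sets S" "disjoint_family A" "\<Union> (range A) \<in> sets S"
      have part: "(\<lambda>x. \<Sum>i<n. indicator (A i) x) = (indicator (\<Union>i<n. A i) :: 'a \<Rightarrow> real)" for n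
        using A(2) by (auto simp: indicator_UN_disjoint disjoint_family_on_def fun_eq_iff)
      \<comment> \<open>Countable additivity is the continuity assumption \<open>lim\<close>,
        applied to the indicators of the partial unions.\<close>
      have "(\<lambda>n. J (indicator (\<Union>i<n. A i))) \<longlonglongrightarrow> J (indicator (\<Union> (range A)))"
      proof (rule lim)
        show "indicator (\<Union>i<n. A i) \<in> unit_fun S" for n
          using A by (intro indicator_unit) auto
        show "(\<lambda>n. indicator (\<Union>i<n. A i) x) \<longlonglongrightarrow> (indicator (\<Union> (range A)) x :: real)" for x
          by (rule LIMSEQ_indicator_UN)
      qed
      moreover have "J (indicator (\<Union>i<n. A i)) = (\<Sum>i<n. J (indicator (A i)))" for n
        unfolding part[symmetric] using A(1) by (intro conjunct1[OF J_sum] unit_fun_bdd indicator_unit) auto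
      ultimately have "(\<lambda>i. J (indicator (A i))) sums J (indicator (\<Union> (range A)))"
        by (simp add: sums_def)
      then show "(\<Sum>i. ennreal (J (indicator (A i)))) = ennreal (J (indicator (\<Union> (range A))))"
        using A by (intro suminf_ennreal_eq pos indicator_unit) auto
    qed
  qed
  have fin: "M \<in> finite_on S"
    unfolding finite_on_def using sets_M emeasure_M[of "space S"]
    by (auto intro!: finite_measureI)
  have "(LINT x|M. \<phi> x) = J \<phi>" if \<phi>: "\<phi> \<in> unit_fun S" "\<And>x. 0 \<le> \<phi> x" for \<phi>
  proof -
    have "\<phi> \<in> borel_measurable S" using unit_funD[OF \<phi>(1)] by simp
    \<comment> \<open>The induction supplies only measurable nonnegative pieces. Boundedness is
      therefore a premise inside the induction claim, and each case passes it from the composed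
      function back to its pieces.\<close>
    then have "\<phi> \<in> bdd_fun S \<longrightarrow> (LINT x|M. \<phi> x) = J \<phi>"
      using \<phi>(2)
    proof (induction rule: borel_measurable_induct_real)
      case (set A)
      then show ?case
        using emeasure_M[OF set] pos[OF indicator_unit[OF set]] sets_M
        by (auto simp: measure_def sets.Int_space_eq2)
    next
      case (mult u c)
      show ?case
      proof (cases "c = 0")
        case True then show ?thesis by (simp add: J0)
      next
        case False
        show ?thesis
        proof
          assume "(\<lambda>x. c * u x) \<in> bdd_fun S"
          from bdd_fun_scale[OF this, of "1 / c"] have "u \<in> bdd_fun S"
            using False by simp
          then show "(LINT x|M. c * u x) = J (\<lambda>x. c * u x)"
            using mult.IH scale[of u c] by simp
        qed
      qed
    next
      case (add u v)
      show ?case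
      proof
        assume "(\<lambda>x. v x + u x) \<in> bdd_fun S"
        then obtain c where c: "\<And>x. x \<in> space S \<Longrightarrow> \<bar>v x + u x\<bar> \<le> c" by (rule bdd_funE) blast
        have "\<bar>u x\<bar> \<le> c \<and> \<bar>v x\<bar> \<le> c" if "x \<in> space S" for x
          using c[OF that] add.hyps(2)[of x] add.hyps(4)[of x] by linarith
        then have "u \<in> bdd_fun S" "v \<in> bdd_fun S"
          using add.hyps(1,3) by (auto intro: bdd_funI[of _ _ c])
        with add.IH have eq: "(LINT x|M. u x) = J u" "(LINT x|M. v x) = J v" by auto
        have "J (\<lambda>x. v x + u x) = J v + J u"
          by (rule assms(1)) fact+
        also have "\<dots> = (LINT x|M. v x + u x)"
          unfolding eq[symmetric]
          by (intro Bochner_Integration.integral_add[symmetric] finite_on_integrable[OF fin]) fact+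
        finally show "(LINT x|M. v x + u x) = J (\<lambda>x. v x + u x)" ..
      qed
    next
      case (seq U)
      show ?case
      proof
        have U_le: "U i x \<le> \<phi> x" if "x \<in> space S" for i x
          using seq.hyps(3) seq.hyps(4)[OF that] by (intro incseq_le) (auto simp: incseq_def le_fun_def)
        have U: "U i \<in> unit_fun S" for i
        proof (rule unit_funI)
          show "\<bar>U i x\<bar> \<le> 1" if "x \<in> space S" for x
            using U_le[OF that, of i] seq.hyps(2)[of i x] unit_funD(2)[OF \<phi>(1) that] by simp
        qed (rule seq.hyps)
        have "(\<lambda>i. LINT x|M. U i x) \<longlonglongrightarrow> (LINT x|M. \<phi> x)"
          using unit_funD[OF U] unit_funD[OF \<phi>(1)] seq.hyps(4) finite_onD[OF fin]
          by (intro integral_tendsto_bounded[where c = 1]) auto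
        moreover have "(\<lambda>i. LINT x|M. U i x) \<longlonglongrightarrow> J \<phi>"
          using lim[of U \<phi>, OF U seq.hyps(4)] seq.IH unit_fun_bdd[OF U] by simp
        ultimately show "(LINT x|M. \<phi> x) = J \<phi>" by (rule LIMSEQ_unique)
      qed
    qed
    then show ?thesis using unit_fun_bdd \<phi> by auto
  qed
  note nonneg = this
  have unit: "(LINT x|M. \<phi> x) = J \<phi>" if \<phi>: "\<phi> \<in> unit_fun S" for \<phi>
  proof -
    let ?p = "\<lambda>x. max 0 (\<phi> x)" and ?n = "\<lambda>x. max 0 (- \<phi> x)"
    have pn: "?p \<in> unit_fun S" "?n \<in> unit_fun S"
      using unit_funD[OF \<phi>] by (auto intro!: unit_funI simp: abs_le_iff minus_le_iff)
    then have b: "?p \<in> bdd_fun S" "?n \<in> bdd_fun S" "(\<lambda>x. - 1 * ?n x) \<in> bdd_fun S"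
      by (auto intro: unit_fun_bdd bdd_fun_scale[of _ _ "- 1", simplified])
    have eq: "\<phi> = (\<lambda>x. ?p x + - 1 * ?n x)" by auto
    have "J \<phi> = J ?p - J ?n"
      by (subst eq, subst add[OF b(1,3)], subst scale[OF b(2)]) simp
    also have "\<dots> = (LINT x|M. ?p x) - (LINT x|M. ?n x)"
      using pn by (simp add: nonneg)
    also have "\<dots> = (LINT x|M. ?p x - ?n x)"
      using b by (intro Bochner_Integration.integral_diff[symmetric] finite_on_integrable[OF fin])
    also have "\<dots> = (LINT x|M. \<phi> x)" by (intro Bochner_Integration.integral_cong) auto
    finally show ?thesis ..
  qed
  have "(LINT x|M. \<phi> x) = J \<phi>" if \<phi>: "\<phi> \<in> bdd_fun S" for \<phi>
  proof -
    obtain c \<psi> where "c > 0" and \<psi>: "\<psi> \<in> unit_fun S" and eq: "\<phi> = (\<lambda>x. c * \<psi> x)"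
      by (rule bdd_fun_scaled[OF \<phi>])
    show ?thesis
      unfolding eq scale[OF unit_fun_bdd[OF \<psi>]] unit[OF \<psi>, symmetric] by simp
  qed
  with fin show ?thesis by blast
qed

section \<open>Total variation distance through test functions\<close>

lemma measure_eq_if_unit_integrals_eq:
  assumes "M \<in> finite_on S" "N \<in> finite_on S"
    and "\<And>\<phi>. \<phi> \<in> unit_fun S \<Longrightarrow> (LINT x|M. \<phi> x) = (LINT x|N. \<phi> x)"
  shows "M = N"
proof (rule measure_eqI)
  note M = finite_onD[OF assms(1)] and N = finite_onD[OF assms(2)]
  show "sets M = sets N" using M N by simp
  fix A assume "A \<in> sets M"
  then have "measure M A = measure N A"
    using assms(3)[OF indicator_unit, of A] M N by (simp add: sets.Int_space_eq2)
  then show "emeasure M A = emeasure N A"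
    by (simp add: finite_measure.emeasure_eq_measure M N)
qed

lemma tv_leD: "tv_le S M N e \<Longrightarrow> \<phi> \<in> unit_fun S \<Longrightarrow> \<bar>(LINT x|M. \<phi> x) - (LINT x|N. \<phi> x)\<bar> \<le> e"
  by (simp add: tv_le_def)

text \<open>For a fixed partition, the sum of the |M A - N A| is the difference of the integrals of
  one unit function, namely the one whose value on each cell A is the sign of M A - N A.\<close>

lemma tv_dist_le_if_tv_le:
  assumes "M \<in> finite_on S" "N \<in> finite_on S" "tv_le S M N e"
  shows "tv_dist M N \<le> ennreal e"
  unfolding tv_dist_def
proof (rule SUP_least)
  note M = finite_onD[OF assms(1)] and N = finite_onD[OF assms(2)]
  fix P assume "P \<in> {P. finite P \<and> P \<subseteq> sets M \<and> partition_on (space M) P}"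
  then have P: "finite P" "P \<subseteq> sets S" "partition_on (space S) P"
    using M by auto
  define \<phi> where "\<phi> x = (\<Sum>A\<in>P. sgn (measure M A - measure N A) * indicator A x)" for x
  have "\<phi> \<in> unit_fun S"
  proof (rule unit_funI)
    show "\<phi> \<in> borel_measurable S"
      unfolding \<phi>_def using P(2) by (intro borel_measurable_sum borel_measurable_times) auto
    fix x assume "x \<in> space S"
    then obtain B where B: "B \<in> P" "x \<in> B" using P(3) by (auto simp: partition_on_def)
    have "indicator A x = (if A = B then 1 else 0 :: real)" if "A \<in> P" for A
      using that B P(3) by (cases "A = B") (auto simp: partition_on_def disjoint_def indicator_def)
    then have "\<phi> x = (\<Sum>A\<in>P. if A = B then sgn (measure M A - measure N A) else 0)"
      unfolding \<phi>_def by (intro sum.cong) auto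
    also have "\<dots> = sgn (measure M B - measure N B)"
      using B(1) P(1) by simp
    finally have "\<phi> x = sgn (measure M B - measure N B)" .
    then show "\<bar>\<phi> x\<bar> \<le> 1" by (simp add: abs_sgn_eq)
  qed
  then have "\<bar>(LINT x|M. \<phi> x) - (LINT x|N. \<phi> x)\<bar> \<le> e"
    by (rule tv_leD[OF assms(3)])
  moreover have "(LINT x|L. \<phi> x) = (\<Sum>A\<in>P. sgn (measure M A - measure N A) * measure L A)"
    if "L \<in> finite_on S" for L
  proof -
    note L = finite_onD[OF that]
    have "integrable L (indicator A :: _ \<Rightarrow> real)" if "A \<in> P" for A
      using P(2) that by (intro finite_on_integrable[OF \<open>L \<in> _\<close>] unit_fun_bdd indicator_unit) auto
    moreover have "A \<inter> space L = A" if "A \<in> P" for A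
      using P(2) that L by (metis sets.Int_space_eq2 subsetD)
    ultimately show ?thesis
      unfolding \<phi>_def by (subst Bochner_Integration.integral_sum) auto
  qed
  ultimately have "\<bar>\<Sum>A\<in>P. (measure M A - measure N A) * sgn (measure M A - measure N A)\<bar> \<le> e"
    using assms by (simp add: sum_subtractf algebra_simps)
  then show "(\<Sum>A\<in>P. ennreal \<bar>measure M A - measure N A\<bar>) \<le> ennreal e"
    by (subst sum_ennreal) (auto simp: ennreal_leI simp flip: abs_sgn)
qed

text \<open>The level sets of a simple function form a finite partition, so the distance bounds its
  integrals directly. A general unit function is a pointwise limit of simple functions that are
  again bounded by 1, and dominated convergence carries the bound over without loss.\<close>

lemma tv_le_if_tv_dist_le:
  assumes "M \<in> finite_on S" "N \<in> finite_on S" "tv_dist M N \<le> ennreal e" "e \<ge> 0"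
  shows "tv_le S M N e"
  unfolding tv_le_def
proof
  note M = finite_onD[OF assms(1)] and N = finite_onD[OF assms(2)]
  have simple: "\<bar>(LINT x|M. u x) - (LINT x|N. u x)\<bar> \<le> c * e"
    if u: "simple_function S u" "\<And>x. x \<in> space S \<Longrightarrow> \<bar>u x\<bar> \<le> c" "c \<ge> 0" for u :: "'a \<Rightarrow> real" and c
  proof -
    define A where "A y = u -` {y} \<inter> space S" for y
    let ?Y = "u ` space S"
    have fin: "finite ?Y" using u(1) by (simp add: simple_function_def)
    have A: "A y \<in> sets S" if "y \<in> ?Y" for y
      using u(1) that unfolding A_def simple_function_def by blast
    \<comment> \<open>Each level set of an attained value is nonempty, hence distinct values have
      distinct level sets and the sum over the partition can be reindexed by values.\<close>
    have inj: "inj_on A ?Y"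
    proof (rule inj_onI)
      fix y z assume "y \<in> ?Y" "A y = A z"
      then obtain x where "x \<in> A y" "x \<in> A z" by (auto simp: A_def)
      then show "y = z" by (simp add: A_def)
    qed
    have "partition_on (space S) (A ` ?Y)"
      by (auto simp: partition_on_def A_def disjoint_def)
    with fin A M have "A ` ?Y \<in> {P. finite P \<and> P \<subseteq> sets M \<and> partition_on (space M) P}"
      by auto
    then have "(\<Sum>B\<in>A ` ?Y. ennreal \<bar>measure M B - measure N B\<bar>) \<le> tv_dist M N"
      unfolding tv_dist_def by (rule SUP_upper)
    with assms(3) have "(\<Sum>B\<in>A ` ?Y. ennreal \<bar>measure M B - measure N B\<bar>) \<le> ennreal e" by simp
    then have le: "(\<Sum>y\<in>?Y. \<bar>measure M (A y) - measure N (A y)\<bar>) \<le> e"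
      using assms(4) inj by (simp add: sum_ennreal sum_nonneg sum.reindex)
    have int: "(LINT x|L. u x) = (\<Sum>y\<in>?Y. y * measure L (A y))" if "L \<in> finite_on S" for L
    proof -
      note L = finite_onD[OF that]
      have "(LINT x|L. u x) = (LINT x|L. (\<Sum>y\<in>?Y. y * indicator (A y) x))"
      proof (rule Bochner_Integration.integral_cong)
        fix x assume "x \<in> space L"
        then have x: "x \<in> space S" using L by simp
        have "(\<Sum>y\<in>?Y. y * indicator (A y) x) = (\<Sum>y\<in>?Y. if y = u x then y else 0)"
          using x by (intro sum.cong) (auto simp: A_def)
        then show "u x = (\<Sum>y\<in>?Y. y * indicator (A y) x)" using fin x by simp
      qed simp
      also have "\<dots> = (\<Sum>y\<in>?Y. y * measure L (A y))"
      proof -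
        have "integrable L (indicator (A y) :: _ \<Rightarrow> real)" if "y \<in> ?Y" for y
          using A that by (intro finite_on_integrable[OF \<open>L \<in> _\<close>] unit_fun_bdd indicator_unit)
        moreover have "A y \<inter> space L = A y" for y
          by (auto simp: L A_def)
        ultimately show ?thesis by (subst Bochner_Integration.integral_sum) auto
      qed
      finally show ?thesis .
    qed
    have "\<bar>(LINT x|M. u x) - (LINT x|N. u x)\<bar> = \<bar>\<Sum>y\<in>?Y. y * (measure M (A y) - measure N (A y))\<bar>"
      by (simp add: int[OF assms(1)] int[OF assms(2)] sum_subtractf algebra_simps)
    also have "\<dots> \<le> (\<Sum>y\<in>?Y. c * \<bar>measure M (A y) - measure N (A y)\<bar>)"
      by (intro order_trans[OF sum_abs] sum_mono) (auto simp: abs_mult u intro!: mult_right_mono)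
    also have "\<dots> \<le> c * e"
      using le u(3) by (simp add: mult_left_mono flip: sum_distrib_left)
    finally show ?thesis .
  qed
  fix \<phi> assume \<phi>: "\<phi> \<in> unit_fun S"
  have \<phi>_abs: "- 1 \<le> \<phi> x" "\<phi> x \<le> 1" if "x \<in> space S" for x
    using unit_funD(2)[OF \<phi> that] by auto
  \<comment> \<open>Rounding down to multiples of 1/(n+1) keeps the values within [-1,1], since both
    endpoints are such multiples. So the estimate for simple functions applies with c = 1.\<close>
  define u where "u n x = of_int \<lfloor>real (Suc n) * \<phi> x\<rfloor> / real (Suc n)" for n x
  have u_floor: "- int (Suc n) \<le> \<lfloor>real (Suc n) * \<phi> x\<rfloor>" "\<lfloor>real (Suc n) * \<phi> x\<rfloor> \<le> int (Suc n)"
    if "x \<in> space S" for n x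
  proof -
    show "- int (Suc n) \<le> \<lfloor>real (Suc n) * \<phi> x\<rfloor>"
      using mult_left_mono[OF \<phi>_abs(1)[OF that], of "real (Suc n)"] by (simp add: le_floor_iff)
    have "real (Suc n) * \<phi> x \<le> real (Suc n)"
      using mult_left_mono[OF \<phi>_abs(2)[OF that], of "real (Suc n)"] by simp
    then show "\<lfloor>real (Suc n) * \<phi> x\<rfloor> \<le> int (Suc n)"
      by (metis floor_mono floor_of_nat)
  qed
  have u_abs: "\<bar>u n x\<bar> \<le> 1" if "x \<in> space S" for n x
  proof -
    have "\<bar>\<lfloor>real (Suc n) * \<phi> x\<rfloor>\<bar> \<le> int (Suc n)"
      using u_floor[OF that, of n] by (simp add: abs_le_iff)
    then have "\<bar>real_of_int \<lfloor>real (Suc n) * \<phi> x\<rfloor>\<bar> \<le> real (Suc n)" by linarith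
    then show ?thesis by (simp add: u_def)
  qed
  have u_meas: "u n \<in> borel_measurable S" for n
    unfolding u_def using unit_funD(1)[OF \<phi>] by measurable
  have u_simple: "simple_function S (u n)" for n
  proof (rule simple_function_borel_measurable[OF u_meas])
    have "u n ` space S \<subseteq> (\<lambda>k. of_int k / real (Suc n)) ` {- int (Suc n)..int (Suc n)}"
      using u_floor[of _ n] by (auto simp: u_def)
    then show "finite (u n ` space S)" by (rule finite_subset) simp
  qed
  have u_lim: "(\<lambda>n. u n x) \<longlonglongrightarrow> \<phi> x" for x
  proof (rule tendsto_sandwich[OF _ _ _ tendsto_const])
    have "real (Suc n) * (\<phi> x - 1 / real (Suc n)) \<le> of_int \<lfloor>real (Suc n) * \<phi> x\<rfloor>" for n
      by (simp add: right_diff_distrib)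
    then show "\<forall>\<^sub>F n in sequentially. \<phi> x - 1 / real (Suc n) \<le> u n x"
      by (simp add: u_def pos_le_divide_eq mult.commute del: of_nat_Suc)
    show "\<forall>\<^sub>F n in sequentially. u n x \<le> \<phi> x"
      by (simp add: u_def pos_divide_le_eq mult.commute del: of_nat_Suc)
    show "(\<lambda>n. \<phi> x - 1 / real (Suc n)) \<longlonglongrightarrow> \<phi> x"
      using tendsto_diff[OF tendsto_const LIMSEQ_inverse_real_of_nat, of "\<phi> x"]
      by (simp add: inverse_eq_divide)
  qed
  have int_lim: "(\<lambda>n. LINT x|L. u n x) \<longlonglongrightarrow> (LINT x|L. \<phi> x)" if "L \<in> finite_on S" for L
    using finite_onD[OF that] u_meas u_abs u_lim unit_funD(1)[OF \<phi>]
    by (intro integral_tendsto_bounded[where c = 1]) auto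
  have "\<bar>(LINT x|M. u n x) - (LINT x|N. u n x)\<bar> \<le> e" for n
    using simple[OF u_simple u_abs, of n] by simp
  then show "\<bar>(LINT x|M. \<phi> x) - (LINT x|N. \<phi> x)\<bar> \<le> e"
    using assms by (intro tendsto_upperbound[OF tendsto_rabs[OF tendsto_diff[OF int_lim int_lim]]]) auto
qed

definition tv_path :: "'a measure \<Rightarrow> (real \<Rightarrow> 'a measure) \<Rightarrow> bool" where
  "tv_path S \<mu> \<longleftrightarrow> (\<forall>t\<ge>0. \<mu> t \<in> finite_on S) \<and>
     (\<forall>t\<ge>0. \<forall>e>0. \<forall>\<^sub>F s in at t within {0..}. tv_le S (\<mu> s) (\<mu> t) e)"

lemma tv_path_iff_tv_continuous:
  assumes "\<And>t. t \<ge> 0 \<Longrightarrow> \<mu> t \<in> finite_on S"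
  shows "tv_path S \<mu> \<longleftrightarrow> tv_continuous \<mu>"
proof
  assume p: "tv_path S \<mu>"
  show "tv_continuous \<mu>"
    unfolding tv_continuous_def
  proof (intro allI impI order_tendstoI)
    fix t and a :: ennreal assume t: "t \<ge> (0::real)" and a: "0 < a"
    then obtain e :: real where e: "0 < e" "ennreal e < a"
    proof (cases a)
      case (real r)
      with a show ?thesis by (intro that[of "r / 2"]) (auto simp: ennreal_lessI)
    next
      case top
      then show ?thesis by (intro that[of 1]) auto
    qed
    have "\<forall>\<^sub>F s in at t within {0..}. tv_le S (\<mu> s) (\<mu> t) e"
      using p t e(1) unfolding tv_path_def by blast
    moreover have "\<forall>\<^sub>F s in at t within {0..}. s \<ge> 0"
      by (auto simp: eventually_at_filter)
    ultimately show "\<forall>\<^sub>F s in at t within {0..}. tv_dist (\<mu> s) (\<mu> t) < a"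
    proof eventually_elim
      case (elim s)
      have "tv_dist (\<mu> s) (\<mu> t) \<le> ennreal e"
        by (rule tv_dist_le_if_tv_le[OF assms assms]) (use elim t in auto)
      with e(2) show ?case by simp
    qed
  qed simp
next
  assume c: "tv_continuous \<mu>"
  show "tv_path S \<mu>"
    unfolding tv_path_def
  proof (intro conjI allI impI assms)
    fix t e :: real assume t: "t \<ge> 0" and e: "e > 0"
    have "((\<lambda>s. tv_dist (\<mu> s) (\<mu> t)) \<longlongrightarrow> 0) (at t within {0..})"
      using c t by (simp add: tv_continuous_def)
    then have "\<forall>\<^sub>F s in at t within {0..}. tv_dist (\<mu> s) (\<mu> t) < ennreal e"
      using e by (intro order_tendstoD) auto
    moreover have "\<forall>\<^sub>F s in at t within {0..}. s \<ge> 0"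
      by (auto simp: eventually_at_filter)
    ultimately show "\<forall>\<^sub>F s in at t within {0..}. tv_le S (\<mu> s) (\<mu> t) e"
    proof eventually_elim
      case (elim s)
      show ?case
        by (rule tv_le_if_tv_dist_le[OF assms assms]) (use elim t e in auto)
    qed
  qed
qed

section \<open>Integrals over time intervals\<close>

text \<open>Paths are unconstrained at negative times, so measurability in time is asserted on the
  half line only.\<close>

abbreviation borel_time :: "real measure" where
  "borel_time \<equiv> restrict_space borel {0..}"

text \<open>As a finite measure it makes every bounded measurable rate integrable and admits
  products for Fubini. For t < 0 its space is empty and all integrals vanish.\<close>

abbreviation leb_upto :: "real \<Rightarrow> real measure" where
  "leb_upto t \<equiv> restrict_space lborel {0..t}"

lemma leb_upto_finite: "finite_measure (leb_upto t)"
  by (rule finite_measureI) (simp add: emeasure_restrict_space emeasure_lborel_Icc_eq)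

lemma mass_leb_upto: "mass (leb_upto t) = max 0 t"
  by (simp add: measure_restrict_space measure_def[of lborel] emeasure_lborel_Icc_eq)

lemma leb_upto_measurable_ident: "(\<lambda>x. x) \<in> borel_measurable (leb_upto t)"
  by (simp add: measurable_restrict_space1)

lemma leb_upto_measurable: "f \<in> borel_measurable borel_time \<Longrightarrow> f \<in> borel_measurable (leb_upto t)"
proof -
  assume "f \<in> borel_measurable borel_time"
  then have "f \<in> borel_measurable (restrict_space borel {0..t})"
    by (rule measurable_restrict_mono) auto
  also have "borel_measurable (restrict_space borel {0..t}) = borel_measurable (leb_upto t)"
    by (intro measurable_cong_sets) (simp_all add: sets_restrict_space)
  finally show ?thesis .
qed

lemma borel_time_measurable: "f \<in> borel_measurable borel \<Longrightarrow> f \<in> borel_measurable borel_time"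
  by (rule measurable_restrict_space1)

lemma set_integral_leb_upto: "(LINT s:{0..t}|lborel. f s) = (LINT s|leb_upto t. f s)" for f :: "real \<Rightarrow> real"
  by (simp add: set_lebesgue_integral_def integral_restrict_space)

lemma integral_leb_upto_subinterval:
  fixes f :: "real \<Rightarrow> real"
  assumes "s \<le> t"
  shows "(LINT x|leb_upto s. f x) = (LINT x|leb_upto t. indicator {0..s} x * f x)"
proof -
  have "(LBINT x. indicator {0..s} x * f x) = (LBINT x. indicator {0..t} x * (indicator {0..s} x * f x))"
    using assms by (intro Bochner_Integration.integral_cong) (auto simp: indicator_def)
  then show ?thesis
    by (simp add: integral_restrict_space)
qed

lemma integral_leb_upto_lipschitz:
  fixes f :: "real \<Rightarrow> real"
  assumes "f \<in> borel_measurable borel_time" "\<And>x. 0 \<le> x \<Longrightarrow> x \<le> T \<Longrightarrow> \<bar>f x\<bar> \<le> C"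
    and "0 \<le> s" "s \<le> T" "0 \<le> t" "t \<le> T"
  shows "\<bar>(LINT x|leb_upto s. f x) - (LINT x|leb_upto t. f x)\<bar> \<le> C * \<bar>s - t\<bar>"
proof -
  have *: "\<bar>(LINT x|leb_upto s. f x) - (LINT x|leb_upto t. f x)\<bar> \<le> C * (t - s)" if "0 \<le> s" "s \<le> t" "t \<le> T" for s t
  proof -
    note m = leb_upto_measurable[OF assms(1), of t]
    have b: "\<bar>f x\<bar> \<le> C" if "x \<in> space (leb_upto t)" for x
      using that \<open>t \<le> T\<close> by (intro assms(2)) auto
    have C: "0 \<le> C" using assms(2)[of s] that by fastforce
    have int: "integrable (leb_upto t) f"
      by (rule integrable_bounded[OF leb_upto_finite m b])
    have ind: "(indicator A :: real \<Rightarrow> real) \<in> borel_measurable (leb_upto t)" if "A \<in> sets borel" for A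
      using that by (intro measurable_restrict_space1) auto
    have int2: "integrable (leb_upto t) (\<lambda>x. indicator {0..s} x * f x)"
      using C b by (intro integrable_bounded[OF leb_upto_finite, where c = C] borel_measurable_times ind m)
        (auto simp: indicator_def)
    have "(LINT x|leb_upto s. f x) - (LINT x|leb_upto t. f x) = (LINT x|leb_upto t. indicator {0..s} x * f x - f x)"
      using int int2 by (simp add: integral_leb_upto_subinterval[OF \<open>s \<le> t\<close>])
    also have "\<bar>\<dots>\<bar> \<le> (LINT x|leb_upto t. \<bar>indicator {0..s} x * f x - f x\<bar>)"
      by (rule integral_abs_bound)
    also have "\<dots> \<le> (LINT x|leb_upto t. C * indicator {s<..t} x)"
    proof (rule integral_mono)
      show "integrable (leb_upto t) (\<lambda>x. \<bar>indicator {0..s} x * f x - f x\<bar>)"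
        using int int2 by simp
      show "integrable (leb_upto t) (\<lambda>x. C * indicator {s<..t} x)"
        using C by (intro integrable_bounded[OF leb_upto_finite, where c = C] borel_measurable_times ind)
          (auto simp: indicator_def)
      show "\<bar>indicator {0..s} x * f x - f x\<bar> \<le> C * indicator {s<..t} x" if "x \<in> space (leb_upto t)" for x
        using b[OF that] that by (auto simp: indicator_def)
    qed
    also have "\<dots> = C * (t - s)"
    proof -
      have "{s<..t} \<subseteq> {0..t}" using that by auto
      then show ?thesis using that by (simp add: measure_restrict_space Int_absorb2)
    qed
    finally show ?thesis .
  qed
  show ?thesis
  proof (cases "s \<le> t")
    case True then show ?thesis using *[of s t] assms by simp
  next
    case False then show ?thesis using *[of t s] assms by (simp add: abs_minus_commute)
  qed
qed

lemma integral_FTC_Icc_leb_upto: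
  fixes f F :: "real \<Rightarrow> real"
  assumes "0 \<le> r" "r \<le> t"
    and "\<And>x. (F has_real_derivative f x) (at x)" "\<And>x. isCont f x"
  shows "(LINT x|leb_upto t. indicator {r..t} x * f x) = F t - F r"
proof -
  have "(LINT x|leb_upto t. indicator {r..t} x * f x) = (LINT x|lborel. f x * indicator {r..t} x)"
    using assms by (auto simp: integral_restrict_space indicator_def intro!: Bochner_Integration.integral_cong)
  also have "\<dots> = F t - F r"
    using assms by (intro integral_FTC_Icc_real) auto
  finally show ?thesis .
qed

lemma integral_FTC_leb_upto:
  fixes f F :: "real \<Rightarrow> real"
  assumes "0 \<le> t" "\<And>x. (F has_real_derivative f x) (at x)" "\<And>x. isCont f x"
  shows "(LINT x|leb_upto t. f x) = F t - F 0"
proof -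
  have "(LINT x|leb_upto t. f x) = (LINT x|leb_upto t. indicator {0..t} x * f x)"
    by (intro Bochner_Integration.integral_cong) auto
  with integral_FTC_Icc_leb_upto[of 0 t F f] assms show ?thesis by simp
qed

text \<open>Multiply the mild equation by \<theta> and integrate over [0,t]. Since \<theta>
  exp(-\<Theta>) is the derivative of -exp(-\<Theta>), Fubini on the triangle r <= s <= t evaluates
  the inner integral explicitly. The integral of \<theta> u then occurs on both sides and cancels,
  and the mild equation at time t removes what remains of the integrating factor. Fubini takes the
  place of differentiation because w is only measurable in time.\<close>

lemma mild_imp_integral_equation:
  fixes u w \<theta> \<Theta> :: "real \<Rightarrow> real"
  assumes \<Theta>: "\<And>x. (\<Theta> has_real_derivative \<theta> x) (at x)" "\<And>x. isCont \<theta> x" "\<Theta> 0 = 0"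
    and meas: "u \<in> borel_measurable borel_time" "w \<in> borel_measurable borel_time"
    and bound: "\<And>s. 0 \<le> s \<Longrightarrow> s \<le> t \<Longrightarrow> \<bar>u s\<bar> \<le> C" "\<And>s. 0 \<le> s \<Longrightarrow> s \<le> t \<Longrightarrow> \<bar>w s\<bar> \<le> C"
    and mild: "\<And>s. 0 \<le> s \<Longrightarrow> s \<le> t \<Longrightarrow> u s = exp (- \<Theta> s) * (u0 + (LINT r|leb_upto s. exp (\<Theta> r) * (\<theta> r * u r + w r)))"
    and t: "0 \<le> t"
  shows "u t = u0 + (LINT s|leb_upto t. w s)"
proof -
  interpret I: finite_measure "leb_upto t" by (rule leb_upto_finite)
  interpret P: pair_sigma_finite "leb_upto t" "leb_upto t" ..
  define f where "f r = exp (\<Theta> r) * (\<theta> r * u r + w r)" for r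
  define k where "k s = \<theta> s * exp (- \<Theta> s)" for s
  have cont: "isCont \<Theta> x" for x using \<Theta>(1) DERIV_isCont by blast
  have contk: "isCont k x" for x unfolding k_def by (intro continuous_intros \<Theta> cont)
  have cont_on: "continuous_on A \<theta>" "continuous_on A \<Theta>" "continuous_on A k" for A
    using \<Theta>(2) cont contk by (auto intro: continuous_at_imp_continuous_on)
  have [measurable]: "\<theta> \<in> borel_measurable borel" "\<Theta> \<in> borel_measurable borel" "k \<in> borel_measurable borel"
    by (intro borel_measurable_continuous_onI cont_on)+
  have mt: "\<theta> \<in> borel_measurable (leb_upto t)" "\<Theta> \<in> borel_measurable (leb_upto t)" "k \<in> borel_measurable (leb_upto t)"
    by (intro leb_upto_measurable borel_time_measurable; measurable)+
  note [measurable] = leb_upto_measurable[OF meas(1), of t] leb_upto_measurable[OF meas(2), of t] mt leb_upto_measurable_ident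
  have f_meas[measurable]: "f \<in> borel_measurable (leb_upto t)" unfolding f_def by measurable
  have compact_bound: "\<exists>B\<ge>0. \<forall>x\<in>{0..t}. \<bar>h x\<bar> \<le> B" if "continuous_on {0..t} h" for h :: "real \<Rightarrow> real"
    using compact_imp_bounded[OF compact_continuous_image[OF that compact_Icc]]
    by (auto simp: bounded_pos intro: less_imp_le)
  obtain B1 where B1: "B1 \<ge> 0" "\<And>x. x \<in> {0..t} \<Longrightarrow> \<bar>\<theta> x\<bar> \<le> B1"
    using compact_bound[OF cont_on(1)] by auto
  obtain B2 where B2: "B2 \<ge> 0" "\<And>x. x \<in> {0..t} \<Longrightarrow> \<bar>exp (\<Theta> x)\<bar> \<le> B2"
    using compact_bound[OF continuous_on_exp[OF cont_on(2)]] by auto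
  obtain B3 where B3: "B3 \<ge> 0" "\<And>x. x \<in> {0..t} \<Longrightarrow> \<bar>k x\<bar> \<le> B3"
    using compact_bound[OF cont_on(3)] by auto
  have C: "C \<ge> 0" using bound(1)[OF t] by simp
  have tu: "\<bar>\<theta> x * u x\<bar> \<le> B1 * C" if "x \<in> {0..t}" for x
    unfolding abs_mult using that B1 bound(1)[of x] by (intro mult_mono) auto
  have fb: "\<bar>f x\<bar> \<le> B2 * (B1 * C + C)" if "x \<in> {0..t}" for x
    unfolding f_def abs_mult using that B2 tu[OF that] bound(2)[of x] by (intro mult_mono) auto
  have int_tu: "integrable (leb_upto t) (\<lambda>x. \<theta> x * u x)"
    using tu by (intro integrable_bounded[OF leb_upto_finite, where c = "B1 * C"]) auto
  have int_w: "integrable (leb_upto t) w"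
    using bound by (intro integrable_bounded[OF leb_upto_finite, where c = C]) auto
  have int_f: "integrable (leb_upto t) f"
    using fb by (intro integrable_bounded[OF leb_upto_finite, where c = "B2 * (B1 * C + C)"]) auto
  have int_k: "integrable (leb_upto t) k"
    using B3 by (intro integrable_bounded[OF leb_upto_finite, where c = B3]) auto
  let ?e = "exp (- \<Theta> t)"
  have k_deriv: "((\<lambda>s. - exp (- \<Theta> s)) has_real_derivative k s) (at s)" for s
    unfolding k_def by (auto intro!: derivative_eq_intros \<Theta>(1))
  \<comment> \<open>The double integrand on the square, cut off to the triangle r <= s, where it is
    k(s) f(r).\<close>
  define D where "D z = (case z of (s, r) \<Rightarrow> k s * (indicator {0..s} r * f r))" for z :: "real \<times> real"
  have D_eq: "D (s, r) = (if r \<in> {0..s} then k s * f r else 0)" for s r by (simp add: D_def)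
  have D_meas: "D \<in> borel_measurable (leb_upto t \<Otimes>\<^sub>M leb_upto t)"
  proof -
    have "(\<lambda>z. if 0 \<le> snd z \<and> snd z \<le> fst z then k (fst z) * f (snd z) else 0) \<in> borel_measurable (leb_upto t \<Otimes>\<^sub>M leb_upto t)"
      by measurable
    also have "(\<lambda>z. if 0 \<le> snd z \<and> snd z \<le> fst z then k (fst z) * f (snd z) else 0) = D"
      by (auto simp: D_def fun_eq_iff)
    finally show ?thesis .
  qed
  have D_int: "integrable (leb_upto t \<Otimes>\<^sub>M leb_upto t) D"
  proof (rule integrable_bounded[OF _ D_meas])
    show "finite_measure (leb_upto t \<Otimes>\<^sub>M leb_upto t)" by (intro finite_measure_pair_measure leb_upto_finite)
    fix z assume "z \<in> space (leb_upto t \<Otimes>\<^sub>M leb_upto t)"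
    then obtain s r where z: "z = (s, r)" "s \<in> {0..t}" "r \<in> {0..t}"
      by (auto simp: space_pair_measure)
    have "\<bar>k s * f r\<bar> \<le> B3 * (B2 * (B1 * C + C))"
      unfolding abs_mult using B3 fb z by (intro mult_mono) auto
    moreover have "0 \<le> B3 * (B2 * (B1 * C + C))" using B1 B2 B3 C by simp
    ultimately show "\<bar>D z\<bar> \<le> B3 * (B2 * (B1 * C + C))" by (simp add: z D_eq)
  qed
  have "(LINT s|leb_upto t. \<theta> s * u s) = (LINT s|leb_upto t. u0 * k s + (LINT r|leb_upto t. D (s, r)))"
  proof (rule Bochner_Integration.integral_cong)
    fix s assume "s \<in> space (leb_upto t)"
    then have s: "0 \<le> s" "s \<le> t" by auto
    have "\<theta> s * u s = k s * (u0 + (LINT r|leb_upto s. f r))"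
      unfolding k_def f_def by (subst mild[OF s]) simp
    also have "(LINT r|leb_upto s. f r) = (LINT r|leb_upto t. indicator {0..s} r * f r)"
      by (rule integral_leb_upto_subinterval[OF s(2)])
    finally have "\<theta> s * u s = u0 * k s + k s * (LINT r|leb_upto t. indicator {0..s} r * f r)"
      by (simp only: distrib_left mult.commute)
    then show "\<theta> s * u s = u0 * k s + (LINT r|leb_upto t. D (s, r))"
      unfolding D_def prod.case integral_mult_right_zero .
  qed simp
  also have "\<dots> = u0 * (LINT s|leb_upto t. k s) + (LINT s|leb_upto t. (LINT r|leb_upto t. D (s, r)))"
    using int_k P.integrable_fst[of "\<lambda>s r. D (s, r)"] D_int by simp
  also have "(LINT s|leb_upto t. k s) = 1 - ?e"
    using integral_FTC_leb_upto[OF t k_deriv contk] by (simp add: \<Theta>(3))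
  also have "(LINT s|leb_upto t. (LINT r|leb_upto t. D (s, r))) = (LINT r|leb_upto t. (LINT s|leb_upto t. D (s, r)))"
    using P.Fubini_integral[of "\<lambda>s r. D (s, r)"] D_int by simp
  also have "\<dots> = (LINT r|leb_upto t. (\<theta> r * u r + w r) - ?e * f r)"
  proof (rule Bochner_Integration.integral_cong)
    fix r assume "r \<in> space (leb_upto t)"
    then have r: "0 \<le> r" "r \<le> t" by auto
    have "(LINT s|leb_upto t. D (s, r)) = (LINT s|leb_upto t. (indicator {r..t} s * k s) * f r)"
      by (intro Bochner_Integration.integral_cong) (use r in \<open>auto simp: D_eq indicator_def\<close>)
    also have "\<dots> = (exp (- \<Theta> r) - ?e) * f r"
      using integral_FTC_Icc_leb_upto[OF r k_deriv contk] by simp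
    finally show "(LINT s|leb_upto t. D (s, r)) = (\<theta> r * u r + w r) - ?e * f r"
      by (simp add: f_def left_diff_distrib mult.assoc[symmetric] flip: exp_add)
  qed simp
  also have "\<dots> = (LINT r|leb_upto t. \<theta> r * u r) + (LINT r|leb_upto t. w r) - ?e * (LINT r|leb_upto t. f r)"
    using int_tu int_w int_f by simp
  \<comment> \<open>The integral of \<theta> u has dropped out here.\<close>
  finally have "u0 * (1 - ?e) + (LINT r|leb_upto t. w r) = ?e * (LINT r|leb_upto t. f r)" by simp
  moreover have "u t = ?e * (u0 + (LINT r|leb_upto t. f r))"
    unfolding f_def using mild[of t] t by simp
  ultimately show ?thesis by (simp add: algebra_simps)
qed

text \<open>One integration turns s^n into t^(n+1)/(n+1). Iterated, this produces the factor 1/n!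
  that makes both the existence and the uniqueness argument work on arbitrary time
  intervals.\<close>

lemma integral_leb_upto_diff_le_power:
  fixes f g :: "real \<Rightarrow> real"
  assumes "integrable (leb_upto t) f" "integrable (leb_upto t) g" "0 \<le> t" "0 \<le> k"
    and "\<And>s. 0 \<le> s \<Longrightarrow> s \<le> t \<Longrightarrow> \<bar>f s - g s\<bar> \<le> k * s ^ n"
  shows "\<bar>(LINT s|leb_upto t. f s) - (LINT s|leb_upto t. g s)\<bar> \<le> k * (t ^ Suc n / Suc n)"
proof -
  have "\<bar>(LINT s|leb_upto t. f s) - (LINT s|leb_upto t. g s)\<bar> = \<bar>LINT s|leb_upto t. f s - g s\<bar>"
    using assms by simp
  also have "\<dots> \<le> (LINT s|leb_upto t. \<bar>f s - g s\<bar>)"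
    by (rule integral_abs_bound)
  also have "\<dots> \<le> (LINT s|leb_upto t. k * s ^ n)"
  proof (rule integral_mono)
    show "integrable (leb_upto t) (\<lambda>s. \<bar>f s - g s\<bar>)" using assms by simp
    show "integrable (leb_upto t) (\<lambda>s. k * s ^ n)"
    proof (rule integrable_bounded[OF leb_upto_finite])
      show "(\<lambda>s. k * s ^ n) \<in> borel_measurable (leb_upto t)"
        by (intro leb_upto_measurable borel_time_measurable) measurable
      show "\<bar>k * s ^ n\<bar> \<le> k * t ^ n" if "s \<in> space (leb_upto t)" for s
        unfolding abs_mult using that assms(4) by (intro mult_mono) (auto intro: power_mono)
    qed
  qed (use assms(5) in auto)
  also have "\<dots> = k * (t ^ Suc n / Suc n)"
  proof -
    have "((\<lambda>s. s ^ Suc n / Suc n) has_real_derivative s ^ n) (at s)" for s :: real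
      by (auto intro!: derivative_eq_intros simp del: of_nat_Suc power_Suc)
    from integral_FTC_leb_upto[OF assms(3) this] show ?thesis
      by (simp del: of_nat_Suc)
  qed
  finally show ?thesis .
qed

section \<open>Continuous paths of measures and their products\<close>

lemma tv_le_sym: "tv_le S M N e \<Longrightarrow> tv_le S N M e"
  by (simp add: tv_le_def abs_minus_commute)

lemma tv_le_trans: "tv_le S L M d \<Longrightarrow> tv_le S M N e \<Longrightarrow> tv_le S L N (d + e)"
  unfolding tv_le_def
proof
  assume *: "\<forall>\<phi>\<in>unit_fun S. \<bar>(LINT x|L. \<phi> x) - (LINT x|M. \<phi> x)\<bar> \<le> d"
    "\<forall>\<phi>\<in>unit_fun S. \<bar>(LINT x|M. \<phi> x) - (LINT x|N. \<phi> x)\<bar> \<le> e"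
  fix \<phi> assume "\<phi> \<in> unit_fun S"
  with *[THEN bspec] show "\<bar>(LINT x|L. \<phi> x) - (LINT x|N. \<phi> x)\<bar> \<le> d + e"
    by (smt (verit))
qed

lemma abs_le_all_epsilon:
  fixes a k :: real
  assumes "\<And>e. 0 < e \<Longrightarrow> \<bar>a\<bar> \<le> k * e"
  shows "a = 0"
proof -
  have "((\<lambda>e. k * e) \<longlongrightarrow> k * 0) (at_right 0)" by (intro tendsto_intros)
  then have "\<bar>a\<bar> \<le> k * 0"
    by (rule tendsto_lowerbound) (auto simp: eventually_at_filter assms intro!: always_eventually)
  then show ?thesis by simp
qed

lemma tv_pathD:
  assumes "tv_path S \<mu>" "0 \<le> t"
  shows "\<mu> t \<in> finite_on S"
  using assms by (simp add: tv_path_def)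

lemma integral_path_tendsto:
  assumes "tv_path S \<mu>" "\<phi> \<in> unit_fun S" "0 \<le> t"
  shows "((\<lambda>s. LINT x|\<mu> s. \<phi> x) \<longlongrightarrow> (LINT x|\<mu> t. \<phi> x)) (at t within {0..})"
proof (rule tendstoI)
  fix e :: real assume "e > 0"
  then have "\<forall>\<^sub>F s in at t within {0..}. tv_le S (\<mu> s) (\<mu> t) (e / 2)"
    using assms by (simp add: tv_path_def)
  then show "\<forall>\<^sub>F s in at t within {0..}. dist (LINT x|\<mu> s. \<phi> x) (LINT x|\<mu> t. \<phi> x) < e"
    by eventually_elim (use tv_leD[OF _ assms(2)] \<open>e > 0\<close> in \<open>fastforce simp: dist_real_def\<close>)
qed

lemma integral_path_continuous:
  assumes "tv_path S \<mu>" "\<phi> \<in> unit_fun S"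
  shows "continuous_on {0..} (\<lambda>s. LINT x|\<mu> s. \<phi> x)"
  unfolding continuous_on_def using integral_path_tendsto[OF assms] by auto

lemma integral_path_measurable:
  assumes "tv_path S \<mu>" "\<phi> \<in> bdd_fun S"
  shows "(\<lambda>s. LINT x|\<mu> s. \<phi> x) \<in> borel_measurable borel_time"
proof -
  obtain c \<psi> where "c > 0" and \<psi>: "\<psi> \<in> unit_fun S" and eq: "\<phi> = (\<lambda>x. c * \<psi> x)"
    by (rule bdd_fun_scaled[OF assms(2)])
  have "(\<lambda>s. LINT x|\<mu> s. \<psi> x) \<in> borel_measurable borel_time"
    by (rule borel_measurable_continuous_on_restrict[OF integral_path_continuous[OF assms(1) \<psi>]])
  then show ?thesis by (simp add: eq)
qed

lemma tv_leD_scaled: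
  assumes "tv_le S M N e" "\<phi> \<in> borel_measurable S" "\<And>x. x \<in> space S \<Longrightarrow> \<bar>\<phi> x\<bar> \<le> c" "c \<ge> 0"
  shows "\<bar>(LINT x|M. \<phi> x) - (LINT x|N. \<phi> x)\<bar> \<le> c * e"
proof -
  have pos: "\<bar>(LINT x|M. \<phi> x) - (LINT x|N. \<phi> x)\<bar> \<le> d * e" if "d > 0" "c \<le> d" for d
  proof -
    have "(\<lambda>x. \<phi> x / d) \<in> unit_fun S"
      using assms(2) order_trans[OF assms(3) that(2)] that(1) by (auto intro!: unit_funI)
    from tv_leD[OF assms(1) this] show ?thesis
      using that by (simp add: field_simps flip: diff_divide_distrib)
  qed
  show ?thesis
  proof (cases "c = 0")
    \<comment> \<open>With c = 0 no normalisation by c is possible. The bound d * e holds for every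
      d > 0 instead, which forces the difference to vanish.\<close>
    case True
    then have "(LINT x|M. \<phi> x) - (LINT x|N. \<phi> x) = 0"
      using pos by (intro abs_le_all_epsilon[of _ e]) (auto simp: mult.commute)
    with True show ?thesis by simp
  qed (use pos assms(4) in auto)
qed

lemma tv_le_mass:
  assumes "M \<in> finite_on S" "N \<in> finite_on S" "tv_le S M N e"
  shows "mass M \<le> mass N + e"
  using tv_leD[OF assms(3) const_unit[of 1]] by simp

text \<open>Restricting to e < 1 lets applications bound the masses at nearby times by the mass at
  the limit time plus 1, so that B does not depend on e.\<close>

lemma tendsto_if_eventually_le_mult:
  fixes f :: "'b \<Rightarrow> real"
  assumes "\<And>e. 0 < e \<Longrightarrow> e < 1 \<Longrightarrow> \<forall>\<^sub>F s in A. \<bar>f s - l\<bar> \<le> B * e"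
  shows "(f \<longlongrightarrow> l) A"
proof (rule tendstoI)
  fix \<epsilon> :: real assume \<epsilon>: "0 < \<epsilon>"
  define e where "e = min (1 / 2) (\<epsilon> / (\<bar>B\<bar> + 1) / 2)"
  have e: "0 < e" "e < 1" using \<epsilon> by (auto simp: e_def)
  have "B * e \<le> (\<bar>B\<bar> + 1) * e" using e by (intro mult_right_mono) auto
  also have "\<dots> \<le> (\<bar>B\<bar> + 1) * (\<epsilon> / (\<bar>B\<bar> + 1) / 2)" by (intro mult_left_mono) (auto simp: e_def)
  also have "\<dots> < \<epsilon>" using \<epsilon> by (simp add: field_simps add_pos_nonneg)
  finally have "B * e < \<epsilon>" .
  with assms[OF e] show "\<forall>\<^sub>F s in A. dist (f s) l < \<epsilon>"
    by (auto simp: dist_real_def elim: eventually_mono)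
qed

lemma borel_measurable_pair_finite_on:
  assumes "M \<in> finite_on S" "N \<in> finite_on S"
  shows "borel_measurable (M \<Otimes>\<^sub>M N) = borel_measurable (S \<Otimes>\<^sub>M S)"
  using finite_onD(1)[OF assms(1)] finite_onD(1)[OF assms(2)]
  by (intro measurable_cong_sets sets_pair_measure_cong) auto

lemma integral_pair_finite_on:
  fixes k :: "'a \<times> 'a \<Rightarrow> real"
  assumes M: "M \<in> finite_on S" and N: "N \<in> finite_on S"
    and k: "k \<in> borel_measurable (S \<Otimes>\<^sub>M S)" "\<And>z. z \<in> space (S \<Otimes>\<^sub>M S) \<Longrightarrow> \<bar>k z\<bar> \<le> C"
  shows "integrable (M \<Otimes>\<^sub>M N) k" "integral\<^sup>L (M \<Otimes>\<^sub>M N) k = (LINT x|M. LINT y|N. k (x, y))"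
    "integral\<^sup>L (M \<Otimes>\<^sub>M N) k = (LINT y|N. LINT x|M. k (x, y))"
proof -
  interpret M: finite_measure M by (rule finite_onD(3)[OF M])
  interpret N: finite_measure N by (rule finite_onD(3)[OF N])
  interpret P: pair_sigma_finite M N ..
  have "space (M \<Otimes>\<^sub>M N) = space (S \<Otimes>\<^sub>M S)"
    using finite_onD(2)[OF M] finite_onD(2)[OF N] by (simp add: space_pair_measure)
  then show int: "integrable (M \<Otimes>\<^sub>M N) k"
    using k by (intro integrable_bounded[of _ k C] finite_measure_pair_measure)
      (auto simp: borel_measurable_pair_finite_on[OF M N] M.finite_measure_axioms N.finite_measure_axioms)
  show fst: "integral\<^sup>L (M \<Otimes>\<^sub>M N) k = (LINT x|M. LINT y|N. k (x, y))"
    using P.integral_fst'[OF int] ..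
  have "integrable (M \<Otimes>\<^sub>M N) (\<lambda>(x, y). k (x, y))" using int by simp
  from P.Fubini_integral[OF this] fst
  show "integral\<^sup>L (M \<Otimes>\<^sub>M N) k = (LINT y|N. LINT x|M. k (x, y))" by simp
qed

text \<open>M \<otimes> M - N \<otimes> N is the sum of (M - N) \<otimes> M and N \<otimes> (M - N).
  In each summand the inner integral over the unchanged factor is a test function bounded by C times
  the mass of that factor.\<close>

lemma tv_le_pair:
  fixes k :: "'a \<times> 'a \<Rightarrow> real"
  assumes M: "M \<in> finite_on S" and N: "N \<in> finite_on S" and e: "tv_le S M N e"
    and k: "k \<in> borel_measurable (S \<Otimes>\<^sub>M S)" "\<And>z. z \<in> space (S \<Otimes>\<^sub>M S) \<Longrightarrow> \<bar>k z\<bar> \<le> C" and "0 \<le> C"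
  shows "\<bar>integral\<^sup>L (M \<Otimes>\<^sub>M M) k - integral\<^sup>L (N \<Otimes>\<^sub>M N) k\<bar> \<le> C * (mass M + mass N) * e"
proof -
  interpret M: finite_measure M by (rule finite_onD(3)[OF M])
  interpret N: finite_measure N by (rule finite_onD(3)[OF N])
  note sp = finite_onD(2)[OF M] finite_onD(2)[OF N]
  have SM: "borel_measurable (S \<Otimes>\<^sub>M S) = borel_measurable (S \<Otimes>\<^sub>M M)"
    by (intro measurable_cong_sets sets_pair_measure_cong) (simp_all add: finite_onD(1)[OF M])
  have sec: "(\<lambda>y. k (x, y)) \<in> borel_measurable S" "(\<lambda>y. k (y, x)) \<in> borel_measurable S" if "x \<in> space S" for x
    using measurable_compose[OF measurable_Pair1'[OF that] k(1)]
      measurable_compose[OF measurable_Pair2'[OF that] k(1)] by simp_all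
  have bd: "\<bar>k (x, y)\<bar> \<le> C" if "x \<in> space S" "y \<in> space S" for x y
    using that by (intro k(2)) (simp add: space_pair_measure)
  define u where "u x = (LINT y|M. k (x, y))" for x
  have "case_prod (\<lambda>x y. k (x, y)) \<in> borel_measurable (S \<Otimes>\<^sub>M M)" using k(1) unfolding SM by simp
  then have u_meas: "u \<in> borel_measurable S"
    unfolding u_def by (rule M.borel_measurable_lebesgue_integral)
  have u_bd: "\<bar>u x\<bar> \<le> C * mass M" if "x \<in> space S" for x
    unfolding u_def using that bd sec(1)[OF that] finite_onD[OF M]
    by (intro integral_bounded) simp_all
  have "\<bar>(LINT x|M. u x) - (LINT x|N. u x)\<bar> \<le> C * mass M * e"
    by (rule tv_leD_scaled[OF e u_meas u_bd]) (use \<open>0 \<le> C\<close> in auto)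
  moreover have "\<bar>(LINT y|M. LINT x|N. k (x, y)) - (LINT y|N. LINT x|N. k (x, y))\<bar> \<le> C * mass N * e"
  proof (rule tv_leD_scaled[OF e])
    have "(\<lambda>z. k (snd z, fst z)) \<in> borel_measurable (S \<Otimes>\<^sub>M S)"
      by (rule measurable_compose[OF _ k(1)]) measurable
    also have "borel_measurable (S \<Otimes>\<^sub>M S) = borel_measurable (S \<Otimes>\<^sub>M N)"
      by (intro measurable_cong_sets sets_pair_measure_cong) (simp_all add: finite_onD(1)[OF N])
    finally have "case_prod (\<lambda>x y. k (y, x)) \<in> borel_measurable (S \<Otimes>\<^sub>M N)"
      by (simp add: case_prod_beta')
    then show "(\<lambda>y. LINT x|N. k (x, y)) \<in> borel_measurable S"
      by (rule N.borel_measurable_lebesgue_integral)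
    show "\<bar>LINT x|N. k (x, y)\<bar> \<le> C * mass N" if "y \<in> space S" for y
      using that bd sec(2)[OF that] finite_onD[OF N] by (intro integral_bounded) simp_all
  qed (use \<open>0 \<le> C\<close> in auto)
  moreover have "(LINT x|N. u x) = (LINT y|M. LINT x|N. k (x, y))"
    unfolding u_def using integral_pair_finite_on(2,3)[OF N M k] by simp
  ultimately show ?thesis
    using integral_pair_finite_on(2)[OF M M k] integral_pair_finite_on(3)[OF N N k]
    unfolding u_def by (simp add: algebra_simps)
qed

text \<open>The product integral is even continuous in time: convergence in total variation
  tolerates a kernel that is merely bounded and measurable.\<close>

lemma integral_pair_path_measurable:
  fixes k :: "'a \<times> 'a \<Rightarrow> real"
  assumes \<mu>: "tv_path S \<mu>"
    and k: "k \<in> borel_measurable (S \<Otimes>\<^sub>M S)" "\<And>z. z \<in> space (S \<Otimes>\<^sub>M S) \<Longrightarrow> \<bar>k z\<bar> \<le> C" and "0 \<le> C"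
  shows "(\<lambda>s. integral\<^sup>L (\<mu> s \<Otimes>\<^sub>M \<mu> s) k) \<in> borel_measurable borel_time"
proof (rule borel_measurable_continuous_on_restrict, unfold continuous_on_def, intro ballI)
  fix t :: real assume "t \<in> {0..}"
  then have t: "0 \<le> t" by simp
  show "((\<lambda>s. integral\<^sup>L (\<mu> s \<Otimes>\<^sub>M \<mu> s) k) \<longlongrightarrow> integral\<^sup>L (\<mu> t \<Otimes>\<^sub>M \<mu> t) k) (at t within {0..})"
  proof (rule tendsto_if_eventually_le_mult)
    fix e :: real assume e: "0 < e" "e < 1"
    have "\<forall>\<^sub>F s in at t within {0..}. tv_le S (\<mu> s) (\<mu> t) e"
      using \<mu> t e by (simp add: tv_path_def)
    moreover have "\<forall>\<^sub>F s in at t within {0..}. 0 \<le> s"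
      by (auto simp: eventually_at_filter)
    ultimately show "\<forall>\<^sub>F s in at t within {0..}.
        \<bar>integral\<^sup>L (\<mu> s \<Otimes>\<^sub>M \<mu> s) k - integral\<^sup>L (\<mu> t \<Otimes>\<^sub>M \<mu> t) k\<bar> \<le> C * (2 * mass (\<mu> t) + 1) * e"
    proof eventually_elim
      case (elim s)
      note fin = tv_pathD[OF \<mu> elim(2)] tv_pathD[OF \<mu> t]
      have "\<bar>integral\<^sup>L (\<mu> s \<Otimes>\<^sub>M \<mu> s) k - integral\<^sup>L (\<mu> t \<Otimes>\<^sub>M \<mu> t) k\<bar> \<le> C * (mass (\<mu> s) + mass (\<mu> t)) * e"
        by (rule tv_le_pair[OF fin elim(1) k \<open>0 \<le> C\<close>])
      also have "\<dots> \<le> C * (2 * mass (\<mu> t) + 1) * e"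
        using tv_le_mass[OF fin elim(1)] e \<open>0 \<le> C\<close> by (intro mult_right_mono mult_left_mono) auto
      finally show ?case .
    qed
  qed
qed

section \<open>Evolution equations for finite measures\<close>

text \<open>\<open>W s M\<close> stands for a signed measure: \<open>W_add\<close>,
  \<open>W_scale\<close> and \<open>W_lim\<close> express linearity and countable additivity. The
  number p + q R is at once a Lipschitz constant on masses up to R and, in \<open>W_pos\<close>, a
  bound for the loss rate, so that one function \<theta> serves both purposes. The bound in
  \<open>W_mass\<close> has no quadratic part; this is what excludes blow-up.\<close>

locale measure_evolution =
  fixes S :: "'a measure" and W :: "real \<Rightarrow> 'a measure \<Rightarrow> ('a \<Rightarrow> real) \<Rightarrow> real"
    and p q :: real and N0 :: "'a measure"
  assumes p_pos: "p > 0" and q_nonneg: "q \<ge> 0" and N0: "N0 \<in> finite_on S"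
    and W_add: "\<And>s M \<phi> \<psi>. 0 \<le> s \<Longrightarrow> M \<in> finite_on S \<Longrightarrow> \<phi> \<in> bdd_fun S \<Longrightarrow> \<psi> \<in> bdd_fun S \<Longrightarrow>
      W s M (\<lambda>x. \<phi> x + \<psi> x) = W s M \<phi> + W s M \<psi>"
    and W_scale: "\<And>s M \<phi> c. 0 \<le> s \<Longrightarrow> M \<in> finite_on S \<Longrightarrow> \<phi> \<in> bdd_fun S \<Longrightarrow>
      W s M (\<lambda>x. c * \<phi> x) = c * W s M \<phi>"
    and W_lim: "\<And>s M \<phi> \<phi>'. 0 \<le> s \<Longrightarrow> M \<in> finite_on S \<Longrightarrow> (\<And>n. \<phi> n \<in> unit_fun S) \<Longrightarrow>
      (\<And>x. x \<in> space S \<Longrightarrow> (\<lambda>n. \<phi> n x) \<longlonglongrightarrow> \<phi>' x) \<Longrightarrow> (\<lambda>n. W s M (\<phi> n)) \<longlonglongrightarrow> W s M \<phi>'"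
    and W_bound: "\<And>s M \<phi> R. 0 \<le> s \<Longrightarrow> M \<in> finite_on S \<Longrightarrow> mass M \<le> R \<Longrightarrow> \<phi> \<in> unit_fun S \<Longrightarrow>
      \<bar>W s M \<phi>\<bar> \<le> p + (p + q * R) * R"
    and W_lip: "\<And>s M N \<phi> R e. 0 \<le> s \<Longrightarrow> M \<in> finite_on S \<Longrightarrow> N \<in> finite_on S \<Longrightarrow> mass M \<le> R \<Longrightarrow>
      mass N \<le> R \<Longrightarrow> tv_le S M N e \<Longrightarrow> \<phi> \<in> unit_fun S \<Longrightarrow> \<bar>W s M \<phi> - W s N \<phi>\<bar> \<le> (p + q * R) * e"
    and W_pos: "\<And>s M \<phi> R. 0 \<le> s \<Longrightarrow> M \<in> finite_on S \<Longrightarrow> mass M \<le> R \<Longrightarrow> \<phi> \<in> unit_fun S \<Longrightarrow>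
      (\<And>x. x \<in> space S \<Longrightarrow> 0 \<le> \<phi> x) \<Longrightarrow> 0 \<le> (p + q * R) * (LINT x|M. \<phi> x) + W s M \<phi>"
    and W_mass: "\<And>s M. 0 \<le> s \<Longrightarrow> M \<in> finite_on S \<Longrightarrow> W s M (\<lambda>_. 1) \<le> p * mass M + p"
    and W_meas: "\<And>\<mu> \<phi>. tv_path S \<mu> \<Longrightarrow> \<phi> \<in> unit_fun S \<Longrightarrow> (\<lambda>s. W s (\<mu> s) \<phi>) \<in> borel_measurable borel_time"
begin

definition evolves :: "(real \<Rightarrow> 'a measure) \<Rightarrow> bool" where
  "evolves \<mu> \<longleftrightarrow> tv_path S \<mu> \<and> (\<forall>t\<ge>0. \<forall>\<phi>\<in>bdd_fun S.
     (LINT x|\<mu> t. \<phi> x) = (LINT x|N0. \<phi> x) + (LINT s|leb_upto t. W s (\<mu> s) \<phi>))"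

text \<open>The factor 2 absorbs the affine growth of the mass: \<open>p \<rho> + p \<le> 2 p \<rho>\<close> because \<open>\<rho> \<ge> 1\<close>.\<close>

definition \<rho> :: "real \<Rightarrow> real" where "\<rho> s = (mass N0 + 1) * exp (2 * p * s)"

definition \<theta> :: "real \<Rightarrow> real" where "\<theta> s = p + q * \<rho> s"

definition \<Theta> :: "real \<Rightarrow> real" where "\<Theta> s = p * s + q * (\<rho> s - \<rho> 0) / (2 * p)"

lemma \<rho>_deriv: "(\<rho> has_real_derivative 2 * p * \<rho> s) (at s)"
  unfolding \<rho>_def by (auto intro!: derivative_eq_intros)

lemma \<Theta>_deriv: "(\<Theta> has_real_derivative \<theta> s) (at s)"
  unfolding \<Theta>_def \<theta>_def using p_pos by (auto intro!: derivative_eq_intros \<rho>_deriv)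

lemma \<Theta>_0: "\<Theta> 0 = 0"
  by (simp add: \<Theta>_def)

lemma \<rho>_ge_1: "0 \<le> s \<Longrightarrow> 1 \<le> \<rho> s"
  unfolding \<rho>_def using p_pos mult_mono[of 1 "mass N0 + 1" 1 "exp (2 * p * s)"] by simp

lemma \<rho>_mono: "s \<le> t \<Longrightarrow> \<rho> s \<le> \<rho> t"
  unfolding \<rho>_def using p_pos by (intro mult_left_mono) auto

lemma \<rho>_pos: "0 < \<rho> s"
  unfolding \<rho>_def by (simp add: add_nonneg_pos)

lemma \<theta>_mono: "s \<le> t \<Longrightarrow> \<theta> s \<le> \<theta> t"
  unfolding \<theta>_def using \<rho>_mono q_nonneg by (simp add: mult_left_mono)

lemma \<theta>_pos: "0 < \<theta> s"
  unfolding \<theta>_def using p_pos q_nonneg \<rho>_pos[of s] by (simp add: add_pos_nonneg)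

lemma \<Theta>_mono: "s \<le> t \<Longrightarrow> \<Theta> s \<le> \<Theta> t"
  unfolding \<Theta>_def using \<rho>_mono[of s t] p_pos q_nonneg
  by (intro add_mono mult_left_mono divide_right_mono) auto

lemma cont_\<rho>: "isCont \<rho> s" and cont_\<Theta>: "isCont \<Theta> s"
  using \<rho>_deriv \<Theta>_deriv DERIV_isCont by blast+

lemma cont_\<theta>: "isCont \<theta> s"
  unfolding \<theta>_def by (intro continuous_intros cont_\<rho>)

lemma borel_growth [measurable]:
  "\<rho> \<in> borel_measurable borel" "\<theta> \<in> borel_measurable borel" "\<Theta> \<in> borel_measurable borel"
  using cont_\<rho> cont_\<theta> cont_\<Theta>
  by (auto intro!: borel_measurable_continuous_onI continuous_at_imp_continuous_on)

lemma W_path_measurable: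
  assumes "tv_path S \<mu>" "\<phi> \<in> bdd_fun S"
  shows "(\<lambda>s. W s (\<mu> s) \<phi>) \<in> borel_measurable borel_time"
proof -
  obtain c \<psi> where "c > 0" and \<psi>: "\<psi> \<in> unit_fun S" and eq: "\<phi> = (\<lambda>x. c * \<psi> x)"
    by (rule bdd_fun_scaled[OF assms(2)])
  have "(\<lambda>s. c * W s (\<mu> s) \<psi>) \<in> borel_measurable borel_time"
    using W_meas[OF assms(1) \<psi>] by measurable
  then show ?thesis
    unfolding eq
    by (rule measurable_cong[THEN iffD2, rotated]) (simp add: W_scale tv_pathD[OF assms(1)] unit_fun_bdd[OF \<psi>])
qed

section \<open>The mild equation as a map on admissible paths\<close>

definition rate :: "(real \<Rightarrow> 'a measure) \<Rightarrow> ('a \<Rightarrow> real) \<Rightarrow> real \<Rightarrow> real" where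
  "rate \<mu> \<phi> s = \<theta> s * (LINT x|\<mu> s. \<phi> x) + W s (\<mu> s) \<phi>"

definition mild :: "(real \<Rightarrow> 'a measure) \<Rightarrow> real \<Rightarrow> ('a \<Rightarrow> real) \<Rightarrow> real" where
  "mild \<mu> t \<phi> = exp (- \<Theta> t) * ((LINT x|N0. \<phi> x) + (LINT s|leb_upto t. exp (\<Theta> s) * rate \<mu> \<phi> s))"

definition admissible :: "(real \<Rightarrow> 'a measure) \<Rightarrow> bool" where
  "admissible \<mu> \<longleftrightarrow> tv_path S \<mu> \<and> (\<forall>t\<ge>0. mass (\<mu> t) \<le> \<rho> t)"

text \<open>On [0,T] the two parts of \<open>rate\<close> are at most \<theta> \<rho> and p +
  \<theta> \<rho> for a unit test function. Monotonicity replaces every factor by its value at T,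
  which yields a constant that is uniform over admissible paths and unit functions.\<close>

definition rate_bound :: "real \<Rightarrow> real" where
  "rate_bound T = exp (\<Theta> T) * (p + 2 * (\<theta> T * \<rho> T))"

lemma admissibleD:
  assumes "admissible \<mu>"
  shows "tv_path S \<mu>" "0 \<le> t \<Longrightarrow> \<mu> t \<in> finite_on S" "0 \<le> t \<Longrightarrow> mass (\<mu> t) \<le> \<rho> t"
  using assms by (auto simp: admissible_def tv_pathD)

lemma integrand_measurable:
  assumes "tv_path S \<mu>" "\<phi> \<in> bdd_fun S"
  shows "(\<lambda>s. exp (\<Theta> s) * rate \<mu> \<phi> s) \<in> borel_measurable borel_time"
proof -
  note [measurable] = W_path_measurable[OF assms] integral_path_measurable[OF assms]
    borel_time_measurable[OF borel_growth(2)] borel_time_measurable[OF borel_growth(3)]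
  show ?thesis unfolding rate_def by measurable
qed

lemma integrand_bound:
  assumes "admissible \<mu>" "\<phi> \<in> unit_fun S" "0 \<le> s" "s \<le> T"
  shows "\<bar>exp (\<Theta> s) * rate \<mu> \<phi> s\<bar> \<le> rate_bound T"
proof -
  note \<mu> = admissibleD[OF assms(1)]
  have "\<bar>LINT x|\<mu> s. \<phi> x\<bar> \<le> \<rho> s"
    using finite_on_integral_le[OF \<mu>(2) assms(2)] \<mu>(3)[of s] assms by fastforce
  then have "\<bar>\<theta> s * (LINT x|\<mu> s. \<phi> x)\<bar> \<le> \<theta> s * \<rho> s"
    using \<theta>_pos[of s] by (simp add: abs_mult)
  moreover have "\<bar>W s (\<mu> s) \<phi>\<bar> \<le> p + \<theta> s * \<rho> s"
    unfolding \<theta>_def using assms \<mu> by (intro W_bound) auto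
  moreover have "\<theta> s * \<rho> s \<le> \<theta> T * \<rho> T"
    using \<theta>_mono \<rho>_mono \<theta>_pos \<rho>_pos assms by (intro mult_mono) (auto intro: less_imp_le)
  ultimately have "\<bar>rate \<mu> \<phi> s\<bar> \<le> p + 2 * (\<theta> T * \<rho> T)"
    unfolding rate_def by linarith
  then show ?thesis
    unfolding rate_bound_def abs_mult using \<Theta>_mono[OF assms(4)] by (intro mult_mono) auto
qed

lemma integrand_integrable:
  assumes "admissible \<mu>" "\<phi> \<in> bdd_fun S"
  shows "integrable (leb_upto t) (\<lambda>s. exp (\<Theta> s) * rate \<mu> \<phi> s)"
proof -
  note \<mu> = admissibleD[OF assms(1)]
  obtain c \<psi> where "c > 0" and \<psi>: "\<psi> \<in> unit_fun S" and eq: "\<phi> = (\<lambda>x. c * \<psi> x)"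
    by (rule bdd_fun_scaled[OF assms(2)])
  have "integrable (leb_upto t) (\<lambda>s. exp (\<Theta> s) * rate \<mu> \<psi> s)"
    by (rule integrable_bounded[OF leb_upto_finite leb_upto_measurable[OF integrand_measurable[OF \<mu>(1) unit_fun_bdd[OF \<psi>]]]])
      (rule integrand_bound[OF assms(1) \<psi>, where T = t]; simp)
  then have "integrable (leb_upto t) (\<lambda>s. c * (exp (\<Theta> s) * rate \<mu> \<psi> s))" by simp
  also have "integrable (leb_upto t) (\<lambda>s. c * (exp (\<Theta> s) * rate \<mu> \<psi> s)) = integrable (leb_upto t) (\<lambda>s. exp (\<Theta> s) * rate \<mu> \<phi> s)"
    unfolding eq rate_def
    by (intro Bochner_Integration.integrable_cong refl)
      (simp add: W_scale \<mu> unit_fun_bdd[OF \<psi>] algebra_simps)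
  finally show ?thesis .
qed

lemma mild_add:
  assumes "admissible \<mu>" "\<phi> \<in> bdd_fun S" "\<psi> \<in> bdd_fun S"
  shows "mild \<mu> t (\<lambda>x. \<phi> x + \<psi> x) = mild \<mu> t \<phi> + mild \<mu> t \<psi>"
proof -
  note \<mu> = admissibleD[OF assms(1)]
  have "(LINT s|leb_upto t. exp (\<Theta> s) * rate \<mu> (\<lambda>x. \<phi> x + \<psi> x) s)
      = (LINT s|leb_upto t. exp (\<Theta> s) * rate \<mu> \<phi> s + exp (\<Theta> s) * rate \<mu> \<psi> s)"
    by (intro Bochner_Integration.integral_cong refl)
      (simp add: rate_def W_add \<mu> assms finite_on_integrable[OF \<mu>(2)] algebra_simps)
  then show ?thesis
    unfolding mild_def by (simp add: integrand_integrable assms finite_on_integrable[OF N0] algebra_simps)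
qed

lemma mild_scale:
  assumes "admissible \<mu>" "\<phi> \<in> bdd_fun S"
  shows "mild \<mu> t (\<lambda>x. c * \<phi> x) = c * mild \<mu> t \<phi>"
proof -
  note \<mu> = admissibleD[OF assms(1)]
  have "(LINT s|leb_upto t. exp (\<Theta> s) * rate \<mu> (\<lambda>x. c * \<phi> x) s) = (LINT s|leb_upto t. c * (exp (\<Theta> s) * rate \<mu> \<phi> s))"
    by (intro Bochner_Integration.integral_cong refl)
      (simp add: rate_def W_scale \<mu> assms algebra_simps)
  then show ?thesis
    unfolding mild_def by (simp add: algebra_simps)
qed

text \<open>Admissibility allows \<open>W_pos\<close> to be used with R = \<rho> s, and p + q R is
  then exactly \<theta> s. So the added multiple of the measure outweighs the losses at every
  time.\<close>

lemma mild_pos: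
  assumes "admissible \<mu>" "\<phi> \<in> unit_fun S" "\<And>x. x \<in> space S \<Longrightarrow> 0 \<le> \<phi> x"
  shows "0 \<le> mild \<mu> t \<phi>"
proof -
  note \<mu> = admissibleD[OF assms(1)]
  have "0 \<le> rate \<mu> \<phi> s" if "0 \<le> s" for s
    unfolding rate_def \<theta>_def using that \<mu> assms by (intro W_pos) auto
  then show ?thesis
    unfolding mild_def using finite_onD(2)[OF N0] assms
    by (auto intro!: mult_nonneg_nonneg add_nonneg_nonneg Bochner_Integration.integral_nonneg)
qed

text \<open>Dominated convergence is applied twice, first in the state variable at each fixed time
  and then in time, with the constant majorant \<open>rate_bound t\<close>.\<close>

lemma mild_lim:
  assumes "admissible \<mu>" "\<And>n. \<phi> n \<in> unit_fun S" "\<And>x. x \<in> space S \<Longrightarrow> (\<lambda>n. \<phi> n x) \<longlonglongrightarrow> \<phi>' x"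
  shows "(\<lambda>n. mild \<mu> t (\<phi> n)) \<longlonglongrightarrow> mild \<mu> t \<phi>'"
proof -
  note \<mu> = admissibleD[OF assms(1)]
  have \<phi>': "\<phi>' \<in> unit_fun S" by (rule unit_fun_limit[OF assms(2,3)])
  have int: "(\<lambda>n. LINT x|M. \<phi> n x) \<longlonglongrightarrow> (LINT x|M. \<phi>' x)" if "M \<in> finite_on S" for M
    using finite_onD[OF that] unit_funD[OF assms(2)] unit_funD[OF \<phi>'] assms(3)
    by (intro integral_tendsto_bounded[where c = 1]) simp_all
  show ?thesis
    unfolding mild_def
  proof (rule tendsto_mult[OF tendsto_const tendsto_add[OF int[OF N0]]],
      rule integral_tendsto_bounded[where c = "rate_bound t"])
    show "finite_measure (leb_upto t)" by (rule leb_upto_finite)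
    show "(\<lambda>s. exp (\<Theta> s) * rate \<mu> (\<phi> n) s) \<in> borel_measurable (leb_upto t)" for n
      by (intro leb_upto_measurable integrand_measurable \<mu> unit_fun_bdd assms(2))
    show "(\<lambda>s. exp (\<Theta> s) * rate \<mu> \<phi>' s) \<in> borel_measurable (leb_upto t)"
      by (intro leb_upto_measurable integrand_measurable \<mu> unit_fun_bdd \<phi>')
    show "\<bar>exp (\<Theta> s) * rate \<mu> (\<phi> n) s\<bar> \<le> rate_bound t" if "s \<in> space (leb_upto t)" for n s
      by (rule integrand_bound[OF assms(1,2)]) (use that in auto)
    show "(\<lambda>n. exp (\<Theta> s) * rate \<mu> (\<phi> n) s) \<longlonglongrightarrow> exp (\<Theta> s) * rate \<mu> \<phi>' s" if "s \<in> space (leb_upto t)" for s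
      unfolding rate_def using that by (intro tendsto_intros int W_lim \<mu> assms(2,3)) auto
  qed
qed

text \<open>The upper bound (\<theta> + 2 p) \<rho> for the rate of the mass, multiplied by
  exp(\<Theta>), is the exact derivative of exp(\<Theta>) \<rho>. Its integral is exp(\<Theta>(t))
  \<rho>(t) - \<rho>(0), and \<rho>(0) exceeds the initial mass. So \<rho> is a supersolution of the
  mild mass equation.\<close>

lemma mild_one_le:
  assumes "admissible \<mu>" "0 \<le> t"
  shows "mild \<mu> t (\<lambda>_. 1) \<le> \<rho> t"
proof -
  note \<mu> = admissibleD[OF assms(1)]
  have one: "(\<lambda>_. 1) \<in> unit_fun S" by (rule const_unit) simp
  have H1: "rate \<mu> (\<lambda>_. 1) s \<le> (\<theta> s + 2 * p) * \<rho> s" if "0 \<le> s" for s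
  proof -
    have "\<theta> s * mass (\<mu> s) \<le> \<theta> s * \<rho> s"
      using \<mu>(3)[OF that] \<theta>_pos[of s] by simp
    moreover have "p * mass (\<mu> s) \<le> p * \<rho> s" "p \<le> p * \<rho> s"
      using \<mu>(3)[OF that] p_pos \<rho>_ge_1[OF that] by auto
    ultimately show ?thesis
      unfolding rate_def using W_mass[OF that \<mu>(2)[OF that]] by (simp add: algebra_simps)
  qed
  have F: "((\<lambda>s. exp (\<Theta> s) * \<rho> s) has_real_derivative exp (\<Theta> s) * ((\<theta> s + 2 * p) * \<rho> s)) (at s)" for s
    by (auto intro!: derivative_eq_intros \<Theta>_deriv \<rho>_deriv simp: algebra_simps)
  have cont: "isCont (\<lambda>s. exp (\<Theta> s) * ((\<theta> s + 2 * p) * \<rho> s)) s" for s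
    by (intro continuous_intros cont_\<Theta> cont_\<theta> cont_\<rho>)
  have "(LINT s|leb_upto t. exp (\<Theta> s) * rate \<mu> (\<lambda>_. 1) s) \<le> (LINT s|leb_upto t. exp (\<Theta> s) * ((\<theta> s + 2 * p) * \<rho> s))"
  proof (rule integral_mono)
    show "integrable (leb_upto t) (\<lambda>s. exp (\<Theta> s) * rate \<mu> (\<lambda>_. 1) s)"
      by (rule integrand_integrable[OF assms(1) unit_fun_bdd[OF one]])
    have "(\<lambda>s. exp (\<Theta> s) * ((\<theta> s + 2 * p) * \<rho> s)) \<in> borel_measurable borel" by measurable
    from leb_upto_measurable[OF borel_time_measurable[OF this]]
    show "integrable (leb_upto t) (\<lambda>s. exp (\<Theta> s) * ((\<theta> s + 2 * p) * \<rho> s))"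
    proof (rule integrable_bounded[OF leb_upto_finite])
      fix s assume "s \<in> space (leb_upto t)"
      then have s: "s \<le> t" by simp
      show "\<bar>exp (\<Theta> s) * ((\<theta> s + 2 * p) * \<rho> s)\<bar> \<le> exp (\<Theta> t) * ((\<theta> t + 2 * p) * \<rho> t)"
        unfolding abs_mult
        using \<Theta>_mono[OF s] \<theta>_mono[OF s] \<rho>_mono[OF s] \<theta>_pos[of s] \<rho>_pos[of s] \<rho>_pos[of t] p_pos
        by (intro mult_mono) auto
    qed
  qed (use H1 in auto)
  also have "\<dots> = exp (\<Theta> t) * \<rho> t - \<rho> 0"
    using integral_FTC_leb_upto[OF assms(2) F cont] by (simp add: \<Theta>_0)
  finally have "mild \<mu> t (\<lambda>_. 1) \<le> exp (- \<Theta> t) * (mass N0 + (exp (\<Theta> t) * \<rho> t - \<rho> 0))"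
    unfolding mild_def by (intro mult_left_mono add_mono) auto
  also have "\<dots> \<le> exp (- \<Theta> t) * (exp (\<Theta> t) * \<rho> t)"
    by (intro mult_left_mono) (auto simp: \<rho>_def)
  finally show ?thesis by (simp add: mult.assoc[symmetric] flip: exp_add)
qed

text \<open>Continuity has to be uniform over unit functions. The time integral is Lipschitz with
  constant \<open>rate_bound T\<close>, which does not see the test function; the exponential
  prefactor is continuous, and its cofactor at t is bounded by \<open>D\<close>.\<close>

lemma mild_path:
  assumes "admissible \<mu>" and fin: "\<And>t. 0 \<le> t \<Longrightarrow> \<nu> t \<in> finite_on S"
    and \<nu>: "\<And>t \<phi>. 0 \<le> t \<Longrightarrow> \<phi> \<in> bdd_fun S \<Longrightarrow> (LINT x|\<nu> t. \<phi> x) = mild \<mu> t \<phi>"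
  shows "tv_path S \<nu>"
  unfolding tv_path_def
proof (intro conjI allI impI fin)
  fix t e :: real assume t: "0 \<le> t" and e: "0 < e"
  \<comment> \<open>One unit of room to the right of t, so that nearby later times still lie in
    [0,T].\<close>
  define T where "T = t + 1"
  define D where "D = mass N0 + rate_bound T * t"
  let ?r = "\<lambda>s. rate_bound T * \<bar>s - t\<bar> + \<bar>exp (- \<Theta> s) - exp (- \<Theta> t)\<bar> * D"
  have "(?r \<longlongrightarrow> rate_bound T * \<bar>t - t\<bar> + \<bar>exp (- \<Theta> t) - exp (- \<Theta> t)\<bar> * D) (at t within {0..})"
    by (intro tendsto_intros isCont_tendsto_compose[OF cont_\<Theta>])
  then have ev1: "\<forall>\<^sub>F s in at t within {0..}. ?r s < e"
    by (rule order_tendstoD(2)) (use e in simp)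
  have ev2: "\<forall>\<^sub>F s in at t within {0..}. s < T"
    by (rule order_tendstoD(2)[OF tendsto_ident_at]) (simp add: T_def)
  have ev3: "\<forall>\<^sub>F s in at t within {0..}. 0 \<le> s"
    by (auto simp: eventually_at_filter)
  from ev1 ev2 ev3 show "\<forall>\<^sub>F s in at t within {0..}. tv_le S (\<nu> s) (\<nu> t) e"
  proof eventually_elim
    case (elim s)
    show ?case
      unfolding tv_le_def
    proof
      fix \<phi> assume \<phi>: "\<phi> \<in> unit_fun S"
      define A where "A s = (LINT x|N0. \<phi> x) + (LINT s|leb_upto s. exp (\<Theta> s) * rate \<mu> \<phi> s)" for s
      note meas = integrand_measurable[OF admissibleD(1)[OF assms(1)] unit_fun_bdd[OF \<phi>]]
      have lip: "\<bar>A x - A y\<bar> \<le> rate_bound T * \<bar>x - y\<bar>" if "0 \<le> x" "x \<le> T" "0 \<le> y" "y \<le> T" for x y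
        using integral_leb_upto_lipschitz[OF meas integrand_bound[OF assms(1) \<phi>] that] by (simp add: A_def)
      \<comment> \<open>The integral over the null interval {0} vanishes. So \<open>A 0\<close> is
        the initial value, and the Lipschitz bound from time 0 controls \<open>A t\<close>.\<close>
      have "\<bar>LINT s|leb_upto 0. exp (\<Theta> s) * rate \<mu> \<phi> s\<bar> \<le> rate_bound 0 * mass (leb_upto 0)"
        by (rule integral_bounded[OF leb_upto_finite leb_upto_measurable[OF meas]])
          (rule integrand_bound[OF assms(1) \<phi>]; simp)
      then have "A 0 = (LINT x|N0. \<phi> x)"
        unfolding mass_leb_upto A_def by simp
      then have "\<bar>A t\<bar> \<le> D"
        using lip[of t 0] finite_on_integral_le[OF N0 \<phi>] t by (simp add: D_def T_def)
      have exp_le: "exp (- \<Theta> s) \<le> 1" using \<Theta>_mono[OF elim(3)] by (simp add: \<Theta>_0)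
      have "\<bar>(LINT x|\<nu> s. \<phi> x) - (LINT x|\<nu> t. \<phi> x)\<bar> = \<bar>exp (- \<Theta> s) * A s - exp (- \<Theta> t) * A t\<bar>"
        using elim t by (simp add: \<nu> unit_fun_bdd[OF \<phi>] mild_def A_def)
      also have "\<dots> = \<bar>exp (- \<Theta> s) * (A s - A t) + (exp (- \<Theta> s) - exp (- \<Theta> t)) * A t\<bar>"
        by (simp add: algebra_simps)
      also have "\<dots> \<le> exp (- \<Theta> s) * \<bar>A s - A t\<bar> + \<bar>exp (- \<Theta> s) - exp (- \<Theta> t)\<bar> * \<bar>A t\<bar>"
        by (rule order_trans[OF abs_triangle_ineq]) (simp add: abs_mult)
      also have "\<dots> \<le> 1 * (rate_bound T * \<bar>s - t\<bar>) + \<bar>exp (- \<Theta> s) - exp (- \<Theta> t)\<bar> * D"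
        using lip[of s t] elim t exp_le \<open>\<bar>A t\<bar> \<le> D\<close>
        by (intro add_mono mult_mono mult_left_mono) (auto simp: T_def)
      finally show "\<bar>(LINT x|\<nu> s. \<phi> x) - (LINT x|\<nu> t. \<phi> x)\<bar> \<le> e" using elim(1) by simp
    qed
  qed
qed

lemma picard_step:
  assumes "admissible \<mu>"
  shows "\<exists>\<nu>. admissible \<nu> \<and> (\<forall>t\<ge>0. \<forall>\<phi>\<in>bdd_fun S. (LINT x|\<nu> t. \<phi> x) = mild \<mu> t \<phi>)"
proof -
  have "\<exists>M\<in>finite_on S. \<forall>\<phi>\<in>bdd_fun S. (LINT x|M. \<phi> x) = mild \<mu> t \<phi>" for t
    by (rule functional_representation; rule mild_add[OF assms] mild_scale[OF assms] mild_pos[OF assms] mild_lim[OF assms])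
  then obtain \<nu> where \<nu>: "\<And>t. \<nu> t \<in> finite_on S" "\<And>t \<phi>. \<phi> \<in> bdd_fun S \<Longrightarrow> (LINT x|\<nu> t. \<phi> x) = mild \<mu> t \<phi>"
    by metis
  have "mass (\<nu> t) \<le> \<rho> t" if "0 \<le> t" for t
    using mild_one_le[OF assms that] \<nu>(2)[OF unit_fun_bdd[OF const_unit[of 1]], of t] by simp
  moreover have "tv_path S \<nu>" by (rule mild_path[OF assms]) (use \<nu> in auto)
  ultimately show ?thesis using \<nu> by (auto simp: admissible_def)
qed

text \<open>The two parts of \<open>rate\<close> are each Lipschitz with constant \<theta>, whence
  the factor 2; the exponentials in front of and inside the integral cancel after both are estimated
  at time t. The power s^n in the hypothesis is the shape that this estimate reproduces with n +
  1.\<close>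

lemma mild_contraction:
  assumes "admissible \<mu>" "admissible \<nu>" "0 \<le> t" "0 \<le> c" "\<phi> \<in> unit_fun S"
    and close: "\<And>s. 0 \<le> s \<Longrightarrow> s \<le> t \<Longrightarrow> tv_le S (\<mu> s) (\<nu> s) (c * s ^ n)"
  shows "\<bar>mild \<mu> t \<phi> - mild \<nu> t \<phi>\<bar> \<le> c * (2 * \<theta> t) * (t ^ Suc n / Suc n)"
proof -
  note \<mu> = admissibleD[OF assms(1)] and \<nu> = admissibleD[OF assms(2)]
  note b = unit_fun_bdd[OF assms(5)]
  let ?f = "\<lambda>s. exp (\<Theta> s) * rate \<mu> \<phi> s" and ?g = "\<lambda>s. exp (\<Theta> s) * rate \<nu> \<phi> s"
  let ?k = "exp (\<Theta> t) * (2 * \<theta> t * c)"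
  have le: "\<bar>?f s - ?g s\<bar> \<le> ?k * s ^ n" if "0 \<le> s" "s \<le> t" for s
  proof -
    have "\<bar>(LINT x|\<mu> s. \<phi> x) - (LINT x|\<nu> s. \<phi> x)\<bar> \<le> c * s ^ n"
      by (rule tv_leD[OF close assms(5)]) fact+
    then have "\<bar>\<theta> s * ((LINT x|\<mu> s. \<phi> x) - (LINT x|\<nu> s. \<phi> x))\<bar> \<le> \<theta> s * (c * s ^ n)"
      using \<theta>_pos[of s] by (simp add: abs_mult)
    moreover have "\<bar>W s (\<mu> s) \<phi> - W s (\<nu> s) \<phi>\<bar> \<le> \<theta> s * (c * s ^ n)"
      unfolding \<theta>_def using that assms(5) \<mu> \<nu> by (intro W_lip close) auto
    moreover have "\<theta> s * (c * s ^ n) \<le> \<theta> t * (c * s ^ n)"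
      using \<theta>_mono[OF that(2)] that(1) assms(4) by (intro mult_right_mono) auto
    ultimately have "\<bar>rate \<mu> \<phi> s - rate \<nu> \<phi> s\<bar> \<le> 2 * (\<theta> t * (c * s ^ n))"
      unfolding rate_def right_diff_distrib by linarith
    then have "exp (\<Theta> s) * \<bar>rate \<mu> \<phi> s - rate \<nu> \<phi> s\<bar> \<le> exp (\<Theta> t) * (2 * (\<theta> t * (c * s ^ n)))"
      using \<Theta>_mono[OF that(2)] by (intro mult_mono) auto
    also have "exp (\<Theta> s) * \<bar>rate \<mu> \<phi> s - rate \<nu> \<phi> s\<bar> = \<bar>?f s - ?g s\<bar>"
      by (simp add: abs_mult flip: right_diff_distrib)
    finally show ?thesis by (simp add: ac_simps)
  qed
  have "\<bar>(LINT s|leb_upto t. ?f s) - (LINT s|leb_upto t. ?g s)\<bar> \<le> ?k * (t ^ Suc n / Suc n)"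
    using assms(4) \<theta>_pos[of t]
    by (intro integral_leb_upto_diff_le_power integrand_integrable assms b le) auto
  then have "exp (- \<Theta> t) * \<bar>(LINT s|leb_upto t. ?f s) - (LINT s|leb_upto t. ?g s)\<bar> \<le> exp (- \<Theta> t) * (?k * (t ^ Suc n / Suc n))"
    by (intro mult_left_mono) auto
  also have "\<dots> = c * (2 * \<theta> t) * (t ^ Suc n / Suc n)"
    by (simp add: mult.assoc[symmetric] flip: exp_add)
  also have "exp (- \<Theta> t) * \<bar>(LINT s|leb_upto t. ?f s) - (LINT s|leb_upto t. ?g s)\<bar> = \<bar>mild \<mu> t \<phi> - mild \<nu> t \<phi>\<bar>"
    by (simp add: mild_def abs_mult flip: right_diff_distrib)
  finally show ?thesis .
qed

section \<open>Convergence of the Picard iteration\<close>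

lemma null_measure_finite_on: "null_measure S \<in> finite_on S"
  by (auto simp: finite_on_def intro!: finite_measureI)

text \<open>All integrals of the zero path vanish, so with this start each iterate is exactly the
  sum of the successive differences before it.\<close>

lemma picard_sequence:
  obtains X where "X 0 = (\<lambda>_. null_measure S)" "\<And>n. admissible (X n)"
    "\<And>n t \<phi>. 0 \<le> t \<Longrightarrow> \<phi> \<in> bdd_fun S \<Longrightarrow> (LINT x|X (Suc n) t. \<phi> x) = mild (X n) t \<phi>"
proof -
  have "admissible (\<lambda>_. null_measure S)"
    using less_imp_le[OF \<rho>_pos]
    by (auto simp: admissible_def tv_path_def tv_le_def null_measure_finite_on intro!: always_eventually)
  then have "\<exists>X. \<forall>n. (admissible (X n) \<and> (n = 0 \<longrightarrow> X n = (\<lambda>_. null_measure S))) \<and>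
      (\<forall>t\<ge>0. \<forall>\<phi>\<in>bdd_fun S. (LINT x|X (Suc n) t. \<phi> x) = mild (X n) t \<phi>)"
    using picard_step by (intro dependent_nat_choice) auto
  then show thesis using that by blast
qed

text \<open>Coefficient of t^n in the bound for the n-th Picard difference on [0,T]. The first
  difference is at most 2 \<rho>(T), by the mass bound; every further step contributes 2 \<theta>(T)
  and a division by the new index.\<close>

definition gap :: "real \<Rightarrow> nat \<Rightarrow> real" where
  "gap T n = 2 * \<rho> T * (2 * \<theta> T) ^ n / fact n"

lemma gap_nonneg: "0 \<le> gap T n"
  unfolding gap_def using \<rho>_pos[of T] \<theta>_pos[of T] by simp

lemma gap_summable: "summable (\<lambda>n. gap T n * T ^ n)"
proof -
  have "summable (\<lambda>n. 2 * \<rho> T * (inverse (fact n) * (2 * \<theta> T * T) ^ n))"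
    by (intro summable_mult summable_exp)
  then show ?thesis by (simp add: gap_def divide_inverse power_mult_distrib mult_ac)
qed

lemma picard_gap:
  assumes X: "\<And>n. admissible (X n)"
    "\<And>n t \<phi>. 0 \<le> t \<Longrightarrow> \<phi> \<in> bdd_fun S \<Longrightarrow> (LINT x|X (Suc n) t. \<phi> x) = mild (X n) t \<phi>"
    and "0 \<le> t" "t \<le> T"
  shows "tv_le S (X (Suc n) t) (X n t) (gap T n * t ^ n)"
  using assms(3,4)
proof (induction n arbitrary: t)
  case 0
  show ?case
    unfolding tv_le_def
  proof
    fix \<phi> assume \<phi>: "\<phi> \<in> unit_fun S"
    have "\<bar>LINT x|X n t. \<phi> x\<bar> \<le> \<rho> T" for n
      using finite_on_integral_le[OF admissibleD(2)[OF X(1)] \<phi>, of t n] admissibleD(3)[OF X(1), of t n] \<rho>_mono[of t T] 0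
      by linarith
    from this[of 0] this[of "Suc 0"]
    show "\<bar>(LINT x|X (Suc 0) t. \<phi> x) - (LINT x|X 0 t. \<phi> x)\<bar> \<le> gap T 0 * t ^ 0"
      by (simp add: gap_def)
  qed
next
  case (Suc n)
  show ?case
    unfolding tv_le_def
  proof
    fix \<phi> assume \<phi>: "\<phi> \<in> unit_fun S"
    have "\<bar>mild (X (Suc n)) t \<phi> - mild (X n) t \<phi>\<bar> \<le> gap T n * (2 * \<theta> t) * (t ^ Suc n / Suc n)"
      by (rule mild_contraction[OF X(1) X(1)]) (use Suc gap_nonneg \<phi> in auto)
    also have "\<dots> \<le> gap T n * (2 * \<theta> T) * (t ^ Suc n / Suc n)"
      using \<theta>_mono[of t T] Suc.prems gap_nonneg by (intro mult_right_mono mult_left_mono) auto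
    also have "\<dots> = gap T (Suc n) * t ^ Suc n"
      by (simp add: gap_def del: of_nat_Suc) (simp add: algebra_simps)
    finally show "\<bar>(LINT x|X (Suc (Suc n)) t. \<phi> x) - (LINT x|X (Suc n) t. \<phi> x)\<bar> \<le> gap T (Suc n) * t ^ Suc n"
      using Suc.prems by (simp add: X(2) unit_fun_bdd[OF \<phi>])
  qed
qed

text \<open>The M-test runs over pairs of a time in [0,T] and a unit function. Uniformity in the
  function lets the limit functional inherit continuity under bounded pointwise limits by a
  three-epsilon argument, so that it is a measure again; uniformity in time will make the limit path
  continuous.\<close>

lemma picard_limit:
  assumes X0: "X 0 = (\<lambda>_. null_measure S)" and X: "\<And>n. admissible (X n)"
    "\<And>n t \<phi>. 0 \<le> t \<Longrightarrow> \<phi> \<in> bdd_fun S \<Longrightarrow> (LINT x|X (Suc n) t. \<phi> x) = mild (X n) t \<phi>"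
  shows "\<exists>\<mu>. (\<forall>t\<ge>0. \<mu> t \<in> finite_on S) \<and>
    (\<forall>T. \<forall>e>0. \<forall>\<^sub>F n in sequentially. \<forall>t\<in>{0..T}. tv_le S (X n t) (\<mu> t) e)"
proof -
  define L :: "real \<Rightarrow> ('a \<Rightarrow> real) \<Rightarrow> real" where "L t \<phi> = lim (\<lambda>n. LINT x|X n t. \<phi> x)" for t \<phi>
  note fin = admissibleD(2)[OF X(1)]
  have unif: "uniform_limit ({0..T} \<times> unit_fun S) (\<lambda>n z. LINT x|X n (fst z). snd z x)
      (\<lambda>z. L (fst z) (snd z)) sequentially" for T
  proof -
    let ?A = "{0..T} \<times> unit_fun S"
    let ?d = "\<lambda>n z. (LINT x|X (Suc n) (fst z). snd z x) - (LINT x|X n (fst z). snd z x)"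
    have start: "(LINT x|X 0 (fst z). snd z x) = 0" if "z \<in> ?A" for z
      using that finite_on_integral_le[OF null_measure_finite_on, of "snd z"] by (auto simp: X0)
    have "uniform_limit ?A (\<lambda>n z. \<Sum>i<n. ?d i z) (\<lambda>z. suminf (\<lambda>i. ?d i z)) sequentially"
    proof (rule Weierstrass_m_test[OF _ gap_summable[of T]])
      fix n z assume z: "z \<in> ?A"
      then have "\<bar>?d n z\<bar> \<le> gap T n * fst z ^ n"
        by (intro tv_leD[OF picard_gap[of X, OF X]]) auto
      also have "\<dots> \<le> gap T n * T ^ n"
        using z gap_nonneg by (intro mult_left_mono power_mono) auto
      finally show "norm (?d n z) \<le> gap T n * T ^ n" by simp
    qed
    moreover have "(\<Sum>i<n. ?d i z) = (LINT x|X n (fst z). snd z x)" if "z \<in> ?A" for n z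
      using start[OF that] sum_lessThan_telescope[of "\<lambda>i. LINT x|X i (fst z). snd z x" n] by simp
    ultimately have u: "uniform_limit ?A (\<lambda>n z. LINT x|X n (fst z). snd z x) (\<lambda>z. suminf (\<lambda>i. ?d i z)) sequentially"
      by (subst (asm) uniform_limit_cong'[where g = "\<lambda>n z. LINT x|X n (fst z). snd z x"]) auto
    have "suminf (\<lambda>i. ?d i z) = L (fst z) (snd z)" if "z \<in> ?A" for z
      unfolding L_def using tendsto_uniform_limitI[OF u that] by (rule limI[symmetric])
    then show ?thesis
      by (subst uniform_limit_cong'[where i = "\<lambda>z. suminf (\<lambda>i. ?d i z)"]) (auto intro: u)
  qed
  have close: "\<forall>\<^sub>F n in sequentially. \<forall>t\<in>{0..T}. \<forall>\<phi>\<in>unit_fun S. \<bar>(LINT x|X n t. \<phi> x) - L t \<phi>\<bar> \<le> e"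
    if "0 < e" for T e
    using uniform_limitD[OF unif that, of T]
    by eventually_elim (auto simp: dist_real_def intro: less_imp_le)
  have lim_unit: "(\<lambda>n. LINT x|X n t. \<phi> x) \<longlonglongrightarrow> L t \<phi>" if "0 \<le> t" "\<phi> \<in> unit_fun S" for t \<phi>
    using tendsto_uniform_limitI[OF unif[of t], of "(t, \<phi>)"] that by simp
  have lim: "(\<lambda>n. LINT x|X n t. \<phi> x) \<longlonglongrightarrow> L t \<phi>" if t: "0 \<le> t" and \<phi>: "\<phi> \<in> bdd_fun S" for t \<phi>
  proof -
    obtain c \<psi> where "c > 0" and \<psi>: "\<psi> \<in> unit_fun S" and eq: "\<phi> = (\<lambda>x. c * \<psi> x)"
      by (rule bdd_fun_scaled[OF \<phi>])
    have "(\<lambda>n. LINT x|X n t. \<phi> x) \<longlonglongrightarrow> c * L t \<psi>"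
      unfolding eq using lim_unit[OF t \<psi>] by (auto intro!: tendsto_intros)
    then show ?thesis unfolding L_def by (simp add: limI)
  qed
  have "\<exists>M\<in>finite_on S. \<forall>\<phi>\<in>bdd_fun S. (LINT x|M. \<phi> x) = L t \<phi>" if t: "0 \<le> t" for t
  proof (rule functional_representation)
    fix \<phi> \<psi> assume *: "\<phi> \<in> bdd_fun S" "\<psi> \<in> bdd_fun S"
    have "(\<lambda>n. LINT x|X n t. \<phi> x + \<psi> x) \<longlonglongrightarrow> L t \<phi> + L t \<psi>"
      using tendsto_add[OF lim[OF t *(1)] lim[OF t *(2)]] finite_on_integrable[OF fin[OF t]] * by simp
    then show "L t (\<lambda>x. \<phi> x + \<psi> x) = L t \<phi> + L t \<psi>" unfolding L_def by (rule limI)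
  next
    fix c \<phi> assume "\<phi> \<in> bdd_fun S"
    then have "(\<lambda>n. LINT x|X n t. c * \<phi> x) \<longlonglongrightarrow> c * L t \<phi>"
      using tendsto_mult[OF tendsto_const lim[OF t]] by simp
    then show "L t (\<lambda>x. c * \<phi> x) = c * L t \<phi>" unfolding L_def by (rule limI)
  next
    fix \<phi> assume "\<phi> \<in> unit_fun S" and nn: "\<And>x. x \<in> space S \<Longrightarrow> 0 \<le> \<phi> x"
    then show "0 \<le> L t \<phi>"
      using finite_onD(2)[OF fin[OF t]]
      by (intro LIMSEQ_le_const[OF lim_unit[OF t]] exI[of _ 0]) (auto intro!: Bochner_Integration.integral_nonneg)
  next
    fix \<phi> \<phi>' assume \<phi>: "\<And>n. \<phi> n \<in> unit_fun S" "\<And>x. x \<in> space S \<Longrightarrow> (\<lambda>n. \<phi> n x) \<longlonglongrightarrow> \<phi>' x"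
    have \<phi>': "\<phi>' \<in> unit_fun S" by (rule unit_fun_limit[OF \<phi>])
    show "(\<lambda>n. L t (\<phi> n)) \<longlonglongrightarrow> L t \<phi>'"
    proof (rule tendstoI)
      fix e :: real assume e: "0 < e"
      then have "0 < e / 3" by simp
      from eventually_happens'[OF sequentially_bot close[OF this, of t]]
      obtain n where "\<forall>s\<in>{0..t}. \<forall>\<psi>\<in>unit_fun S. \<bar>(LINT x|X n s. \<psi> x) - L s \<psi>\<bar> \<le> e / 3" ..
      then have n: "\<bar>(LINT x|X n t. \<psi> x) - L t \<psi>\<bar> \<le> e / 3" if "\<psi> \<in> unit_fun S" for \<psi>
        using that t by auto
      note M = finite_onD[OF fin[OF t, of n]]
      have "(\<lambda>k. LINT x|X n t. \<phi> k x) \<longlonglongrightarrow> (LINT x|X n t. \<phi>' x)"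
        using M unit_funD[OF \<phi>(1)] unit_funD[OF \<phi>'] \<phi>(2)
        by (intro integral_tendsto_bounded[where c = 1]) simp_all
      then have "\<forall>\<^sub>F k in sequentially. dist (LINT x|X n t. \<phi> k x) (LINT x|X n t. \<phi>' x) < e / 3"
        by (rule tendstoD) (use e in simp)
      then show "\<forall>\<^sub>F k in sequentially. dist (L t (\<phi> k)) (L t \<phi>') < e"
      proof eventually_elim
        case (elim k)
        then show ?case
          using n[OF \<phi>(1), of k] n[OF \<phi>'] unfolding dist_real_def by linarith
      qed
    qed
  qed
  then obtain \<mu> where \<mu>: "\<And>t. 0 \<le> t \<Longrightarrow> \<mu> t \<in> finite_on S"
      "\<And>t \<phi>. 0 \<le> t \<Longrightarrow> \<phi> \<in> bdd_fun S \<Longrightarrow> (LINT x|\<mu> t. \<phi> x) = L t \<phi>"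
    by metis
  show ?thesis
  proof (intro exI[of _ \<mu>] conjI allI impI \<mu>(1))
    fix T e :: real assume "0 < e"
    from close[OF this, of T]
    show "\<forall>\<^sub>F n in sequentially. \<forall>t\<in>{0..T}. tv_le S (X n t) (\<mu> t) e"
      by eventually_elim (auto simp: tv_le_def \<mu>(2) unit_fun_bdd)
  qed
qed

lemma mild_solution_exists:
  obtains \<mu> where "admissible \<mu>" "\<And>t \<phi>. 0 \<le> t \<Longrightarrow> \<phi> \<in> unit_fun S \<Longrightarrow> (LINT x|\<mu> t. \<phi> x) = mild \<mu> t \<phi>"
proof -
  obtain X where X0: "X 0 = (\<lambda>_. null_measure S)" and X: "\<And>n. admissible (X n)"
    "\<And>n t \<phi>. 0 \<le> t \<Longrightarrow> \<phi> \<in> bdd_fun S \<Longrightarrow> (LINT x|X (Suc n) t. \<phi> x) = mild (X n) t \<phi>"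
    by (rule picard_sequence) blast
  obtain \<mu> where fin: "\<And>t. 0 \<le> t \<Longrightarrow> \<mu> t \<in> finite_on S"
    and close: "\<And>T e. 0 < e \<Longrightarrow> \<forall>\<^sub>F n in sequentially. \<forall>t\<in>{0..T}. tv_le S (X n t) (\<mu> t) e"
    using picard_limit[of X, OF X0 X] by blast
  have "tv_path S \<mu>"
    unfolding tv_path_def
  proof (intro conjI allI impI fin)
    fix t e :: real assume t: "0 \<le> t" and e: "0 < e"
    have "0 < e / 3" using e by simp
    from eventually_happens'[OF sequentially_bot close[OF this, of "t + 1"]]
    obtain n where "\<forall>s\<in>{0..t + 1}. tv_le S (X n s) (\<mu> s) (e / 3)" ..
    note n = bspec[OF this]
    have "\<forall>\<^sub>F s in at t within {0..}. tv_le S (X n s) (X n t) (e / 3)"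
      using admissibleD(1)[OF X(1), of n] t e by (simp add: tv_path_def)
    moreover have "\<forall>\<^sub>F s in at t within {0..}. s < t + 1"
      by (rule order_tendstoD(2)[OF tendsto_ident_at]) simp
    moreover have "\<forall>\<^sub>F s in at t within {0..}. 0 \<le> s"
      by (auto simp: eventually_at_filter)
    ultimately show "\<forall>\<^sub>F s in at t within {0..}. tv_le S (\<mu> s) (\<mu> t) e"
    proof eventually_elim
      case (elim s)
      have "tv_le S (\<mu> s) (\<mu> t) (e / 3 + (e / 3 + e / 3))"
        by (intro tv_le_trans[OF tv_le_sym[OF n]] tv_le_trans[OF elim(1) n]) (use elim t in auto)
      then show ?case by simp
    qed
  qed
  moreover have "mass (\<mu> t) \<le> \<rho> t" if t: "0 \<le> t" for t
  proof (rule field_le_epsilon)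
    fix e :: real assume "0 < e"
    from eventually_happens'[OF sequentially_bot close[OF this, of t]]
    obtain n where "\<forall>s\<in>{0..t}. tv_le S (X n s) (\<mu> s) e" ..
    then have n: "tv_le S (X n t) (\<mu> t) e" using t by simp
    show "mass (\<mu> t) \<le> \<rho> t + e"
      using tv_leD[OF n const_unit[of 1]] admissibleD(3)[OF X(1) t, of n] by simp
  qed
  ultimately have admissible: "admissible \<mu>" by (simp add: admissible_def)
  have "(LINT x|\<mu> t. \<phi> x) = mild \<mu> t \<phi>" if t: "0 \<le> t" and \<phi>: "\<phi> \<in> unit_fun S" for t \<phi>
  proof -
    have "\<bar>(LINT x|\<mu> t. \<phi> x) - mild \<mu> t \<phi>\<bar> \<le> (1 + 2 * \<theta> t * t) * e" if "0 < e" for e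
    proof -
      \<comment> \<open>Both indices must be close to the limit: the path \<open>X n\<close> enters
        the mild map, and \<open>X (Suc n)\<close> is its value.\<close>
      have "\<forall>\<^sub>F n in sequentially. (\<forall>s\<in>{0..t}. tv_le S (X n s) (\<mu> s) e) \<and> (\<forall>s\<in>{0..t}. tv_le S (X (Suc n) s) (\<mu> s) e)"
        using close[OF that, of t]
        by (intro eventually_conj) (auto simp: eventually_sequentially_Suc[where P = "\<lambda>n. \<forall>s\<in>{0..t}. tv_le S (X n s) (\<mu> s) e"])
      from eventually_happens'[OF sequentially_bot this]
      obtain n where "\<forall>s\<in>{0..t}. tv_le S (X n s) (\<mu> s) e" "\<forall>s\<in>{0..t}. tv_le S (X (Suc n) s) (\<mu> s) e"
        by blast
      then have n: "tv_le S (X n s) (\<mu> s) e" "tv_le S (X (Suc n) t) (\<mu> t) e" if "s \<in> {0..t}" for s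
        using t that by auto
      \<comment> \<open>The contraction estimate with exponent 0, that is, with a distance e that is
        constant in time.\<close>
      have "\<bar>mild (X n) t \<phi> - mild \<mu> t \<phi>\<bar> \<le> e * (2 * \<theta> t) * (t ^ Suc 0 / Suc 0)"
        by (rule mild_contraction[OF X(1) admissible]) (use that n(1) t \<phi> in auto)
      moreover have "\<bar>mild (X n) t \<phi> - (LINT x|\<mu> t. \<phi> x)\<bar> \<le> e"
        using tv_leD[OF n(2)[of t] \<phi>] t by (simp add: X(2)[OF t unit_fun_bdd[OF \<phi>]])
      ultimately show ?thesis by (simp add: algebra_simps)
    qed
    from abs_le_all_epsilon[OF this] show ?thesis by simp
  qed
  with admissible show thesis by (rule that)
qed

lemma evolution_exists: "\<exists>\<mu>. evolves \<mu>"
proof -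
  obtain \<mu> where admissible: "admissible \<mu>" and mild: "\<And>t \<phi>. 0 \<le> t \<Longrightarrow> \<phi> \<in> unit_fun S \<Longrightarrow> (LINT x|\<mu> t. \<phi> x) = mild \<mu> t \<phi>"
    by (rule mild_solution_exists) blast
  note \<mu> = admissibleD[OF admissible]
  have unit: "(LINT x|\<mu> t. \<phi> x) = (LINT x|N0. \<phi> x) + (LINT s|leb_upto t. W s (\<mu> s) \<phi>)"
    if t: "0 \<le> t" and \<phi>: "\<phi> \<in> unit_fun S" for t \<phi>
  proof (rule mild_imp_integral_equation[OF \<Theta>_deriv cont_\<theta> \<Theta>_0, where C = "\<rho> t + p + \<theta> t * \<rho> t"])
    show "(\<lambda>s. LINT x|\<mu> s. \<phi> x) \<in> borel_measurable borel_time"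
      by (rule integral_path_measurable[OF \<mu>(1) unit_fun_bdd[OF \<phi>]])
    show "(\<lambda>s. W s (\<mu> s) \<phi>) \<in> borel_measurable borel_time" by (rule W_meas[OF \<mu>(1) \<phi>])
    fix s assume s: "0 \<le> s" "s \<le> t"
    have m: "mass (\<mu> s) \<le> \<rho> t" using \<mu>(3)[OF s(1)] \<rho>_mono[OF s(2)] by simp
    have pos: "0 \<le> \<theta> t * \<rho> t" using \<theta>_pos[of t] \<rho>_pos[of t] by simp
    show "\<bar>LINT x|\<mu> s. \<phi> x\<bar> \<le> \<rho> t + p + \<theta> t * \<rho> t"
      using finite_on_integral_le[OF \<mu>(2)[OF s(1)] \<phi>] m pos p_pos by linarith
    have "\<bar>W s (\<mu> s) \<phi>\<bar> \<le> p + \<theta> t * \<rho> t"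
      unfolding \<theta>_def by (rule W_bound[OF s(1) \<mu>(2)[OF s(1)] m \<phi>])
    then show "\<bar>W s (\<mu> s) \<phi>\<bar> \<le> \<rho> t + p + \<theta> t * \<rho> t"
      using \<rho>_pos[of t] by linarith
    show "(LINT x|\<mu> s. \<phi> x) = exp (- \<Theta> s) * ((LINT x|N0. \<phi> x) +
        (LINT r|leb_upto s. exp (\<Theta> r) * (\<theta> r * (LINT x|\<mu> r. \<phi> x) + W r (\<mu> r) \<phi>)))"
      using mild[OF s(1) \<phi>] by (simp add: mild_def rate_def)
  qed (rule t)
  have "(LINT x|\<mu> t. \<phi> x) = (LINT x|N0. \<phi> x) + (LINT s|leb_upto t. W s (\<mu> s) \<phi>)"
    if t: "0 \<le> t" and \<phi>: "\<phi> \<in> bdd_fun S" for t \<phi>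
  proof -
    obtain c \<psi> where "c > 0" and \<psi>: "\<psi> \<in> unit_fun S" and eq: "\<phi> = (\<lambda>x. c * \<psi> x)"
      by (rule bdd_fun_scaled[OF \<phi>])
    have "(LINT s|leb_upto t. W s (\<mu> s) \<phi>) = (LINT s|leb_upto t. c * W s (\<mu> s) \<psi>)"
      unfolding eq
      by (intro Bochner_Integration.integral_cong refl) (simp add: W_scale \<mu> unit_fun_bdd[OF \<psi>])
    then show ?thesis using unit[OF t \<psi>] by (simp add: eq algebra_simps)
  qed
  with \<mu>(1) show ?thesis unfolding evolves_def by blast
qed

section \<open>Uniqueness\<close>

lemma path_mass_bounded:
  assumes "tv_path S \<mu>"
  shows "\<exists>R. \<forall>t\<in>{0..T}. mass (\<mu> t) \<le> R"
proof -
  have "continuous_on {0..T} (\<lambda>s. mass (\<mu> s))"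
    using continuous_on_subset[OF integral_path_continuous[OF assms const_unit[of 1]], of "{0..T}"] by simp
  from compact_imp_bounded[OF compact_continuous_image[OF this compact_Icc]]
  obtain R where "\<forall>t\<in>{0..T}. \<bar>mass (\<mu> t)\<bar> \<le> R" by (auto simp: bounded_iff)
  then show ?thesis by (auto intro: exI[of _ R])
qed

text \<open>An arbitrary solution is not known to stay below \<rho>. Continuity on the compact
  interval [0,T] gives some mass bound R instead, and iterating the original equation with the
  Lipschitz constant p + q R bounds the distance by 2 R (L t)^n / n! for every n.\<close>

lemma evolution_unique:
  assumes \<mu>: "evolves \<mu>" and \<nu>: "evolves \<nu>" and T: "0 \<le> T"
  shows "\<mu> T = \<nu> T"
proof -
  have path: "tv_path S \<mu>" "tv_path S \<nu>" using \<mu> \<nu> by (auto simp: evolves_def)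
  note fin = tv_pathD[OF path(1)] tv_pathD[OF path(2)]
  obtain R1 R2 where R12: "\<forall>t\<in>{0..T}. mass (\<mu> t) \<le> R1" "\<forall>t\<in>{0..T}. mass (\<nu> t) \<le> R2"
    using path_mass_bounded path by blast
  define R where "R = max 0 (max R1 R2)"
  have R: "mass (\<mu> t) \<le> R" "mass (\<nu> t) \<le> R" if "0 \<le> t" "t \<le> T" for t
    using that R12 by (fastforce simp: R_def le_max_iff_disj)+
  have "0 \<le> R" by (simp add: R_def)
  define L where "L = p + q * R"
  have "0 \<le> L" using p_pos q_nonneg \<open>0 \<le> R\<close> by (simp add: L_def)
  have close: "tv_le S (\<mu> t) (\<nu> t) (2 * R * L ^ n / fact n * t ^ n)" if "0 \<le> t" "t \<le> T" for n t
    using that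
  proof (induction n arbitrary: t)
    case 0
    show ?case
      unfolding tv_le_def
    proof
      fix \<phi> assume \<phi>: "\<phi> \<in> unit_fun S"
      show "\<bar>(LINT x|\<mu> t. \<phi> x) - (LINT x|\<nu> t. \<phi> x)\<bar> \<le> 2 * R * L ^ 0 / fact 0 * t ^ 0"
        using finite_on_integral_le[OF fin(1) \<phi>, of t] finite_on_integral_le[OF fin(2) \<phi>, of t] R[OF 0] 0
        by simp
    qed
  next
    case (Suc n)
    show ?case
      unfolding tv_le_def
    proof
      fix \<phi> assume \<phi>: "\<phi> \<in> unit_fun S"
      let ?c = "2 * R * L ^ n / fact n"
      have int: "integrable (leb_upto t) (\<lambda>s. W s (\<kappa> s) \<phi>)"
        if "tv_path S \<kappa>" "\<And>s. 0 \<le> s \<Longrightarrow> s \<le> T \<Longrightarrow> mass (\<kappa> s) \<le> R" for \<kappa>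
        using that Suc.prems W_bound[OF _ tv_pathD[OF that(1)] that(2) \<phi>]
        by (intro integrable_bounded[OF leb_upto_finite leb_upto_measurable[OF W_meas[OF that(1) \<phi>]],
              where c = "p + (p + q * R) * R"]) auto
      have "\<bar>(LINT s|leb_upto t. W s (\<mu> s) \<phi>) - (LINT s|leb_upto t. W s (\<nu> s) \<phi>)\<bar> \<le> (L * ?c) * (t ^ Suc n / Suc n)"
      proof (rule integral_leb_upto_diff_le_power[OF int int])
        show "0 \<le> L * ?c" using \<open>0 \<le> L\<close> \<open>0 \<le> R\<close> by simp
        fix s assume s: "0 \<le> s" "s \<le> t"
        with Suc.prems have "s \<le> T" by simp
        have "\<bar>W s (\<mu> s) \<phi> - W s (\<nu> s) \<phi>\<bar> \<le> L * (?c * s ^ n)"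
          unfolding L_def[symmetric] using W_lip[OF s(1) fin R Suc.IH \<phi>] s \<open>s \<le> T\<close> by (simp add: L_def)
        then show "\<bar>W s (\<mu> s) \<phi> - W s (\<nu> s) \<phi>\<bar> \<le> L * ?c * s ^ n" by (simp add: mult.assoc)
      qed (use path R Suc.prems in auto)
      also have "(L * ?c) * (t ^ Suc n / Suc n) = 2 * R * L ^ Suc n / fact (Suc n) * t ^ Suc n"
        by (simp add: algebra_simps del: of_nat_Suc)
      finally show "\<bar>(LINT x|\<mu> t. \<phi> x) - (LINT x|\<nu> t. \<phi> x)\<bar> \<le> 2 * R * L ^ Suc n / fact (Suc n) * t ^ Suc n"
        using \<mu> \<nu> Suc.prems unit_fun_bdd[OF \<phi>] by (simp add: evolves_def)
    qed
  qed
  show ?thesis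
  proof (rule measure_eq_if_unit_integrals_eq[OF fin(1)[OF T] fin(2)[OF T]])
    fix \<phi> assume \<phi>: "\<phi> \<in> unit_fun S"
    have "(\<lambda>n. 2 * R * (inverse (fact n) * (L * T) ^ n)) \<longlonglongrightarrow> 0"
      by (rule summable_LIMSEQ_zero[OF summable_mult[OF summable_exp]])
    then have "(\<lambda>n. 2 * R * L ^ n / fact n * T ^ n) \<longlonglongrightarrow> 0"
      by (simp add: divide_inverse power_mult_distrib mult_ac)
    then have "\<bar>(LINT x|\<mu> T. \<phi> x) - (LINT x|\<nu> T. \<phi> x)\<bar> \<le> 0"
      by (rule LIMSEQ_le_const) (use tv_leD[OF close \<phi>] T in auto)
    then show "(LINT x|\<mu> T. \<phi> x) = (LINT x|\<nu> T. \<phi> x)" by simp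
  qed
qed

end

section \<open>The coagulation-fragmentation generator\<close>

abbreviation borel01 :: "real measure" where
  "borel01 \<equiv> restrict_space borel {0<..1}"

lemma space_borel01 [simp]: "space borel01 = {0<..1}"
  by (simp add: space_restrict_space)

lemma finite_measures_eq: "finite_measures = finite_on borel01"
  by (simp add: finite_measures_def finite_on_def)

lemma finite_on_borel01_measurable:
  "M \<in> finite_on borel01 \<Longrightarrow> f \<in> borel_measurable borel \<Longrightarrow> f \<in> borel_measurable M"
  using finite_onD(4)[of M borel01] by (auto intro: measurable_restrict_space1)

lemma pair_borel01_measurable:
  fixes f :: "real \<times> real \<Rightarrow> real"
  assumes "f \<in> borel_measurable borel"
  shows "f \<in> borel_measurable (borel01 \<Otimes>\<^sub>M borel01)"
proof -
  have "fst \<in> borel_measurable (borel01 \<Otimes>\<^sub>M borel01)" "snd \<in> borel_measurable (borel01 \<Otimes>\<^sub>M borel01)"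
    by (rule measurable_compose[OF measurable_fst] measurable_compose[OF measurable_snd],
      rule measurable_restrict_space1, simp)+
  then have "(\<lambda>z. (fst z, snd z)) \<in> (borel01 \<Otimes>\<^sub>M borel01) \<rightarrow>\<^sub>M (borel \<Otimes>\<^sub>M borel)"
    by (rule measurable_Pair)
  from measurable_compose[OF this, of f borel] assms show ?thesis
    by (simp add: borel_prod)
qed

abbreviation leb01 :: "real measure" where
  "leb01 \<equiv> restrict_space lborel {0<..1}"

lemma leb01: "leb01 \<in> finite_on borel01" "mass leb01 = 1"
  by (auto simp: finite_on_def sets_restrict_space emeasure_restrict_space measure_restrict_space
      intro!: finite_measureI)

text \<open>Makes a test function Borel and bounded on the whole line, so that shifted arguments
  cause no domain conditions. The values outside (0,1] never enter: sums above 1 are redirected to 1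
  by \<open>const_ext\<close>, and fragments of x lie in (0,x).\<close>

definition ext :: "(real \<Rightarrow> real) \<Rightarrow> real \<Rightarrow> real" where
  "ext \<phi> x = indicator {0<..1} x * \<phi> x"

lemma ext_simps [simp]: "0 < x \<Longrightarrow> x \<le> 1 \<Longrightarrow> ext \<phi> x = \<phi> x"
  by (simp add: ext_def)

lemma ext_measurable: "\<phi> \<in> borel_measurable borel01 \<Longrightarrow> ext \<phi> \<in> borel_measurable borel"
  by (simp add: ext_def[abs_def] borel_measurable_restrict_space_iff)

lemma coag_A_bound:
  assumes "\<And>x. \<bar>\<psi> x\<bar> \<le> c"
  shows "\<bar>coag_A \<psi> x y\<bar> \<le> 3 * c"
proof -
  have "\<bar>const_ext \<psi> (x + y)\<bar> \<le> c" using assms by (simp add: const_ext_def)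
  with assms[of x] assms[of y] show ?thesis unfolding coag_A_def by linarith
qed

lemma coag_A_measurable:
  assumes [measurable]: "\<psi> \<in> borel_measurable borel"
  shows "(\<lambda>z. coag_A \<psi> (fst z) (snd z)) \<in> borel_measurable borel"
  unfolding coag_A_def const_ext_def borel_prod[symmetric] by measurable

text \<open>Coefficients defined on the whole plane, with a datum that is nonnegative at every point
  and vanishes up to 1. A single weight y^m controls both tails, as y > 1; with the moment bound M0
  it makes the boundary integrals bounded uniformly in time.\<close>

locale coagulation_fragmentation =
  fixes K F g :: "real \<Rightarrow> real \<Rightarrow> real" and K0 K1 F1 M0 m :: real
  assumes K_meas: "(\<lambda>z. K (fst z) (snd z)) \<in> borel_measurable borel"
    and K_nonneg: "\<And>x y. 0 \<le> K x y"
    and K_le: "\<And>x y. 0 < x \<Longrightarrow> x \<le> 1 \<Longrightarrow> 0 < y \<Longrightarrow> y \<le> 1 \<Longrightarrow> K x y \<le> K0"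
    and K_tail: "\<And>x y. 0 < x \<Longrightarrow> x \<le> 1 \<Longrightarrow> 1 < y \<Longrightarrow> K x y \<le> K1 * y powr m"
    and F_meas: "(\<lambda>z. F (fst z) (snd z)) \<in> borel_measurable borel"
    and F_nonneg: "\<And>x y. 0 \<le> F x y"
    and F_le: "\<And>x y. 0 < y \<Longrightarrow> y < x \<Longrightarrow> x \<le> 1 \<Longrightarrow> F (x - y) y \<le> F1"
    and F_tail: "\<And>x y. 0 < x \<Longrightarrow> x \<le> 1 \<Longrightarrow> 1 < y \<Longrightarrow> F (y - x) x \<le> F1 * y powr m"
    and g_meas: "\<And>s. 0 \<le> s \<Longrightarrow> g s \<in> borel_measurable borel"
    and g_nonneg: "\<And>s y. 0 \<le> g s y"
    and g_supp: "\<And>s y. y \<le> 1 \<Longrightarrow> g s y = 0"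
    and g_int: "\<And>s. 0 \<le> s \<Longrightarrow> integrable lborel (g s)"
    and g_moment_int: "\<And>s. 0 \<le> s \<Longrightarrow> integrable lborel (\<lambda>y. y powr m * g s y)"
    and g_moment: "\<And>s. 0 \<le> s \<Longrightarrow> (LBINT y. y powr m * g s y) \<le> M0"
    and g_cont: "\<And>t. 0 \<le> t \<Longrightarrow> ((\<lambda>s. LBINT y. \<bar>g s y - g t y\<bar>) \<longlongrightarrow> 0) (at t within {0..})"
    and const_nonneg: "0 \<le> K0" "0 \<le> K1" "0 \<le> F1" "0 \<le> M0" "0 \<le> m"
begin

text \<open>Common form of G and C: the kernel K gives G, and the kernel F(y - x, x) gives
  C.\<close>

definition bdy :: "(real \<Rightarrow> real \<Rightarrow> real) \<Rightarrow> real \<Rightarrow> real \<Rightarrow> real" where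
  "bdy k s x = (LBINT y. k x y * g s y)"

definition tail_kernel :: "(real \<Rightarrow> real \<Rightarrow> real) \<Rightarrow> real \<Rightarrow> bool" where
  "tail_kernel k C \<longleftrightarrow> (\<lambda>z. k (fst z) (snd z)) \<in> borel_measurable borel \<and> 0 \<le> C \<and>
     (\<forall>x y. 0 < x \<longrightarrow> x \<le> 1 \<longrightarrow> 1 < y \<longrightarrow> \<bar>k x y\<bar> \<le> C * y powr m)"

lemma tail_kernel_section:
  assumes "tail_kernel k C"
  shows "k x \<in> borel_measurable borel"
proof -
  have "(\<lambda>y. (x, y)) \<in> borel \<rightarrow>\<^sub>M (borel :: (real \<times> real) measure)"
    unfolding borel_prod[symmetric] by measurable
  from measurable_compose[OF this, of "\<lambda>z. k (fst z) (snd z)"] assms show ?thesis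
    by (simp add: tail_kernel_def)
qed

lemma tail_kernel_le:
  assumes "tail_kernel k C" "0 < x" "x \<le> 1"
  shows "\<bar>k x y * g s y\<bar> \<le> C * (y powr m * g s y)"
proof (cases "1 < y")
  case True
  then have "\<bar>k x y\<bar> \<le> C * y powr m" using assms by (simp add: tail_kernel_def)
  then have "\<bar>k x y\<bar> * g s y \<le> C * y powr m * g s y"
    using g_nonneg by (rule mult_right_mono)
  then show ?thesis using g_nonneg[of s y] by (simp add: abs_mult mult.assoc)
qed (simp add: g_supp)

lemma bdy_integrable:
  assumes "tail_kernel k C" "0 < x" "x \<le> 1" "0 \<le> s"
  shows "integrable lborel (\<lambda>y. k x y * g s y)"
proof (rule Bochner_Integration.integrable_bound)
  show "integrable lborel (\<lambda>y. C * (y powr m * g s y))"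
    using g_moment_int[OF assms(4)] by simp
  show "(\<lambda>y. k x y * g s y) \<in> borel_measurable lborel"
    using tail_kernel_section[OF assms(1)] g_meas[OF assms(4)] by simp
  show "AE y in lborel. norm (k x y * g s y) \<le> norm (C * (y powr m * g s y))"
    using order_trans[OF tail_kernel_le[OF assms(1-3)] abs_ge_self] by (intro AE_I2) simp
qed

lemma bdy_bound:
  assumes "tail_kernel k C" "0 < x" "x \<le> 1" "0 \<le> s"
  shows "\<bar>bdy k s x\<bar> \<le> C * M0"
proof -
  have "\<bar>bdy k s x\<bar> \<le> (LBINT y. \<bar>k x y * g s y\<bar>)"
    unfolding bdy_def by (rule integral_abs_bound)
  also have "\<dots> \<le> (LBINT y. C * (y powr m * g s y))"
    using bdy_integrable[OF assms] g_moment_int[OF assms(4)] tail_kernel_le[OF assms(1-3)]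
    by (intro integral_mono integrable_abs) auto
  also have "\<dots> \<le> C * M0"
    using g_moment[OF assms(4)] assms(1) by (simp add: tail_kernel_def mult_left_mono)
  finally show ?thesis .
qed

lemma bdy_measurable:
  assumes "tail_kernel k C" "0 \<le> s"
  shows "bdy k s \<in> borel_measurable borel"
proof -
  have [measurable]: "(\<lambda>z. k (fst z) (snd z)) \<in> borel_measurable (borel \<Otimes>\<^sub>M borel)"
    using assms(1) by (simp add: tail_kernel_def borel_prod)
  note [measurable] = g_meas[OF assms(2)]
  have "(\<lambda>z. k (fst z) (snd z) * g s (snd z)) \<in> borel_measurable (borel \<Otimes>\<^sub>M borel)"
    by measurable
  then have "case_prod (\<lambda>x y. k x y * g s y) \<in> borel_measurable (borel \<Otimes>\<^sub>M lborel)"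
    by (simp add: case_prod_beta' cong: measurable_cong_sets)
  then show ?thesis
    unfolding bdy_def[abs_def] by (rule lborel.borel_measurable_lebesgue_integral)
qed

lemma tail_kernel_truncate:
  assumes "tail_kernel k C"
  shows "tail_kernel (\<lambda>x y. indicator {..real n} y * k x y) C"
proof -
  have [measurable]: "(\<lambda>z. k (fst z) (snd z)) \<in> borel_measurable (borel \<Otimes>\<^sub>M borel)"
    using assms(1) by (simp add: tail_kernel_def borel_prod)
  have "(\<lambda>z. indicator {..real n} (snd z) * k (fst z) (snd z)) \<in> borel_measurable (borel \<Otimes>\<^sub>M borel)"
    by measurable
  then show ?thesis
    using assms by (auto simp: tail_kernel_def borel_prod indicator_def)
qed

lemma bdy_truncate_tendsto:
  assumes "tail_kernel k C" "0 < x" "x \<le> 1" "0 \<le> s"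
  shows "(\<lambda>n. bdy (\<lambda>x y. indicator {..real n} y * k x y) s x) \<longlonglongrightarrow> bdy k s x"
  unfolding bdy_def
proof (rule integral_dominated_convergence)
  show "(\<lambda>y. k x y * g s y) \<in> borel_measurable lborel"
    by (rule borel_measurable_integrable[OF bdy_integrable[OF assms]])
  show "(\<lambda>y. indicator {..real n} y * k x y * g s y) \<in> borel_measurable lborel" for n
    by (rule borel_measurable_integrable[OF bdy_integrable[OF tail_kernel_truncate[OF assms(1)] assms(2-)]])
  show "integrable lborel (\<lambda>y. C * (y powr m * g s y))"
    using g_moment_int[OF assms(4)] by simp
  show "AE y in lborel. norm (indicator {..real n} y * k x y * g s y) \<le> C * (y powr m * g s y)" for n
    using tail_kernel_le[OF tail_kernel_truncate[OF assms(1)] assms(2,3)] by (intro AE_I2) simp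
  show "AE y in lborel. (\<lambda>n. indicator {..real n} y * k x y * g s y) \<longlonglongrightarrow> k x y * g s y"
  proof (rule AE_I2, rule tendsto_eventually)
    fix y :: real
    obtain N where "y \<le> real N" using real_arch_simple by blast
    then show "\<forall>\<^sub>F n in sequentially. indicator {..real n} y * k x y * g s y = k x y * g s y"
      by (intro eventually_sequentiallyI[of N]) (auto simp: indicator_def intro: order_trans)
  qed
qed

text \<open>After truncation only 1 < y <= n contributes, and there the weight is at most C n^m. So
  plain L1 continuity of the datum is enough.\<close>

lemma bdy_truncate_lipschitz:
  fixes n :: nat
  assumes k: "tail_kernel k C" and x: "0 < x" "x \<le> 1" and st: "0 \<le> s" "0 \<le> t"
  defines "kn \<equiv> \<lambda>x y. indicator {..real n} y * k x y"
  shows "\<bar>bdy kn s x - bdy kn t x\<bar> \<le> C * real n powr m * (LBINT y. \<bar>g s y - g t y\<bar>)"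
proof -
  have kn: "tail_kernel kn C" unfolding kn_def by (rule tail_kernel_truncate[OF k])
  note int = bdy_integrable[OF kn x st(1)] bdy_integrable[OF kn x st(2)]
  have "\<bar>bdy kn s x - bdy kn t x\<bar> = \<bar>LBINT y. kn x y * g s y - kn x y * g t y\<bar>"
    unfolding bdy_def using int by simp
  also have "\<dots> \<le> (LBINT y. \<bar>kn x y * g s y - kn x y * g t y\<bar>)"
    by (rule integral_abs_bound)
  also have "\<dots> \<le> (LBINT y. C * real n powr m * \<bar>g s y - g t y\<bar>)"
  proof (rule integral_mono)
    fix y
    show "\<bar>kn x y * g s y - kn x y * g t y\<bar> \<le> C * real n powr m * \<bar>g s y - g t y\<bar>"
    proof (cases "1 < y \<and> y \<le> real n")
      case True
      then have "\<bar>kn x y\<bar> \<le> C * y powr m" using kn x by (simp add: tail_kernel_def)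
      also have "\<dots> \<le> C * real n powr m"
        using True k const_nonneg by (intro mult_left_mono powr_mono2) (auto simp: tail_kernel_def)
      finally have "\<bar>kn x y\<bar> * \<bar>g s y - g t y\<bar> \<le> C * real n powr m * \<bar>g s y - g t y\<bar>"
        by (rule mult_right_mono) simp
      then show ?thesis by (simp add: abs_mult flip: right_diff_distrib)
    next
      case False
      then have "kn x y * g s y - kn x y * g t y = 0"
        by (auto simp: kn_def g_supp)
      then show ?thesis using k unfolding tail_kernel_def by (simp only:) simp
    qed
  qed (use int g_int st in auto)
  also have "\<dots> = C * real n powr m * (LBINT y. \<bar>g s y - g t y\<bar>)" by simp
  finally show ?thesis .
qed

text \<open>The datum is only continuous into \<open>L\<^sup>1\<close>, so an unbounded weight gives a
  measurable rather than continuous function of time, as a limit of continuous truncations.\<close>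

lemma bdy_path_measurable:
  assumes \<mu>: "tv_path borel01 \<mu>" and k: "tail_kernel k C"
  shows "(\<lambda>s. LINT x|\<mu> s. bdy k s x) \<in> borel_measurable borel_time"
proof (rule borel_measurable_LIMSEQ_real)
  let ?k = "\<lambda>n x y. indicator {..real n} y * k x y"
  note kn = tail_kernel_truncate[OF k]
  have C: "0 \<le> C" using k by (simp add: tail_kernel_def)
  show "(\<lambda>n. LINT x|\<mu> s. bdy (?k n) s x) \<longlonglongrightarrow> (LINT x|\<mu> s. bdy k s x)" if "s \<in> space borel_time" for s
  proof -
    have s: "0 \<le> s" using that by simp
    note M = tv_pathD[OF \<mu> s]
    show ?thesis
      using finite_onD[OF M] finite_on_borel01_measurable[OF M bdy_measurable[OF kn s]]
        finite_on_borel01_measurable[OF M bdy_measurable[OF k s]] bdy_bound[OF kn _ _ s] bdy_truncate_tendsto[OF k _ _ s]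
      by (intro integral_tendsto_bounded[where c = "C * M0"]) auto
  qed
  show "(\<lambda>s. LINT x|\<mu> s. bdy (?k n) s x) \<in> borel_measurable borel_time" for n
  proof (rule borel_measurable_continuous_on_restrict, unfold continuous_on_def, intro ballI)
    fix t :: real assume "t \<in> {0..}"
    then have t: "0 \<le> t" by simp
    let ?Cn = "C * real n powr m"
    have Cn: "0 \<le> ?Cn" using C by simp
    show "((\<lambda>s. LINT x|\<mu> s. bdy (?k n) s x) \<longlongrightarrow> (LINT x|\<mu> t. bdy (?k n) t x)) (at t within {0..})"
    proof (rule tendsto_if_eventually_le_mult)
      fix e :: real assume e: "0 < e" "e < 1"
      have "\<forall>\<^sub>F s in at t within {0..}. tv_le borel01 (\<mu> s) (\<mu> t) e"
        using \<mu> t e by (simp add: tv_path_def)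
      moreover have "\<forall>\<^sub>F s in at t within {0..}. (LBINT y. \<bar>g s y - g t y\<bar>) < e"
        by (rule order_tendstoD(2)[OF g_cont[OF t] e(1)])
      moreover have "\<forall>\<^sub>F s in at t within {0..}. 0 \<le> s"
        by (auto simp: eventually_at_filter)
      ultimately show "\<forall>\<^sub>F s in at t within {0..}.
          \<bar>(LINT x|\<mu> s. bdy (?k n) s x) - (LINT x|\<mu> t. bdy (?k n) t x)\<bar> \<le> (?Cn * (mass (\<mu> t) + 1) + C * M0) * e"
      proof eventually_elim
        case (elim s)
        note M = tv_pathD[OF \<mu> elim(3)] and N = tv_pathD[OF \<mu> t]
        note ms = bdy_measurable[OF kn elim(3), of n] and mt = bdy_measurable[OF kn t, of n]
        have int: "integrable (\<mu> s) (bdy (?k n) s)" "integrable (\<mu> s) (bdy (?k n) t)"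
          using finite_onD[OF M] finite_on_borel01_measurable[OF M ms] finite_on_borel01_measurable[OF M mt]
            bdy_bound[OF kn _ _ elim(3), of _ n] bdy_bound[OF kn _ _ t, of _ n]
          by (auto intro!: integrable_bounded[where c = "C * M0"])
        \<comment> \<open>The time difference is split: here the datum changes while the measure
          stays at time s; afterwards the measure changes while the datum stays at time t.\<close>
        have "\<bar>LINT x|\<mu> s. bdy (?k n) s x - bdy (?k n) t x\<bar> \<le> ?Cn * e * mass (\<mu> s)"
        proof (rule integral_bounded)
          show "finite_measure (\<mu> s)" by (rule finite_onD(3)[OF M])
          show "(\<lambda>x. bdy (?k n) s x - bdy (?k n) t x) \<in> borel_measurable (\<mu> s)"
            by (intro finite_on_borel01_measurable[OF M] borel_measurable_diff ms mt)
          fix x assume "x \<in> space (\<mu> s)"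
          then have x: "0 < x" "x \<le> 1" using finite_onD(2)[OF M] by auto
          have "\<bar>bdy (?k n) s x - bdy (?k n) t x\<bar> \<le> ?Cn * (LBINT y. \<bar>g s y - g t y\<bar>)"
            by (rule bdy_truncate_lipschitz[OF k x elim(3) t])
          also have "\<dots> \<le> ?Cn * e" using elim(2) Cn by (intro mult_left_mono) auto
          finally show "\<bar>bdy (?k n) s x - bdy (?k n) t x\<bar> \<le> ?Cn * e" .
        qed
        also have "\<dots> \<le> ?Cn * e * (mass (\<mu> t) + 1)"
          using tv_le_mass[OF M N elim(1)] e Cn by (intro mult_left_mono) auto
        finally have 1: "\<bar>LINT x|\<mu> s. bdy (?k n) s x - bdy (?k n) t x\<bar> \<le> ?Cn * e * (mass (\<mu> t) + 1)" .
        have 2: "\<bar>(LINT x|\<mu> s. bdy (?k n) t x) - (LINT x|\<mu> t. bdy (?k n) t x)\<bar> \<le> (C * M0) * e"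
          using bdy_bound[OF kn _ _ t, of _ n] mt C const_nonneg
          by (intro tv_leD_scaled[OF elim(1)] measurable_restrict_space1) auto
        have "(LINT x|\<mu> s. bdy (?k n) s x) - (LINT x|\<mu> t. bdy (?k n) t x)
            = (LINT x|\<mu> s. bdy (?k n) s x - bdy (?k n) t x)
              + ((LINT x|\<mu> s. bdy (?k n) t x) - (LINT x|\<mu> t. bdy (?k n) t x))"
          using int by simp
        with 1 2 show ?case by (simp add: algebra_simps)
      qed
    qed
  qed
qed

lemma tail_kernel_K: "tail_kernel K K1"
  using K_meas K_nonneg K_tail const_nonneg by (simp add: tail_kernel_def)

lemma tail_kernel_F: "tail_kernel (\<lambda>x y. F (y - x) x) F1"
proof -
  have "(\<lambda>z. (snd z - fst z, fst z)) \<in> borel \<rightarrow>\<^sub>M (borel :: (real \<times> real) measure)"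
    unfolding borel_prod[symmetric] by measurable
  from measurable_compose[OF this F_meas] show ?thesis
    using F_nonneg F_tail const_nonneg by (simp add: tail_kernel_def)
qed

lemma tail_kernel_mult:
  assumes "tail_kernel k C" "\<psi> \<in> borel_measurable borel" "\<And>x. \<bar>\<psi> x\<bar> \<le> c"
  shows "tail_kernel (\<lambda>x y. k x y * \<psi> x) (C * c)"
proof -
  have c: "0 \<le> c" using assms(3)[of 0] by simp
  have [measurable]: "(\<lambda>z. k (fst z) (snd z)) \<in> borel_measurable (borel \<Otimes>\<^sub>M borel)" "\<psi> \<in> borel_measurable borel"
    using assms(1,2) by (auto simp: tail_kernel_def borel_prod)
  have "(\<lambda>z. k (fst z) (snd z) * \<psi> (fst z)) \<in> borel_measurable (borel \<Otimes>\<^sub>M borel)" by measurable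
  moreover have "\<bar>k x y * \<psi> x\<bar> \<le> C * c * y powr m" if "0 < x" "x \<le> 1" "1 < y" for x y
  proof -
    have "\<bar>k x y\<bar> * \<bar>\<psi> x\<bar> \<le> (C * y powr m) * c"
      using assms that c by (intro mult_mono) (auto simp: tail_kernel_def)
    then show ?thesis by (simp add: abs_mult mult_ac)
  qed
  ultimately show ?thesis
    using assms(1) c by (simp add: tail_kernel_def borel_prod)
qed

lemma bdy_mult: "bdy (\<lambda>x y. k x y * \<psi> x) s x = bdy k s x * \<psi> x"
proof -
  have "bdy (\<lambda>x y. k x y * \<psi> x) s x = (LBINT y. (k x y * g s y) * \<psi> x)"
    unfolding bdy_def by (simp only: mult_ac)
  then show ?thesis by (simp add: bdy_def)
qed

end

section \<open>Bounds and regularity of the generator\<close>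

lemma integral_pair_fst_snd:
  fixes \<psi> :: "real \<Rightarrow> real"
  assumes M: "M \<in> finite_on borel01" and \<psi>: "\<psi> \<in> borel_measurable borel" "\<And>x. \<bar>\<psi> x\<bar> \<le> c"
  shows "integrable (M \<Otimes>\<^sub>M M) (\<lambda>z. \<psi> (fst z) + \<psi> (snd z))"
    "(LINT z|(M \<Otimes>\<^sub>M M). \<psi> (fst z) + \<psi> (snd z)) = 2 * mass M * (LINT x|M. \<psi> x)"
proof -
  note [measurable] = \<psi>(1)
  have 1: "(\<lambda>z. \<psi> (fst z) + \<psi> (snd z)) \<in> borel_measurable (borel01 \<Otimes>\<^sub>M borel01)"
    by (rule pair_borel01_measurable) (unfold borel_prod[symmetric], measurable)
  have 2: "\<bar>\<psi> (fst z) + \<psi> (snd z)\<bar> \<le> 2 * c" for z :: "real \<times> real"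
    using \<psi>(2)[of "fst z"] \<psi>(2)[of "snd z"] by linarith
  note P = integral_pair_finite_on[OF M M 1 2]
  show "integrable (M \<Otimes>\<^sub>M M) (\<lambda>z. \<psi> (fst z) + \<psi> (snd z))" by (rule P(1))
  interpret M: finite_measure M by (rule finite_onD(3)[OF M])
  have int: "integrable M \<psi>"
    by (rule integrable_bounded[OF finite_onD(3)[OF M] finite_on_borel01_measurable[OF M \<psi>(1)] \<psi>(2)])
  show "(LINT z|(M \<Otimes>\<^sub>M M). \<psi> (fst z) + \<psi> (snd z)) = 2 * mass M * (LINT x|M. \<psi> x)"
    unfolding P(2) using int by (simp add: algebra_simps)
qed

abbreviation frag_range :: "real \<Rightarrow> real measure" where
  "frag_range x \<equiv> restrict_space lborel {0<..<x}"

lemma frag_range_finite: "finite_measure (frag_range x)"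
  by (cases "0 \<le> x") (auto intro!: finite_measureI simp: emeasure_restrict_space)

lemma mass_frag_range: "0 \<le> x \<Longrightarrow> mass (frag_range x) = x"
  by (simp add: measure_restrict_space)

lemma frag_B_eq:
  "frag_B F \<psi> x = 1/2 * (LINT y|frag_range x. F (x - y) y * (\<psi> x - \<psi> (x - y) - \<psi> y))"
  by (simp add: frag_B_def set_lebesgue_integral_def integral_restrict_space)

lemma integral_null_measure_eq_0: "(LINT x|null_measure S. f x) = 0" for f :: "'a \<Rightarrow> real"
  by (rule integral_eq_zero_AE, rule AE_I'[of "space S"]) (auto simp: null_sets_def)

context coagulation_fragmentation begin

abbreviation Fk :: "real \<Rightarrow> real \<Rightarrow> real" where
  "Fk \<equiv> \<lambda>x y. F (y - x) x"

definition coag :: "(real \<Rightarrow> real) \<Rightarrow> real \<times> real \<Rightarrow> real" where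
  "coag \<psi> z = K (fst z) (snd z) * coag_A \<psi> (fst z) (snd z)"

definition loss :: "real \<Rightarrow> (real \<Rightarrow> real) \<Rightarrow> real \<Rightarrow> real" where
  "loss s \<psi> x = bdy K s x * \<psi> x + frag_B F \<psi> x"

definition generator :: "real \<Rightarrow> real measure \<Rightarrow> (real \<Rightarrow> real) \<Rightarrow> real" where
  "generator s M \<psi> = 1/2 * integral\<^sup>L (M \<Otimes>\<^sub>M M) (coag \<psi>) - (LINT x|M. loss s \<psi> x)
     + (LINT x|leb01. bdy Fk s x * \<psi> x)"

definition bounded_test :: "(real \<Rightarrow> real) \<Rightarrow> real \<Rightarrow> bool" where
  "bounded_test \<psi> c \<longleftrightarrow> \<psi> \<in> borel_measurable borel \<and> (\<forall>x. \<bar>\<psi> x\<bar> \<le> c)"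

lemma bounded_testD:
  assumes "bounded_test \<psi> c"
  shows "\<psi> \<in> borel_measurable borel" "\<bar>\<psi> x\<bar> \<le> c" "0 \<le> c"
proof -
  show "\<psi> \<in> borel_measurable borel" and *: "\<bar>\<psi> x\<bar> \<le> c" for x
    using assms by (auto simp: bounded_test_def)
  show "0 \<le> c" using order_trans[OF abs_ge_zero *] .
qed

lemma coag_measurable:
  assumes "bounded_test \<psi> c"
  shows "coag \<psi> \<in> borel_measurable (borel01 \<Otimes>\<^sub>M borel01)"
  unfolding coag_def[abs_def]
  by (intro pair_borel01_measurable borel_measurable_times K_meas coag_A_measurable bounded_testD(1)[OF assms])

lemma coag_bound:
  assumes "bounded_test \<psi> c" "z \<in> space (borel01 \<Otimes>\<^sub>M borel01)"
  shows "\<bar>coag \<psi> z\<bar> \<le> K0 * (3 * c)"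
proof -
  have "\<bar>K (fst z) (snd z)\<bar> \<le> K0"
    using assms(2) K_le[of "fst z" "snd z"] K_nonneg by (auto simp: space_pair_measure)
  then show ?thesis
    unfolding coag_def abs_mult using coag_A_bound[OF bounded_testD(2)[OF assms(1)]] const_nonneg
    by (intro mult_mono) auto
qed

lemma frag_integrand:
  assumes \<psi>: "bounded_test \<psi> c" and x: "0 < x" "x \<le> 1"
  shows "(\<lambda>y. F (x - y) y * (\<psi> x - \<psi> (x - y) - \<psi> y)) \<in> borel_measurable (frag_range x)"
    "y \<in> space (frag_range x) \<Longrightarrow> \<bar>F (x - y) y * (\<psi> x - \<psi> (x - y) - \<psi> y)\<bar> \<le> F1 * (3 * c)"
proof -
  note [measurable] = bounded_testD(1)[OF \<psi>]
  have "(\<lambda>y. (x - y, y)) \<in> borel \<rightarrow>\<^sub>M (borel :: (real \<times> real) measure)"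
    unfolding borel_prod[symmetric] by measurable
  from measurable_compose[OF this F_meas]
  have [measurable]: "(\<lambda>y. F (x - y) y) \<in> borel_measurable borel" by simp
  show "(\<lambda>y. F (x - y) y * (\<psi> x - \<psi> (x - y) - \<psi> y)) \<in> borel_measurable (frag_range x)"
    by (intro measurable_restrict_space1) measurable
  assume "y \<in> space (frag_range x)"
  then have y: "0 < y" "y < x" by auto
  have "\<bar>\<psi> x - \<psi> (x - y) - \<psi> y\<bar> \<le> 3 * c"
    using bounded_testD(2)[OF \<psi>, of x] bounded_testD(2)[OF \<psi>, of "x - y"] bounded_testD(2)[OF \<psi>, of y] by linarith
  then show "\<bar>F (x - y) y * (\<psi> x - \<psi> (x - y) - \<psi> y)\<bar> \<le> F1 * (3 * c)"
    unfolding abs_mult using F_le[OF y x(2)] F_nonneg const_nonneg by (intro mult_mono) auto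
qed

lemma frag_integrable:
  assumes "bounded_test \<psi> c" "0 < x" "x \<le> 1"
  shows "integrable (frag_range x) (\<lambda>y. F (x - y) y * (\<psi> x - \<psi> (x - y) - \<psi> y))"
  by (rule integrable_bounded[OF frag_range_finite frag_integrand[OF assms]])

lemma frag_bound:
  assumes "bounded_test \<psi> c" "0 < x" "x \<le> 1"
  shows "\<bar>frag_B F \<psi> x\<bar> \<le> 2 * F1 * c"
proof -
  have "\<bar>LINT y|frag_range x. F (x - y) y * (\<psi> x - \<psi> (x - y) - \<psi> y)\<bar> \<le> F1 * (3 * c) * mass (frag_range x)"
    by (rule integral_bounded[OF frag_range_finite frag_integrand[OF assms]])
  also have "\<dots> \<le> F1 * (3 * c) * 1"
    using assms mass_frag_range[of x] const_nonneg bounded_testD(3)[OF assms(1)] by (intro mult_left_mono) auto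
  finally have "\<bar>frag_B F \<psi> x\<bar> \<le> 1/2 * (F1 * (3 * c))" by (simp add: frag_B_eq)
  \<comment> \<open>Three values of the test function and the factor 1/2 give the constant 3/2,
    rounded up to 2.\<close>
  also have "\<dots> \<le> 2 * F1 * c" using const_nonneg bounded_testD(3)[OF assms(1)] by simp
  finally show ?thesis .
qed

lemma frag_measurable:
  assumes "bounded_test \<psi> c"
  shows "frag_B F \<psi> \<in> borel_measurable borel"
proof -
  note [measurable] = bounded_testD(1)[OF assms]
  have "(\<lambda>z. (fst z - snd z, snd z)) \<in> (borel \<Otimes>\<^sub>M borel) \<rightarrow>\<^sub>M (borel :: (real \<times> real) measure)"
    unfolding borel_prod[symmetric] by measurable
  from measurable_compose[OF this F_meas]
  have [measurable]: "(\<lambda>z. F (fst z - snd z) (snd z)) \<in> borel_measurable (borel \<Otimes>\<^sub>M borel)" by simp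
  \<comment> \<open>The integration range depends on x. Moving it into the integrand yields a
    jointly measurable function on the plane, so that measurability of parameter integrals
    applies.\<close>
  have "(\<lambda>z. if 0 < snd z \<and> snd z < fst z then F (fst z - snd z) (snd z) *
      (\<psi> (fst z) - \<psi> (fst z - snd z) - \<psi> (snd z)) else 0) \<in> borel_measurable (borel \<Otimes>\<^sub>M borel)"
    by measurable
  also have "(\<lambda>z. if 0 < snd z \<and> snd z < fst z then F (fst z - snd z) (snd z) *
      (\<psi> (fst z) - \<psi> (fst z - snd z) - \<psi> (snd z)) else 0)
      = case_prod (\<lambda>x y. indicator {0<..<x} y *\<^sub>R (F (x - y) y * (\<psi> x - \<psi> (x - y) - \<psi> y)))"
    by (auto simp: fun_eq_iff)
  finally have "(\<lambda>x. LBINT y. indicator {0<..<x} y *\<^sub>R (F (x - y) y * (\<psi> x - \<psi> (x - y) - \<psi> y))) \<in> borel_measurable borel"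
    by (intro lborel.borel_measurable_lebesgue_integral) (simp cong: measurable_cong_sets)
  then show ?thesis
    unfolding frag_B_def[abs_def] set_lebesgue_integral_def by measurable
qed

lemma bdy_K_bound: "0 < x \<Longrightarrow> x \<le> 1 \<Longrightarrow> 0 \<le> s \<Longrightarrow> \<bar>bdy K s x\<bar> \<le> K1 * M0"
  by (rule bdy_bound[OF tail_kernel_K])

lemma bdy_F_bound: "0 < x \<Longrightarrow> x \<le> 1 \<Longrightarrow> 0 \<le> s \<Longrightarrow> \<bar>bdy Fk s x\<bar> \<le> F1 * M0"
  by (rule bdy_bound[OF tail_kernel_F])

lemma bdy_nonneg: "(\<And>x y. 0 \<le> k x y) \<Longrightarrow> 0 \<le> bdy k s x"
  unfolding bdy_def by (intro Bochner_Integration.integral_nonneg mult_nonneg_nonneg g_nonneg)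

lemma loss_measurable:
  assumes "bounded_test \<psi> c" "0 \<le> s"
  shows "loss s \<psi> \<in> borel_measurable borel"
  unfolding loss_def[abs_def]
  by (intro borel_measurable_add borel_measurable_times bdy_measurable[OF tail_kernel_K assms(2)]
      bounded_testD(1)[OF assms(1)] frag_measurable[OF assms(1)])

lemma loss_bound:
  assumes "bounded_test \<psi> c" "0 \<le> s" "0 < x" "x \<le> 1"
  shows "\<bar>loss s \<psi> x\<bar> \<le> (K1 * M0 + 2 * F1) * c"
proof -
  have "\<bar>bdy K s x * \<psi> x\<bar> \<le> (K1 * M0) * c"
    unfolding abs_mult using bdy_K_bound[OF assms(3,4,2)] bounded_testD[OF assms(1)] const_nonneg
    by (intro mult_mono) auto
  then show ?thesis
    unfolding loss_def using frag_bound[OF assms(1,3,4)] by (simp add: algebra_simps)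
qed

lemma loss_integrable:
  assumes "bounded_test \<psi> c" "0 \<le> s" "M \<in> finite_on borel01"
  shows "integrable M (loss s \<psi>)"
  using loss_bound[OF assms(1,2)] finite_onD(2,3)[OF assms(3)]
  by (intro integrable_bounded[where c = "(K1 * M0 + 2 * F1) * c"]
      finite_on_borel01_measurable[OF assms(3)] loss_measurable[OF assms(1,2)]) auto

lemma source_measurable:
  assumes "bounded_test \<psi> c" "0 \<le> s"
  shows "(\<lambda>x. bdy Fk s x * \<psi> x) \<in> borel_measurable leb01"
  by (intro finite_on_borel01_measurable[OF leb01(1)] borel_measurable_times
      bdy_measurable[OF tail_kernel_F assms(2)] bounded_testD(1)[OF assms(1)])

lemma source_bound:
  assumes "bounded_test \<psi> c" "0 \<le> s" "x \<in> space leb01"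
  shows "\<bar>bdy Fk s x * \<psi> x\<bar> \<le> F1 * M0 * c"
  unfolding abs_mult using bdy_F_bound[of x s] bounded_testD[OF assms(1)] const_nonneg assms(2,3)
  by (intro mult_mono) auto

lemma source_integrable:
  assumes "bounded_test \<psi> c" "0 \<le> s"
  shows "integrable leb01 (\<lambda>x. bdy Fk s x * \<psi> x)"
  by (rule integrable_bounded[OF finite_onD(3)[OF leb01(1)] source_measurable[OF assms] source_bound[OF assms]])

lemma generator_add:
  assumes s: "0 \<le> s" and M: "M \<in> finite_on borel01" and \<psi>: "bounded_test \<psi> c" "bounded_test \<eta> d"
  shows "generator s M (\<lambda>x. \<psi> x + \<eta> x) = generator s M \<psi> + generator s M \<eta>"
proof -
  have "integral\<^sup>L (M \<Otimes>\<^sub>M M) (coag (\<lambda>x. \<psi> x + \<eta> x)) = (LINT z|(M \<Otimes>\<^sub>M M). coag \<psi> z + coag \<eta> z)"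
    by (intro Bochner_Integration.integral_cong) (auto simp: coag_def coag_A_def const_ext_def algebra_simps)
  also have "\<dots> = integral\<^sup>L (M \<Otimes>\<^sub>M M) (coag \<psi>) + integral\<^sup>L (M \<Otimes>\<^sub>M M) (coag \<eta>)"
    by (intro Bochner_Integration.integral_add
        integral_pair_finite_on(1)[OF M M coag_measurable[OF \<psi>(1)] coag_bound[OF \<psi>(1)]]
        integral_pair_finite_on(1)[OF M M coag_measurable[OF \<psi>(2)] coag_bound[OF \<psi>(2)]])
  finally have 1: "integral\<^sup>L (M \<Otimes>\<^sub>M M) (coag (\<lambda>x. \<psi> x + \<eta> x)) =
      integral\<^sup>L (M \<Otimes>\<^sub>M M) (coag \<psi>) + integral\<^sup>L (M \<Otimes>\<^sub>M M) (coag \<eta>)" .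
  have frag: "frag_B F (\<lambda>x. \<psi> x + \<eta> x) x = frag_B F \<psi> x + frag_B F \<eta> x" if x: "0 < x" "x \<le> 1" for x
  proof -
    have "(LINT y|frag_range x. F (x - y) y * ((\<psi> x + \<eta> x) - (\<psi> (x - y) + \<eta> (x - y)) - (\<psi> y + \<eta> y)))
        = (LINT y|frag_range x. F (x - y) y * (\<psi> x - \<psi> (x - y) - \<psi> y) + F (x - y) y * (\<eta> x - \<eta> (x - y) - \<eta> y))"
      by (intro Bochner_Integration.integral_cong) (auto simp: algebra_simps)
    also have "\<dots> = (LINT y|frag_range x. F (x - y) y * (\<psi> x - \<psi> (x - y) - \<psi> y))
        + (LINT y|frag_range x. F (x - y) y * (\<eta> x - \<eta> (x - y) - \<eta> y))"
      by (intro Bochner_Integration.integral_add frag_integrable[OF \<psi>(1) x] frag_integrable[OF \<psi>(2) x])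
    finally show ?thesis by (simp add: frag_B_eq)
  qed
  have "(LINT x|M. loss s (\<lambda>x. \<psi> x + \<eta> x) x) = (LINT x|M. loss s \<psi> x + loss s \<eta> x)"
    using finite_onD(2)[OF M]
    by (intro Bochner_Integration.integral_cong) (auto simp: loss_def frag distrib_left)
  also have "\<dots> = (LINT x|M. loss s \<psi> x) + (LINT x|M. loss s \<eta> x)"
    by (intro Bochner_Integration.integral_add loss_integrable[OF \<psi>(1) s M] loss_integrable[OF \<psi>(2) s M])
  finally have 2: "(LINT x|M. loss s (\<lambda>x. \<psi> x + \<eta> x) x) = (LINT x|M. loss s \<psi> x) + (LINT x|M. loss s \<eta> x)" .
  have 3: "(LINT x|leb01. bdy Fk s x * (\<psi> x + \<eta> x)) = (LINT x|leb01. bdy Fk s x * \<psi> x) + (LINT x|leb01. bdy Fk s x * \<eta> x)"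
    unfolding distrib_left
    by (intro Bochner_Integration.integral_add source_integrable[OF \<psi>(1) s] source_integrable[OF \<psi>(2) s])
  show ?thesis unfolding generator_def 1 2 3 by (simp add: algebra_simps)
qed

lemma generator_scale: "generator s M (\<lambda>x. c * \<psi> x) = c * generator s M \<psi>"
proof -
  have 1: "coag (\<lambda>x. c * \<psi> x) z = c * coag \<psi> z" for z
    by (simp add: coag_def coag_A_def const_ext_def algebra_simps)
  have frag: "frag_B F (\<lambda>x. c * \<psi> x) x = c * frag_B F \<psi> x" for x
  proof -
    have eq: "F (x - y) y * (c * \<psi> x - c * \<psi> (x - y) - c * \<psi> y) = c * (F (x - y) y * (\<psi> x - \<psi> (x - y) - \<psi> y))" for y
      by (simp add: algebra_simps)
    show ?thesis unfolding frag_B_eq eq integral_mult_right_zero by simp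
  qed
  have 2: "loss s (\<lambda>x. c * \<psi> x) x = c * loss s \<psi> x" for x
    by (simp add: loss_def frag algebra_simps)
  have 3: "bdy Fk s x * (c * \<psi> x) = c * (bdy Fk s x * \<psi> x)" for x
    by (simp add: algebra_simps)
  show ?thesis
    unfolding generator_def 1[abs_def] 2 3 integral_mult_right_zero by (simp add: algebra_simps)
qed

lemma generator_lim:
  assumes s: "0 \<le> s" and M: "M \<in> finite_on borel01" and \<psi>: "\<And>n. bounded_test (\<psi> n) c" "bounded_test \<eta> c"
    and lim: "\<And>x. (\<lambda>n. \<psi> n x) \<longlonglongrightarrow> \<eta> x"
  shows "(\<lambda>n. generator s M (\<psi> n)) \<longlonglongrightarrow> generator s M \<eta>"
  unfolding generator_def
proof (intro tendsto_add tendsto_diff tendsto_mult tendsto_const)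
  note sp = finite_onD(2)[OF M]
  show "(\<lambda>n. integral\<^sup>L (M \<Otimes>\<^sub>M M) (coag (\<psi> n))) \<longlonglongrightarrow> integral\<^sup>L (M \<Otimes>\<^sub>M M) (coag \<eta>)"
  proof (rule integral_tendsto_bounded[where c = "K0 * (3 * c)"])
    show "finite_measure (M \<Otimes>\<^sub>M M)" by (intro finite_measure_pair_measure finite_onD(3)[OF M])
    show "coag (\<psi> n) \<in> borel_measurable (M \<Otimes>\<^sub>M M)" "coag \<eta> \<in> borel_measurable (M \<Otimes>\<^sub>M M)" for n
      unfolding borel_measurable_pair_finite_on[OF M M] by (rule coag_measurable[OF \<psi>(1)] coag_measurable[OF \<psi>(2)])+
    show "\<bar>coag (\<psi> n) z\<bar> \<le> K0 * (3 * c)" if "z \<in> space (M \<Otimes>\<^sub>M M)" for n z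
      by (rule coag_bound[OF \<psi>(1)]) (use that sp in \<open>simp add: space_pair_measure\<close>)
    show "(\<lambda>n. coag (\<psi> n) z) \<longlonglongrightarrow> coag \<eta> z" for z
      unfolding coag_def coag_A_def const_ext_def using lim by (auto intro!: tendsto_intros)
  qed
  have frag: "(\<lambda>n. frag_B F (\<psi> n) x) \<longlonglongrightarrow> frag_B F \<eta> x" if x: "0 < x" "x \<le> 1" for x
    unfolding frag_B_eq
  proof (rule tendsto_mult[OF tendsto_const],
      rule integral_tendsto_bounded[OF frag_range_finite frag_integrand(1)[OF \<psi>(1) x] frag_integrand(1)[OF \<psi>(2) x] frag_integrand(2)[OF \<psi>(1) x]])
    show "(\<lambda>n. F (x - y) y * (\<psi> n x - \<psi> n (x - y) - \<psi> n y)) \<longlonglongrightarrow> F (x - y) y * (\<eta> x - \<eta> (x - y) - \<eta> y)" for y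
      by (intro tendsto_intros lim)
  qed
  show "(\<lambda>n. LINT x|M. loss s (\<psi> n) x) \<longlonglongrightarrow> (LINT x|M. loss s \<eta> x)"
  proof (rule integral_tendsto_bounded[where c = "(K1 * M0 + 2 * F1) * c"])
    show "finite_measure M" by (rule finite_onD(3)[OF M])
    show "loss s (\<psi> n) \<in> borel_measurable M" "loss s \<eta> \<in> borel_measurable M" for n
      by (intro finite_on_borel01_measurable[OF M] loss_measurable[OF \<psi>(1) s] loss_measurable[OF \<psi>(2) s])+
    show "\<bar>loss s (\<psi> n) x\<bar> \<le> (K1 * M0 + 2 * F1) * c" if "x \<in> space M" for n x
      by (rule loss_bound[OF \<psi>(1) s]) (use that sp in auto)
    show "(\<lambda>n. loss s (\<psi> n) x) \<longlonglongrightarrow> loss s \<eta> x" if "x \<in> space M" for x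
      unfolding loss_def by (intro tendsto_intros lim frag) (use that sp in auto)
  qed
  show "(\<lambda>n. LINT x|leb01. bdy Fk s x * \<psi> n x) \<longlonglongrightarrow> (LINT x|leb01. bdy Fk s x * \<eta> x)"
    by (rule integral_tendsto_bounded[OF finite_onD(3)[OF leb01(1)] source_measurable[OF \<psi>(1) s]
        source_measurable[OF \<psi>(2) s] source_bound[OF \<psi>(1) s]]; (intro tendsto_intros lim)?)
qed

text \<open>K1 M0 bounds G, 2 F1 bounds the fragmentation operator on unit functions, and F1 M0
  bounds C, hence the total source. The summand 1 makes p positive, since the abstract growth
  function divides by it.\<close>

definition p :: real where "p = 1 + K1 * M0 + 2 * F1 + F1 * M0"

text \<open>A[\<phi>] is at most 3 for a unit function. In the Lipschitz estimate the factor 1/2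
  cancels against the sum of two masses up to R, which leaves 3 K0 R.\<close>

definition q :: real where "q = 3 * K0"

lemma p_ge: "1 \<le> p" "K1 * M0 + 2 * F1 \<le> p" "F1 * M0 \<le> p"
  using const_nonneg by (auto simp: p_def)

text \<open>The source is independent of the measure and cancels. The loss is linear and contributes
  p; the product term contributes q R by the tensor splitting.\<close>

lemma generator_lip:
  assumes s: "0 \<le> s" and M: "M \<in> finite_on borel01" and N: "N \<in> finite_on borel01"
    and R: "mass M \<le> R" "mass N \<le> R" and e: "tv_le borel01 M N e" and \<psi>: "bounded_test \<psi> 1"
  shows "\<bar>generator s M \<psi> - generator s N \<psi>\<bar> \<le> (p + q * R) * e"
proof -
  have e0: "0 \<le> e" using tv_leD[OF e const_unit[of 1]] by simp
  have "\<bar>integral\<^sup>L (M \<Otimes>\<^sub>M M) (coag \<psi>) - integral\<^sup>L (N \<Otimes>\<^sub>M N) (coag \<psi>)\<bar> \<le> K0 * (3 * 1) * (mass M + mass N) * e"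
    using const_nonneg by (intro tv_le_pair[OF M N e coag_measurable[OF \<psi>] coag_bound[OF \<psi>]]) auto
  also have "\<dots> \<le> K0 * (3 * 1) * (2 * R) * e"
    using R const_nonneg e0 by (intro mult_right_mono mult_left_mono) auto
  finally have 1: "\<bar>integral\<^sup>L (M \<Otimes>\<^sub>M M) (coag \<psi>) - integral\<^sup>L (N \<Otimes>\<^sub>M N) (coag \<psi>)\<bar> \<le> 2 * (q * R * e)"
    by (simp add: q_def)
  have "\<bar>(LINT x|M. loss s \<psi> x) - (LINT x|N. loss s \<psi> x)\<bar> \<le> (K1 * M0 + 2 * F1) * 1 * e"
    using loss_bound[OF \<psi> s] const_nonneg
    by (intro tv_leD_scaled[OF e] measurable_restrict_space1 loss_measurable[OF \<psi> s]) auto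
  also have "\<dots> \<le> p * e" using p_ge(2) e0 by (simp add: mult_right_mono)
  finally show ?thesis using 1 unfolding generator_def by (simp add: algebra_simps abs_le_iff)
qed

text \<open>Lipschitz estimate against the null measure, at which only the source is left of the
  generator. Any measure of mass at most R is within R of the null measure.\<close>

lemma generator_bound:
  assumes s: "0 \<le> s" and M: "M \<in> finite_on borel01" and R: "mass M \<le> R" and \<psi>: "bounded_test \<psi> 1"
  shows "\<bar>generator s M \<psi>\<bar> \<le> p + (p + q * R) * R"
proof -
  have R0: "0 \<le> R" using order_trans[OF measure_nonneg R] .
  have null: "null_measure borel01 \<in> finite_on borel01"
    by (auto simp: finite_on_def intro!: finite_measureI)
  have "tv_le borel01 M (null_measure borel01) R"
    unfolding tv_le_def
  proof
    fix \<phi> assume \<phi>: "\<phi> \<in> unit_fun borel01"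
    show "\<bar>(LINT x|M. \<phi> x) - (LINT x|null_measure borel01. \<phi> x)\<bar> \<le> R"
      using finite_on_integral_le[OF M \<phi>] finite_on_integral_le[OF null \<phi>] R by simp
  qed
  then have 1: "\<bar>generator s M \<psi> - generator s (null_measure borel01) \<psi>\<bar> \<le> (p + q * R) * R"
    by (intro generator_lip[OF s M null R _ _ \<psi>]) (use R0 in auto)
  have "\<bar>LINT x|leb01. bdy Fk s x * \<psi> x\<bar> \<le> F1 * M0 * 1 * mass leb01"
    by (rule integral_bounded[OF finite_onD(3)[OF leb01(1)] source_measurable[OF \<psi> s] source_bound[OF \<psi> s]])
  moreover have "integral\<^sup>L (null_measure borel01 \<Otimes>\<^sub>M null_measure borel01) (coag \<psi>) = 0"
    using integral_pair_finite_on(2)[OF null null coag_measurable[OF \<psi>] coag_bound[OF \<psi>]]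
    by (simp add: integral_null_measure_eq_0)
  moreover have "(LINT x|null_measure borel01. loss s \<psi> x) = 0"
    by (rule integral_null_measure_eq_0)
  ultimately have "\<bar>generator s (null_measure borel01) \<psi>\<bar> \<le> p"
    using p_ge(3) leb01(2) by (simp add: generator_def)
  with 1 show ?thesis by linarith
qed

end

lemma ext_bdd:
  assumes "\<phi> \<in> bdd_fun borel01"
  shows "\<exists>c\<ge>0. \<forall>x. \<bar>ext \<phi> x\<bar> \<le> c"
proof -
  obtain c where "c > 0" "\<And>x. x \<in> space borel01 \<Longrightarrow> \<bar>\<phi> x\<bar> \<le> c"
    using assms by (rule bdd_funE) blast
  then show ?thesis by (intro exI[of _ c]) (auto simp: ext_def indicator_def)
qed

context coagulation_fragmentation begin

lemma bounded_test_ext_bdd: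
  assumes "\<phi> \<in> bdd_fun borel01"
  obtains c where "bounded_test (ext \<phi>) c"
  using ext_bdd[OF assms] assms that by (auto simp: bounded_test_def bdd_fun_def ext_measurable)

lemma bounded_test_ext_unit: "\<phi> \<in> unit_fun borel01 \<Longrightarrow> bounded_test (ext \<phi>) 1"
  using unit_funD[of \<phi> borel01] by (auto simp: bounded_test_def ext_measurable ext_def indicator_def)

text \<open>For a nonnegative test function the newly formed cluster in A and the two fragments in B
  contribute with the good sign and are dropped. The remaining coagulation term is -K (\<psi>(x) +
  \<psi>(y)); its two halves are equal by symmetry of the product measure, so that with the factor
  1/2 it costs at most K0 R times the integral of \<psi>. The other losses cost at most K1 M0 + F1
  times that integral, and the source is nonnegative.\<close>

lemma generator_pos:
  assumes s: "0 \<le> s" and M: "M \<in> finite_on borel01" and R: "mass M \<le> R" and \<psi>: "bounded_test \<psi> 1"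
    and nonneg: "\<And>x. 0 \<le> \<psi> x"
  shows "0 \<le> (p + q * R) * (LINT x|M. \<psi> x) + generator s M \<psi>"
proof -
  note sp = finite_onD(2)[OF M] and \<psi>D = bounded_testD[OF \<psi>]
  define I where "I = (LINT x|M. \<psi> x)"
  have I: "0 \<le> I" unfolding I_def by (intro Bochner_Integration.integral_nonneg nonneg)
  have int_\<psi>: "integrable M \<psi>"
    by (rule integrable_bounded[OF finite_onD(3)[OF M] finite_on_borel01_measurable[OF M \<psi>D(1)] \<psi>D(2)])
  note pair = integral_pair_fst_snd[OF M \<psi>D(1,2)]
  have "(LINT z|(M \<Otimes>\<^sub>M M). - K0 * (\<psi> (fst z) + \<psi> (snd z))) \<le> integral\<^sup>L (M \<Otimes>\<^sub>M M) (coag \<psi>)"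
  proof (rule integral_mono)
    show "integrable (M \<Otimes>\<^sub>M M) (\<lambda>z. - K0 * (\<psi> (fst z) + \<psi> (snd z)))"
      using pair(1) by (rule integrable_mult_right)
    show "integrable (M \<Otimes>\<^sub>M M) (coag \<psi>)"
      by (rule integral_pair_finite_on(1)[OF M M coag_measurable[OF \<psi>] coag_bound[OF \<psi>]])
    fix z assume "z \<in> space (M \<Otimes>\<^sub>M M)"
    then have z: "K (fst z) (snd z) \<le> K0" using sp K_le by (auto simp: space_pair_measure)
    have "- coag_A \<psi> (fst z) (snd z) \<le> \<psi> (fst z) + \<psi> (snd z)"
      using nonneg by (simp add: coag_A_def const_ext_def)
    then have "K (fst z) (snd z) * (- coag_A \<psi> (fst z) (snd z)) \<le> K (fst z) (snd z) * (\<psi> (fst z) + \<psi> (snd z))"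
      using K_nonneg by (rule mult_left_mono)
    also have "\<dots> \<le> K0 * (\<psi> (fst z) + \<psi> (snd z))"
      using z nonneg by (intro mult_right_mono) auto
    finally show "- K0 * (\<psi> (fst z) + \<psi> (snd z)) \<le> coag \<psi> z" by (simp add: coag_def)
  qed
  then have 1: "- (2 * (K0 * mass M * I)) \<le> integral\<^sup>L (M \<Otimes>\<^sub>M M) (coag \<psi>)"
    using pair by (simp add: I_def)
  have frag: "frag_B F \<psi> x \<le> F1 * \<psi> x" if x: "0 < x" "x \<le> 1" for x
  proof -
    have "(LINT y|frag_range x. F (x - y) y * (\<psi> x - \<psi> (x - y) - \<psi> y)) \<le> (LINT y|frag_range x. F1 * \<psi> x)"
    proof (rule integral_mono)
      fix y assume "y \<in> space (frag_range x)"
      then have y: "0 < y" "y < x" by auto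
      have "F (x - y) y * (\<psi> x - \<psi> (x - y) - \<psi> y) \<le> F (x - y) y * \<psi> x"
        using F_nonneg nonneg[of "x - y"] nonneg[of y] by (intro mult_left_mono) auto
      also have "\<dots> \<le> F1 * \<psi> x" using F_le[OF y x(2)] nonneg by (intro mult_right_mono)
      finally show "F (x - y) y * (\<psi> x - \<psi> (x - y) - \<psi> y) \<le> F1 * \<psi> x" .
    qed (rule frag_integrable[OF \<psi> x], rule finite_measure.integrable_const[OF frag_range_finite])
    also have "\<dots> = mass (frag_range x) * (F1 * \<psi> x)" by simp
    also have "\<dots> \<le> 1 * (F1 * \<psi> x)"
      unfolding mass_frag_range[OF less_imp_le[OF x(1)]]
      using x const_nonneg nonneg by (intro mult_right_mono) auto
    also have "\<dots> \<le> 2 * (F1 * \<psi> x)" using const_nonneg nonneg[of x] by simp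
    finally show ?thesis by (simp add: frag_B_eq)
  qed
  have "(LINT x|M. loss s \<psi> x) \<le> (LINT x|M. (K1 * M0 + F1) * \<psi> x)"
  proof (rule integral_mono[OF loss_integrable[OF \<psi> s M]])
    fix x assume "x \<in> space M"
    then have x: "0 < x" "x \<le> 1" using sp by auto
    have "bdy K s x * \<psi> x \<le> K1 * M0 * \<psi> x"
      using bdy_K_bound[OF x s] nonneg by (intro mult_right_mono) auto
    then show "loss s \<psi> x \<le> (K1 * M0 + F1) * \<psi> x"
      using frag[OF x] by (simp add: loss_def algebra_simps)
  qed (use int_\<psi> in simp)
  also have "\<dots> = (K1 * M0 + F1) * I" by (simp add: I_def)
  also have "\<dots> \<le> p * I" using I p_ge(2) const_nonneg by (intro mult_right_mono) auto
  finally have 2: "(LINT x|M. loss s \<psi> x) \<le> p * I" .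
  have 3: "0 \<le> (LINT x|leb01. bdy Fk s x * \<psi> x)"
    by (intro Bochner_Integration.integral_nonneg mult_nonneg_nonneg bdy_nonneg F_nonneg nonneg)
  have "K0 * mass M * I \<le> K0 * R * I"
    using R I const_nonneg by (intro mult_right_mono mult_left_mono)
  also have "\<dots> \<le> q * R * I"
    unfolding q_def using I const_nonneg order_trans[OF measure_nonneg R] by (intro mult_right_mono) auto
  finally show ?thesis
    using 1 2 3 unfolding generator_def I_def[symmetric] distrib_right by linarith
qed

text \<open>Each coagulation event lowers the number of clusters by one, also when x + y > 1,
  because the constant extension counts the merged cluster at 1. So the quadratic term is
  nonpositive, and what remains is linear fragmentation plus the source.\<close>

lemma generator_mass:
  assumes s: "0 \<le> s" and M: "M \<in> finite_on borel01"
  shows "generator s M (ext (\<lambda>_. 1)) \<le> p * mass M + p"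
proof -
  let ?\<psi> = "ext (\<lambda>_. 1)"
  note sp = finite_onD(2)[OF M]
  have \<psi>: "bounded_test ?\<psi> 1" by (rule bounded_test_ext_unit[OF const_unit]) simp
  have "0 \<le> (LINT z|(M \<Otimes>\<^sub>M M). - coag ?\<psi> z)"
  proof (rule Bochner_Integration.integral_nonneg)
    fix z assume "z \<in> space (M \<Otimes>\<^sub>M M)"
    then have "coag_A ?\<psi> (fst z) (snd z) = - 1"
      using sp by (auto simp: space_pair_measure coag_A_def const_ext_def)
    then show "0 \<le> - coag ?\<psi> z" using K_nonneg by (simp add: coag_def)
  qed
  moreover have "- (p * mass M) \<le> (LINT x|M. loss s ?\<psi> x)"
  proof -
    interpret M: finite_measure M by (rule finite_onD(3)[OF M])
    have "(LINT x|M. - p) \<le> (LINT x|M. loss s ?\<psi> x)"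
    proof (rule integral_mono[OF _ loss_integrable[OF \<psi> s M]])
      fix x assume "x \<in> space M"
      then have x: "0 < x" "x \<le> 1" using sp by auto
      have "0 \<le> bdy K s x * ?\<psi> x"
        using bdy_nonneg[OF K_nonneg] x by simp
      moreover have "2 * F1 \<le> p" using p_ge(2) mult_nonneg_nonneg[of K1 M0] const_nonneg by linarith
      ultimately show "- p \<le> loss s ?\<psi> x"
        using frag_bound[OF \<psi> x] by (simp add: loss_def)
    qed simp
    then show ?thesis by (simp add: mult.commute)
  qed
  moreover have "(LINT x|leb01. bdy Fk s x * ?\<psi> x) \<le> p"
    using integral_bounded[OF finite_onD(3)[OF leb01(1)] source_measurable[OF \<psi> s] source_bound[OF \<psi> s]]
      p_ge(3) leb01(2) by simp
  ultimately show ?thesis unfolding generator_def by simp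
qed

lemma generator_measurable:
  assumes \<mu>: "tv_path borel01 \<mu>" and \<psi>: "bounded_test \<psi> 1"
  shows "(\<lambda>s. generator s (\<mu> s) \<psi>) \<in> borel_measurable borel_time"
proof -
  note \<psi>D = bounded_testD[OF \<psi>]
  have [measurable]: "(\<lambda>s. integral\<^sup>L (\<mu> s \<Otimes>\<^sub>M \<mu> s) (coag \<psi>)) \<in> borel_measurable borel_time"
    using const_nonneg by (intro integral_pair_path_measurable[OF \<mu> coag_measurable[OF \<psi>] coag_bound[OF \<psi>]]) auto
  have [measurable]: "(\<lambda>s. LINT x|\<mu> s. loss s \<psi> x) \<in> borel_measurable borel_time"
  proof -
    \<comment> \<open>Absorbing the test function into the kernel makes the loss to the boundary a
      boundary integral again; the fragmentation part is one fixed bounded function for all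
      times.\<close>
    note tk = tail_kernel_mult[OF tail_kernel_K \<psi>D(1,2)]
    have f: "frag_B F \<psi> \<in> bdd_fun borel01"
      by (rule bdd_funI[of _ _ "2 * F1 * 1"])
        (use frag_bound[OF \<psi>] frag_measurable[OF \<psi>] in \<open>auto intro: measurable_restrict_space1\<close>)
    have "(\<lambda>s. (LINT x|\<mu> s. bdy (\<lambda>x y. K x y * \<psi> x) s x) + (LINT x|\<mu> s. frag_B F \<psi> x)) \<in> borel_measurable borel_time"
      by (intro borel_measurable_add bdy_path_measurable[OF \<mu> tk] integral_path_measurable[OF \<mu> f])
    also have "?this \<longleftrightarrow> ?thesis"
    proof (rule measurable_cong)
      fix s :: real assume "s \<in> space borel_time"
      then have s: "0 \<le> s" by simp
      note M = tv_pathD[OF \<mu> s]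
      have "integrable (\<mu> s) (bdy (\<lambda>x y. K x y * \<psi> x) s)"
        using bdy_bound[OF tk _ _ s] finite_onD(2,3)[OF M]
        by (intro integrable_bounded[where c = "K1 * 1 * M0"] finite_on_borel01_measurable[OF M] bdy_measurable[OF tk s]) auto
      from Bochner_Integration.integral_add[OF this finite_on_integrable[OF M f]]
      show "(LINT x|\<mu> s. bdy (\<lambda>x y. K x y * \<psi> x) s x) + (LINT x|\<mu> s. frag_B F \<psi> x) = (LINT x|\<mu> s. loss s \<psi> x)"
        unfolding loss_def bdy_mult by simp
    qed
    finally show ?thesis .
  qed
  have [measurable]: "(\<lambda>s. LINT x|leb01. bdy Fk s x * \<psi> x) \<in> borel_measurable borel_time"
  proof -
    \<comment> \<open>The source is handled like the boundary loss, with Lebesgue measure as a path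
      that is constant in time.\<close>
    have "tv_path borel01 (\<lambda>_. leb01)"
      by (auto simp: tv_path_def tv_le_def leb01(1) intro!: always_eventually)
    from bdy_path_measurable[OF this tail_kernel_mult[OF tail_kernel_F \<psi>D(1,2)]]
    show ?thesis by (simp add: bdy_mult)
  qed
  show ?thesis unfolding generator_def by measurable
qed

lemma generator_evolution:
  assumes "N0 \<in> finite_on borel01"
  shows "measure_evolution borel01 (\<lambda>s M \<phi>. generator s M (ext \<phi>)) p q N0"
proof
  have ext_add: "ext (\<lambda>x. \<phi> x + \<psi> x) = (\<lambda>x. ext \<phi> x + ext \<psi> x)" for \<phi> \<psi>
    by (simp add: ext_def fun_eq_iff distrib_left)
  have ext_scale: "ext (\<lambda>x. c * \<phi> x) = (\<lambda>x. c * ext \<phi> x)" for c \<phi>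
    by (simp add: ext_def fun_eq_iff)
  show "p > 0" "q \<ge> 0" using p_ge(1) const_nonneg by (auto simp: q_def)
  show "N0 \<in> finite_on borel01" by fact
  fix s :: real and M :: "real measure" assume s: "0 \<le> s" and M: "M \<in> finite_on borel01"
  show "generator s M (ext (\<lambda>x. \<phi> x + \<psi> x)) = generator s M (ext \<phi>) + generator s M (ext \<psi>)"
    if \<phi>: "\<phi> \<in> bdd_fun borel01" and \<psi>: "\<psi> \<in> bdd_fun borel01" for \<phi> \<psi>
  proof -
    obtain c where "bounded_test (ext \<phi>) c" by (rule bounded_test_ext_bdd[OF \<phi>])
    moreover obtain d where "bounded_test (ext \<psi>) d" by (rule bounded_test_ext_bdd[OF \<psi>])
    ultimately show ?thesis unfolding ext_add by (rule generator_add[OF s M])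
  qed
  show "generator s M (ext (\<lambda>x. c * \<phi> x)) = c * generator s M (ext \<phi>)" for c \<phi>
    unfolding ext_scale by (rule generator_scale)
  show "(\<lambda>n. generator s M (ext (\<phi> n))) \<longlonglongrightarrow> generator s M (ext \<phi>')"
    if \<phi>: "\<And>n. \<phi> n \<in> unit_fun borel01" "\<And>x. x \<in> space borel01 \<Longrightarrow> (\<lambda>n. \<phi> n x) \<longlonglongrightarrow> \<phi>' x" for \<phi> \<phi>'
  proof (rule generator_lim[OF s M, where c = 1])
    show "bounded_test (ext (\<phi> n)) 1" for n by (rule bounded_test_ext_unit[OF \<phi>(1)])
    show "bounded_test (ext \<phi>') 1" by (rule bounded_test_ext_unit[OF unit_fun_limit[OF \<phi>]])
    show "(\<lambda>n. ext (\<phi> n) x) \<longlonglongrightarrow> ext \<phi>' x" for x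
      using \<phi>(2)[of x] by (cases "x \<in> {0<..1}") (auto simp: ext_def)
  qed
  show "\<bar>generator s M (ext \<phi>)\<bar> \<le> p + (p + q * R) * R" if "mass M \<le> R" "\<phi> \<in> unit_fun borel01" for \<phi> R
    by (rule generator_bound[OF s M that(1) bounded_test_ext_unit[OF that(2)]])
  show "\<bar>generator s M (ext \<phi>) - generator s N (ext \<phi>)\<bar> \<le> (p + q * R) * e"
    if "N \<in> finite_on borel01" "mass M \<le> R" "mass N \<le> R" "tv_le borel01 M N e" "\<phi> \<in> unit_fun borel01" for N \<phi> R e
    by (rule generator_lip[OF s M that(1-4) bounded_test_ext_unit[OF that(5)]])
  show "0 \<le> (p + q * R) * (LINT x|M. \<phi> x) + generator s M (ext \<phi>)"
    if "mass M \<le> R" "\<phi> \<in> unit_fun borel01" "\<And>x. x \<in> space borel01 \<Longrightarrow> 0 \<le> \<phi> x" for \<phi> R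
  proof -
    have "(LINT x|M. \<phi> x) = (LINT x|M. ext \<phi> x)"
      using finite_onD(2)[OF M] by (intro Bochner_Integration.integral_cong) auto
    moreover have "0 \<le> ext \<phi> x" for x
      using that(3)[of x] by (simp add: ext_def indicator_def)
    ultimately show ?thesis
      using generator_pos[OF s M that(1) bounded_test_ext_unit[OF that(2)]] by simp
  qed
  show "generator s M (ext (\<lambda>_. 1)) \<le> p * mass M + p" by (rule generator_mass[OF s M])
next
  fix \<mu> \<phi> assume "tv_path borel01 \<mu>" "\<phi> \<in> unit_fun borel01"
  then show "(\<lambda>s. generator s (\<mu> s) (ext \<phi>)) \<in> borel_measurable borel_time"
    by (intro generator_measurable bounded_test_ext_unit)
qed

end

section \<open>Reduction to globally defined coefficients\<close>

text \<open>Zero extension from the open quadrant: the assumptions on the kernels speak of positive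
  arguments only, while the generator is built from Borel functions on the plane.\<close>

definition cut_pos :: "(real \<Rightarrow> real \<Rightarrow> real) \<Rightarrow> real \<Rightarrow> real \<Rightarrow> real" where
  "cut_pos K x y = (if 0 < x \<and> 0 < y then K x y else 0)"

text \<open>At nonnegative times the positive part alters the given representative on
  (1,\<infinity>) only on a null set, since nonnegativity holds almost everywhere. So all boundary
  integrals keep their values.\<close>

definition cut_datum :: "(real \<Rightarrow> real \<Rightarrow> real) \<Rightarrow> real \<Rightarrow> real \<Rightarrow> real" where
  "cut_datum g s y = (if 1 < y then max 0 (g s y) else 0)"

lemma cut_pos_measurable:
  assumes "(\<lambda>(x, y). K x y) \<in> borel_measurable (restrict_space borel ({0<..} \<times> {0<..}))"
  shows "(\<lambda>z. cut_pos K (fst z) (snd z)) \<in> borel_measurable borel"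
proof -
  have "{0<..} \<times> {0<..} \<inter> space borel \<in> sets (borel :: (real \<times> real) measure)"
    by (simp add: borel_open open_Times)
  then have "(\<lambda>z. indicator ({0<..} \<times> {0<..}) z *\<^sub>R (case z of (x, y) \<Rightarrow> K x y)) \<in> borel_measurable borel"
    using assms by (simp only: borel_measurable_restrict_space_iff)
  also have "(\<lambda>z. indicator ({0<..} \<times> {0<..}) z *\<^sub>R (case z of (x, y) \<Rightarrow> K x y)) = (\<lambda>z. cut_pos K (fst z) (snd z))"
    by (auto simp: cut_pos_def fun_eq_iff indicator_def)
  finally show ?thesis .
qed

lemma boundary_datum_measurable:
  assumes "boundary_datum g" "0 \<le> s"
  shows "(\<lambda>y. indicator {1<..} y * g s y) \<in> borel_measurable borel"
    "integrable lborel (\<lambda>y. indicator {1<..} y * g s y)"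
  using assms borel_measurable_integrable[of lborel "\<lambda>y. indicator {1<..} y * g s y"]
  by (auto simp: boundary_datum_def set_integrable_def)

lemma cut_datum_eq: "cut_datum g s y = max 0 (indicator {1<..} y * g s y)"
  by (simp add: cut_datum_def indicator_def)

lemma cut_datum_AE:
  assumes "boundary_datum g" "0 \<le> s"
  shows "AE y in lborel. indicator {1<..} y * g s y = cut_datum g s y"
proof -
  have "AE y in lborel. 1 < y \<longrightarrow> 0 \<le> g s y" using assms by (simp add: boundary_datum_def)
  then show ?thesis by eventually_elim (simp add: cut_datum_def indicator_def)
qed

lemma cut_datum_integrable:
  assumes "boundary_datum g" "0 \<le> s"
  shows "cut_datum g s \<in> borel_measurable borel" "integrable lborel (cut_datum g s)"
proof -
  note b = boundary_datum_measurable[OF assms]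
  show "cut_datum g s \<in> borel_measurable borel"
    unfolding cut_datum_eq[abs_def] using b(1) by measurable
  show "integrable lborel (cut_datum g s)"
    unfolding cut_datum_eq[abs_def] using b(2) by (intro integrable_max) auto
qed

text \<open>Taking the positive part is 1-Lipschitz, so distances in L1 do not grow.\<close>

lemma cut_datum_continuous:
  assumes g: "boundary_datum g" and t: "0 \<le> t"
  shows "((\<lambda>s. LBINT y. \<bar>cut_datum g s y - cut_datum g t y\<bar>) \<longlongrightarrow> 0) (at t within {0..})"
proof (rule tendsto_sandwich[OF _ _ tendsto_const])
  show "((\<lambda>s. LINT x:{1<..}|lborel. \<bar>g s x - g t x\<bar>) \<longlongrightarrow> 0) (at t within {0..})"
    using g t by (simp add: boundary_datum_def)
  have "(LBINT y. \<bar>cut_datum g s y - cut_datum g t y\<bar>) \<le> (LINT x:{1<..}|lborel. \<bar>g s x - g t x\<bar>)" if "0 \<le> s" for s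
    unfolding set_lebesgue_integral_def
  proof (rule integral_mono)
    show "integrable lborel (\<lambda>y. \<bar>cut_datum g s y - cut_datum g t y\<bar>)"
      using cut_datum_integrable(2)[OF g] that t by simp
    have "integrable lborel (\<lambda>y. \<bar>indicator {1<..} y * g s y - indicator {1<..} y * g t y\<bar>)"
      using boundary_datum_measurable(2)[OF g] that t by simp
    then show "integrable lborel (\<lambda>y. indicator {1<..} y *\<^sub>R \<bar>g s y - g t y\<bar>)"
      by (rule Bochner_Integration.integrable_cong[THEN iffD1, rotated 2]) (auto simp: indicator_def)
    show "\<bar>cut_datum g s y - cut_datum g t y\<bar> \<le> indicator {1<..} y *\<^sub>R \<bar>g s y - g t y\<bar>" for y
      by (auto simp: cut_datum_def indicator_def max_def)
  qed
  then show "\<forall>\<^sub>F s in at t within {0..}. (LBINT y. \<bar>cut_datum g s y - cut_datum g t y\<bar>)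
      \<le> (LINT x:{1<..}|lborel. \<bar>g s x - g t x\<bar>)"
    by (auto simp: eventually_at_filter)
qed simp

lemma cut_datum_moment:
  assumes g: "boundary_datum g" and s: "0 \<le> s" and fin: "boundary_moment g r < \<infinity>"
  shows "integrable lborel (\<lambda>y. y powr r * cut_datum g s y)"
    "(LBINT y. y powr r * cut_datum g s y) \<le> enn2real (boundary_moment g r)"
proof -
  note [measurable] = cut_datum_integrable(1)[OF g s]
  have nonneg: "0 \<le> y powr r * cut_datum g s y" for y by (simp add: cut_datum_def)
  have "(\<integral>\<^sup>+y. ennreal (y powr r * cut_datum g s y) \<partial>lborel) = (\<integral>\<^sup>+y\<in>{1<..}. ennreal (y powr r * g s y) \<partial>lborel)"
  proof (rule nn_integral_cong)
    fix y :: real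
    \<comment> \<open>\<open>ennreal\<close> sends negative numbers to 0, hence
      \<open>boundary_moment\<close> already is the moment of the positive part.\<close>
    have "ennreal (y powr r * max 0 (g s y)) = ennreal (y powr r * g s y)"
      by (cases "0 \<le> g s y") (auto simp: max_def ennreal_neg mult_nonneg_nonpos)
    then show "ennreal (y powr r * cut_datum g s y) = ennreal (y powr r * g s y) * indicator {1<..} y"
      by (simp add: cut_datum_def indicator_def)
  qed
  also have "\<dots> \<le> boundary_moment g r"
    unfolding boundary_moment_def using s by (intro SUP_upper) auto
  finally have le: "(\<integral>\<^sup>+y. ennreal (y powr r * cut_datum g s y) \<partial>lborel) \<le> boundary_moment g r" .
  show "integrable lborel (\<lambda>y. y powr r * cut_datum g s y)"
    using le fin nonneg by (intro integrableI_nonneg) (auto intro: order_le_less_trans)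
  show "(LBINT y. y powr r * cut_datum g s y) \<le> enn2real (boundary_moment g r)"
    using le fin nonneg by (subst integral_eq_nn_integral) (auto intro: enn2real_mono)
qed

text \<open>The constant 2 F_0 serves two purposes. For a fragmenting x <= 1 both fragment sizes are
  at most 1, and so are their powers; for y > 1 >= x both y - x and x are below y, so each power is
  at most y^\<gamma>, hence at most y^max(\<beta>, \<gamma>).\<close>

lemma cut_coagulation_fragmentation:
  assumes \<beta>: "\<beta> \<in> {0..1}" and \<gamma>: "\<gamma> \<in> {0..1}" and F0: "0 \<le> F\<^sub>0"
    and K: "bounded_coagulation_kernel \<beta> K"
    and F_cont: "continuous_on ({0<..} \<times> {0<..}) (\<lambda>(x, y). F x y)"
    and F_nonneg: "\<And>x y. 0 < x \<Longrightarrow> 0 < y \<Longrightarrow> 0 \<le> F x y"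
    and F_le: "\<And>x y. 0 < x \<Longrightarrow> 0 < y \<Longrightarrow> F x y \<le> F\<^sub>0 * (x powr \<gamma> + y powr \<gamma>)"
    and g: "boundary_datum g"
    and moment: "boundary_moment g (max \<beta> \<gamma>) < \<infinity>"
  shows "\<exists>K0 K1. coagulation_fragmentation (cut_pos K) (cut_pos F) (cut_datum g) K0 K1
    (2 * F\<^sub>0) (enn2real (boundary_moment g (max \<beta> \<gamma>))) (max \<beta> \<gamma>)"
proof -
  let ?m = "max \<beta> \<gamma>"
  have "bdd_above ((\<lambda>(x, y). K x y) ` ({0<..1} \<times> {0<..1}))"
    using K by (simp add: bounded_coagulation_kernel_def)
  then obtain B where "\<forall>x\<in>{0<..1}. \<forall>y\<in>{0<..1}. K x y \<le> B"
    by (auto simp: bdd_above_def)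
  then have B: "K x y \<le> B" if "x \<in> {0<..1}" "y \<in> {0<..1}" for x y
    using that by blast
  obtain K\<^sub>\<beta> where K\<^sub>\<beta>_pos: "K\<^sub>\<beta> > 0" and "\<forall>y>1. \<forall>x\<in>{0<..1}. K x y \<le> K\<^sub>\<beta> * y powr \<beta>"
    using K unfolding bounded_coagulation_kernel_def by blast
  then have K\<^sub>\<beta>: "K x y \<le> K\<^sub>\<beta> * y powr \<beta>" if "1 < y" "x \<in> {0<..1}" for x y
    using that by blast
  have K_nonneg: "0 < x \<Longrightarrow> 0 < y \<Longrightarrow> 0 \<le> K x y" for x y
    using K by (auto simp: bounded_coagulation_kernel_def)
  have "coagulation_fragmentation (cut_pos K) (cut_pos F) (cut_datum g) (max 0 B) K\<^sub>\<beta>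
    (2 * F\<^sub>0) (enn2real (boundary_moment g ?m)) ?m"
  proof
    show "(\<lambda>z. cut_pos K (fst z) (snd z)) \<in> borel_measurable borel"
      using K by (intro cut_pos_measurable) (simp add: bounded_coagulation_kernel_def)
    show "(\<lambda>z. cut_pos F (fst z) (snd z)) \<in> borel_measurable borel"
      by (intro cut_pos_measurable borel_measurable_continuous_on_restrict F_cont)
    show "0 \<le> cut_pos K x y" "0 \<le> cut_pos F x y" for x y
      using K_nonneg F_nonneg by (auto simp: cut_pos_def)
    show "cut_pos K x y \<le> max 0 B" if "0 < x" "x \<le> 1" "0 < y" "y \<le> 1" for x y
      using that B[of x y] by (simp add: cut_pos_def)
    show "cut_pos K x y \<le> K\<^sub>\<beta> * y powr ?m" if "0 < x" "x \<le> 1" "1 < y" for x y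
    proof -
      have "K x y \<le> K\<^sub>\<beta> * y powr \<beta>" using that by (intro K\<^sub>\<beta>) auto
      also have "\<dots> \<le> K\<^sub>\<beta> * y powr ?m"
        using that K\<^sub>\<beta>_pos by (intro mult_left_mono powr_mono) auto
      finally show ?thesis using that by (simp add: cut_pos_def)
    qed
    show "cut_pos F (x - y) y \<le> 2 * F\<^sub>0" if "0 < y" "y < x" "x \<le> 1" for x y
    proof -
      have "(x - y) powr \<gamma> \<le> 1" "y powr \<gamma> \<le> 1"
        using that \<gamma> by (auto intro!: powr_le1)
      then have "F\<^sub>0 * ((x - y) powr \<gamma> + y powr \<gamma>) \<le> F\<^sub>0 * 2"
        using F0 by (intro mult_left_mono) auto
      then show ?thesis
        using F_le[of "x - y" y] that by (simp add: cut_pos_def)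
    qed
    show "cut_pos F (y - x) x \<le> 2 * F\<^sub>0 * y powr ?m" if "0 < x" "x \<le> 1" "1 < y" for x y
    proof -
      have "(y - x) powr \<gamma> \<le> y powr \<gamma>" "x powr \<gamma> \<le> y powr \<gamma>"
        using that \<gamma> by (auto intro!: powr_mono2)
      moreover have "y powr \<gamma> \<le> y powr ?m"
        using that by (intro powr_mono) auto
      ultimately have "F\<^sub>0 * ((y - x) powr \<gamma> + x powr \<gamma>) \<le> F\<^sub>0 * (2 * y powr ?m)"
        using F0 by (intro mult_left_mono) auto
      then show ?thesis
        using F_le[of "y - x" x] that by (simp add: cut_pos_def)
    qed
    show "0 \<le> cut_datum g s y" "y \<le> 1 \<Longrightarrow> cut_datum g s y = 0" for s y
      by (auto simp: cut_datum_def)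
    show "0 \<le> max 0 B" "0 \<le> K\<^sub>\<beta>" "0 \<le> 2 * F\<^sub>0" "0 \<le> enn2real (boundary_moment g ?m)" "0 \<le> ?m"
      using K\<^sub>\<beta>_pos F0 \<beta> by auto
  qed (use cut_datum_integrable[OF g] cut_datum_moment[OF g _ moment] cut_datum_continuous[OF g] in auto)
  then show ?thesis by blast
qed

lemma boundary_integral_cut:
  assumes g: "boundary_datum g" and s: "0 \<le> s" and k: "k \<in> borel_measurable borel"
    and eq: "\<And>y. 1 < y \<Longrightarrow> k' y = k y"
  shows "(LINT y:{1<..}|lborel. k' y * g s y) = (LBINT y. k y * cut_datum g s y)"
proof -
  have "(LINT y:{1<..}|lborel. k' y * g s y) = (LBINT y. k y * (indicator {1<..} y * g s y))"
    unfolding set_lebesgue_integral_def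
    by (intro Bochner_Integration.integral_cong) (auto simp: eq indicator_def)
  also have "\<dots> = (LBINT y. k y * cut_datum g s y)"
  proof (rule integral_cong_AE)
    show "(\<lambda>y. k y * (indicator {1<..} y * g s y)) \<in> borel_measurable lborel"
      using k boundary_datum_measurable(1)[OF g s] by simp
    show "(\<lambda>y. k y * cut_datum g s y) \<in> borel_measurable lborel"
      using k cut_datum_integrable(1)[OF g s] by simp
    show "AE y in lborel. k y * (indicator {1<..} y * g s y) = k y * cut_datum g s y"
      using cut_datum_AE[OF g s] by eventually_elim simp
  qed
  finally show ?thesis .
qed

text \<open>On every range of integration the kernel arguments are positive: x - y > 0 for y in
  (0,x), and y - x > 0 for x <= 1 < y. The test function is read only on (0,1], so cutting the
  kernels and extending \<phi> by zero change no integrand.\<close>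

lemma weak_rhs_cut:
  assumes C: "coagulation_fragmentation (cut_pos K) (cut_pos F) (cut_datum g) K0 K1 F1 M0 m"
    and g: "boundary_datum g" and s: "0 \<le> s" and M: "\<mu> s \<in> finite_on borel01"
  shows "weak_rhs K F g \<mu> \<phi> s
    = coagulation_fragmentation.generator (cut_pos K) (cut_pos F) (cut_datum g) s (\<mu> s) (ext \<phi>)"
proof -
  interpret C: coagulation_fragmentation "cut_pos K" "cut_pos F" "cut_datum g" K0 K1 F1 M0 m by (rule C)
  note sp = finite_onD(2)[OF M]
  have "(LINT z|(\<mu> s \<Otimes>\<^sub>M \<mu> s). K (fst z) (snd z) * coag_A \<phi> (fst z) (snd z)) = integral\<^sup>L (\<mu> s \<Otimes>\<^sub>M \<mu> s) (C.coag (ext \<phi>))"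
    by (intro Bochner_Integration.integral_cong)
      (auto simp: space_pair_measure sp C.coag_def cut_pos_def coag_A_def const_ext_def)
  moreover have "(LINT x|\<mu> s. boundary_G K g s x * \<phi> x + frag_B F \<phi> x) = (LINT x|\<mu> s. C.loss s (ext \<phi>) x)"
  proof (rule Bochner_Integration.integral_cong)
    fix x assume "x \<in> space (\<mu> s)"
    then have x: "0 < x" "x \<le> 1" using sp by auto
    have "boundary_G K g s x = C.bdy (cut_pos K) s x"
      unfolding boundary_G_def C.bdy_def
      by (rule boundary_integral_cut[OF g s C.tail_kernel_section[OF C.tail_kernel_K]])
        (use x in \<open>simp add: cut_pos_def\<close>)
    moreover have "frag_B F \<phi> x = frag_B (cut_pos F) (ext \<phi>) x"
      unfolding frag_B_eq using x
      by (intro arg_cong2[of _ _ _ _ "(*)"] refl Bochner_Integration.integral_cong) (auto simp: cut_pos_def)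
    ultimately show "boundary_G K g s x * \<phi> x + frag_B F \<phi> x = C.loss s (ext \<phi>) x"
      using x by (simp add: C.loss_def)
  qed simp
  moreover have "(LINT x:{0<..1}|lborel. boundary_C F g s x * \<phi> x)
      = (LINT x|leb01. C.bdy (\<lambda>x y. cut_pos F (y - x) x) s x * ext \<phi> x)"
  proof -
    have "(LINT x:{0<..1}|lborel. boundary_C F g s x * \<phi> x) = (LINT x|leb01. boundary_C F g s x * \<phi> x)"
      by (simp add: set_lebesgue_integral_def integral_restrict_space)
    also have "\<dots> = (LINT x|leb01. C.bdy (\<lambda>x y. cut_pos F (y - x) x) s x * ext \<phi> x)"
    proof (rule Bochner_Integration.integral_cong)
      fix x assume "x \<in> space leb01"
      then have x: "0 < x" "x \<le> 1" by auto
      have "boundary_C F g s x = C.bdy (\<lambda>x y. cut_pos F (y - x) x) s x"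
        unfolding boundary_C_def C.bdy_def
        by (rule boundary_integral_cut[OF g s C.tail_kernel_section[OF C.tail_kernel_F]])
          (use x in \<open>simp add: cut_pos_def\<close>)
      then show "boundary_C F g s x * \<phi> x = C.bdy (\<lambda>x y. cut_pos F (y - x) x) s x * ext \<phi> x"
        using x by simp
    qed simp
    finally show ?thesis .
  qed
  ultimately show ?thesis unfolding weak_rhs_def C.generator_def by simp
qed

theorem proposition2p3:
  fixes \<beta> \<gamma> F\<^sub>0 :: real
    and K F g :: "real \<Rightarrow> real \<Rightarrow> real"
    and \<mu>\<^sub>i\<^sub>n :: "real measure"
  assumes "\<beta> \<in> {0..1}" and "\<gamma> \<in> {0..1}" and "0 \<le> F\<^sub>0"
    and "bounded_coagulation_kernel \<beta> K"
    and "continuous_on ({0<..} \<times> {0<..}) (\<lambda>(x, y). F x y)"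
    and "\<And>x y. 0 < x \<Longrightarrow> 0 < y \<Longrightarrow> 0 \<le> F x y"
    and "\<And>x y. 0 < x \<Longrightarrow> 0 < y \<Longrightarrow> F x y = F y x"
    and "\<And>x y. 0 < x \<Longrightarrow> 0 < y \<Longrightarrow> F x y \<le> F\<^sub>0 * (x powr \<gamma> + y powr \<gamma>)"
    and "\<mu>\<^sub>i\<^sub>n \<in> finite_measures"
    and "boundary_datum g"
    and "boundary_moment g (max \<beta> \<gamma>) < \<infinity>"
  shows "\<exists>\<mu>. weak_solution K F g \<mu>\<^sub>i\<^sub>n \<mu> \<and>
           (\<forall>\<nu>. weak_solution K F g \<mu>\<^sub>i\<^sub>n \<nu> \<longrightarrow> (\<forall>t\<ge>0. \<nu> t = \<mu> t))"
proof -
  obtain K0 K1 where C: "coagulation_fragmentation (cut_pos K) (cut_pos F) (cut_datum g) K0 K1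
      (2 * F\<^sub>0) (enn2real (boundary_moment g (max \<beta> \<gamma>))) (max \<beta> \<gamma>)"
    using cut_coagulation_fragmentation[OF assms(1-6,8,10,11)] by blast
  interpret C: coagulation_fragmentation "cut_pos K" "cut_pos F" "cut_datum g" K0 K1
      "2 * F\<^sub>0" "enn2real (boundary_moment g (max \<beta> \<gamma>))" "max \<beta> \<gamma>"
    by (rule C)
  interpret E: measure_evolution borel01 "\<lambda>s M \<phi>. C.generator s M (ext \<phi>)" C.p C.q \<mu>\<^sub>i\<^sub>n
    using assms(9) by (intro C.generator_evolution) (simp add: finite_measures_eq)
  \<comment> \<open>Both notions of solution agree for each fixed path, not only for the constructed
    one, so uniqueness transfers along with existence.\<close>
  have "weak_solution K F g \<mu>\<^sub>i\<^sub>n \<mu> \<longleftrightarrow> E.evolves \<mu>" for \<mu>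
  proof -
    have bdd: "\<phi> \<in> borel_measurable borel01 \<and> bounded (\<phi> ` {0<..1}) \<longleftrightarrow> \<phi> \<in> bdd_fun borel01" for \<phi>
      by (simp add: bdd_fun_def)
    have rhs: "(LINT s:{0..t}|lborel. weak_rhs K F g \<mu> \<phi> s) = (LINT s|leb_upto t. C.generator s (\<mu> s) (ext \<phi>))"
      if "\<And>t. 0 \<le> t \<Longrightarrow> \<mu> t \<in> finite_on borel01" for t \<phi>
      unfolding set_integral_leb_upto
      by (intro Bochner_Integration.integral_cong refl weak_rhs_cut[OF C assms(10)] that) auto
    \<comment> \<open>\<open>tv_path\<close> includes finiteness at nonnegative times, and this is
      exactly what its equivalence with \<open>tv_continuous\<close> presupposes.\<close>
    have path: "tv_path borel01 \<mu> \<longleftrightarrow> (\<forall>t\<ge>0. \<mu> t \<in> finite_on borel01) \<and> tv_continuous \<mu>"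
      using tv_path_iff_tv_continuous[of \<mu> borel01] by (auto simp: tv_path_def)
    show ?thesis
      unfolding weak_solution_def E.evolves_def finite_measures_eq path bdd
      by (auto simp: rhs)
  qed
  then show ?thesis
    using E.evolution_exists E.evolution_unique by blast
qed

end
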